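(* Let $\alpha\in(0,2)$. There exist a vortex $g$ in the class $\mathfrak{G}$, an integer $k$ with $|k|\ge2$, $0<\varepsilon<1$ and $\beta_0>0$ such that the following holds: for all $\beta\ge\beta_0$ there exists $(\phi,\lambda_\beta)\in\dot H^1\times\mathbb{C}$ with $\phi\not\equiv0$ and $\mathrm{Re}(\lambda_\beta)>\varepsilon/2$, solving the self-similar Rayleigh equation $$\Big(ikv(r)-\frac{1}{\alpha\beta}\big(r\partial_r+\tfrac12\big)+\lambda_\beta\Big)\mathrm{L}_k(\phi)-ik\frac{g'(r)}{r}\phi=0,\qquad r\in(0,\infty).$$
   Context: Here $v(r)=\frac1{r^2}\int_0^r\rho\,g(\rho)\,d\rho$ and $\mathrm{L}_k(\phi)=\phi''-\frac1{r^2}\big(k^2-\frac14\big)\phi$, with $\phi\to0$ as $r\to0^+$ and as $r\to\infty$. The space $\dot H^1$ is the space of complex-valued functions on the radial half-line $(0,\infty)$ with finite norm given by $\|f\|_{\dot H^1}^2=\|\partial_rf\|_{L^2(dr)}^2+\|r^{-1}f\|_{L^2(dr)}^2$. The equation is understood in the sense of distributions on $(0,\infty)$. The class $\mathfrak{G}$ consists of real functions $g$ of the radial variable $r\ge0$ such that: (i) $g$ is smooth with compact support and $\mathrm{supp}(g)\subseteq[0,r_0]$ for a finite $r_0>0$; (ii) $g(r)=g_0-\gamma_0r^2$ for $r\in[0,\delta_0]$, for some $\delta_0\in(0,1)$ and $g_0,\gamma_0>0$ such that $g>0$ on $[0,\delta_0]$; (iii) there are $r_1\in(0,r_0)$, $g_1>0$,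 $\delta_1\in(0,1)$, $\gamma_1>0$ with $g(r)=-g_1+\frac12\gamma_1(r-r_1)^2$ for $r\in[r_1-\delta_1,r_1+\delta_1]$ (in particular $g'(r_1)=0$); (iv) $g'\le0$ on $[0,r_1]$ and $g'\ge0$ on $(r_1,r_0)$; (v) $\int_0^\infty g(r)\,r\,dr=0$. *)

theory Defs
  imports "HOL-Analysis.Analysis"
begin

text \<open>
  A function of the radial variable is a function on \<^typ>\<open>real\<close> of which only the values on
  the half-line matter: nothing below depends on the values of the vortex at negative arguments.
  Derivatives are therefore taken within the domain (one-sided at an end point).
\<close>

definition smooth_on :: "real set \<Rightarrow> (real \<Rightarrow> 'a::real_normed_vector) \<Rightarrow> bool" where
  "smooth_on S f \<longleftrightarrow>
     (\<exists>F. (\<forall>x\<in>S. F 0 x = f x) \<and>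
          (\<forall>n::nat. \<forall>x\<in>S. (F n has_vector_derivative F (Suc n) x) (at x within S)))"

definition rderiv :: "(real \<Rightarrow> real) \<Rightarrow> real \<Rightarrow> real" where
  "rderiv g r = vector_derivative g (at r within {0..})"

definition vortex_class :: "(real \<Rightarrow> real) set" where
  "vortex_class =
     {g. smooth_on {0..} g \<and>
         (\<exists>r0 r1 g0 g1 \<gamma>0 \<gamma>1 \<delta>0 \<delta>1.
            0 < r0 \<and> closure {r \<in> {0..}. g r \<noteq> 0} \<subseteq> {0..r0} \<and>
            0 < \<delta>0 \<and> \<delta>0 < 1 \<and> 0 < g0 \<and> 0 < \<gamma>0 \<and>
            (\<forall>r\<in>{0..\<delta>0}. g r = g0 - \<gamma>0 * r\<^sup>2 \<and> 0 < g r) \<and>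
            0 < r1 \<and> r1 < r0 \<and> 0 < g1 \<and> 0 < \<delta>1 \<and> \<delta>1 < 1 \<and> 0 < \<gamma>1 \<and>
            0 \<le> r1 - \<delta>1 \<and>
            (\<forall>r\<in>{r1 - \<delta>1..r1 + \<delta>1}. g r = - g1 + 1/2 * \<gamma>1 * (r - r1)\<^sup>2) \<and>
            (\<forall>r\<in>{0..r1}. rderiv g r \<le> 0) \<and>
            (\<forall>r\<in>{r1<..<r0}. 0 \<le> rderiv g r)) \<and>
         integral {0..} (\<lambda>r. g r * r) = 0}"

definition angular_velocity :: "(real \<Rightarrow> real) \<Rightarrow> real \<Rightarrow> real" where
  "angular_velocity g r = 1 / r\<^sup>2 * integral {0..r} (\<lambda>\<rho>. \<rho> * g \<rho>)"

text \<open>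
  Test functions on the open half-line are represented by their extension by zero to the whole
  line. Distributions are represented as functionals on test functions; the values at other
  arguments are irrelevant. All distributions used here arise from locally integrable functions
  by differentiation and by multiplication with functions that are smooth on the open half-line.
\<close>

definition test_fun :: "(real \<Rightarrow> complex) \<Rightarrow> bool" where
  "test_fun \<eta> \<longleftrightarrow> smooth_on UNIV \<eta> \<and> (\<exists>a b. 0 < a \<and> (\<forall>r. r \<notin> {a..b} \<longrightarrow> \<eta> r = 0))"

type_synonym distr = "(real \<Rightarrow> complex) \<Rightarrow> complex"

definition regular :: "(real \<Rightarrow> complex) \<Rightarrow> distr" where
  "regular f = (\<lambda>\<eta>. LINT r|lebesgue_on {0<..}. f r * \<eta> r)"

definition ddiff :: "distr \<Rightarrow> distr" where
  "ddiff T = (\<lambda>\<eta>. - T (\<lambda>r. vector_derivative \<eta> (at r)))"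

definition dmult :: "(real \<Rightarrow> complex) \<Rightarrow> distr \<Rightarrow> distr" where
  "dmult a T = (\<lambda>\<eta>. T (\<lambda>r. a r * \<eta> r))"

definition L_op :: "int \<Rightarrow> distr \<Rightarrow> distr" where
  "L_op k T = (\<lambda>\<eta>. ddiff (ddiff T) \<eta>
                   - dmult (\<lambda>r. of_real (1 / r\<^sup>2 * ((of_int k)\<^sup>2 - 1/4))) T \<eta>)"

definition square_integrable :: "(real \<Rightarrow> complex) \<Rightarrow> bool" where
  "square_integrable f \<longleftrightarrow>
     f \<in> borel_measurable (lebesgue_on {0<..}) \<and>
     integrable (lebesgue_on {0<..}) (\<lambda>r. (cmod (f r))\<^sup>2)"

text \<open>Finiteness of the norm: the weak derivative and the quotient by \<open>r\<close> are in \<open>L\<^sup>2(dr)\<close>.\<close>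

definition Hdot1 :: "(real \<Rightarrow> complex) set" where
  "Hdot1 = {f. square_integrable (\<lambda>r. of_real (1 / r) * f r) \<and>
               (\<exists>f'. square_integrable f' \<and>
                     (\<forall>\<eta>. test_fun \<eta> \<longrightarrow> ddiff (regular f) \<eta> = regular f' \<eta>))}"

text \<open>
  The boundary condition at infinity does not follow from membership in \<^const>\<open>Hdot1\<close>
  (consider a power \<open>r powr (1/4)\<close> at infinity), hence both boundary conditions are stated.
\<close>

definition solves_rayleigh ::
  "real \<Rightarrow> real \<Rightarrow> (real \<Rightarrow> real) \<Rightarrow> int \<Rightarrow> (real \<Rightarrow> complex) \<Rightarrow> complex \<Rightarrow> bool" where
  "solves_rayleigh \<alpha> \<beta> g k \<phi> \<mu> \<longleftrightarrow>
     (\<phi> \<longlongrightarrow> 0) (at_right 0) \<and> (\<phi> \<longlongrightarrow> 0) at_top \<and>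
     (let W = L_op k (regular \<phi>) in
       \<forall>\<eta>. test_fun \<eta> \<longrightarrow>
         dmult (\<lambda>r. \<i> * of_int k * of_real (angular_velocity g r)) W \<eta>
         - of_real (1 / (\<alpha> * \<beta>)) * (dmult of_real (ddiff W) \<eta> + 1/2 * W \<eta>)
         + \<mu> * W \<eta>
         - dmult (\<lambda>r. \<i> * of_int k * of_real (rderiv g r / r)) (regular \<phi>) \<eta> = 0)"

end

theory Submission
  imports Defs
begin

text \<open>
  Take \<open>k = 2\<close>, put \<open>B = \<alpha> \<beta>\<close>, and write \<open>\<phi> = r\<^sup>-\<^sup>3\<^sup>/\<^sup>2 u\<close>. Then the equation is the first order system
  \<open>u' = r\<^sup>3 y\<close>, \<open>y' = h / r\<^sup>2\<close>, \<open>h' = (B / r) ((2 i v + c) h - 2 i g' u / r\<^sup>2)\<close>, where \<open>c\<close> is the eigenvalue.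
  Outside the support of the vortex a decaying mode has \<open>u = 1\<close> and \<open>y = h = 0\<close>; solving inwards from there, \<open>c\<close> is an
  eigenvalue as soon as \<open>D c = u(0)\<close> vanishes. The inward problem is a Volterra equation
  \<open>u(r) = 1 + \<integral>\<^sub>r H(r, t) g'(t) u(t) dt\<close> whose kernel is bounded uniformly in \<open>B\<close> and satisfies
  \<open>H(r, t) = i (1 - (r / t)\<^sup>4) / (2 (2 i v + c)) + O(1 / B)\<close>. Only the measure \<open>g' dt\<close> enters, so for large \<open>B\<close> and
  for a smooth \<open>g\<close> close to the step profile with values \<open>2\<close> on \<open>[0, 1]\<close>, \<open>-2\<close> on \<open>[1, sqrt 2]\<close> and \<open>0\<close> beyond,
  \<open>D\<close> is uniformly close to the explicit function \<open>D0\<close> of the step profile, and \<open>c (2 i + c) D0 c = c\<^sup>2 + i c - 1 / 2\<close> has the root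
  \<open>(1 - i) / 2\<close> with positive real part. Since \<open>D\<close> is continuous, Brouwer's theorem gives a zero of \<open>D\<close> near this root.
\<close>

section \<open>Integrals up to a fixed end point\<close>

text \<open>The power \<open>r powr (-3/2)\<close> is the decaying solution of \<open>L_2\<close>.
  Reduction of order gives \<open>L_2 \<phi> = r powr (-1/2) * h\<close>, and this weight exactly
  absorbs the \<open>1/2\<close> in \<open>r d/dr + 1/2\<close>. The obstacle is large
  \<open>B\<close>: the derivative term is a singular perturbation, and the equation for
  \<open>h\<close> has coefficients of size \<open>B\<close>. Inwards is the stable direction. The
  integrating factor \<open>P\<close> has modulus \<open>r powr (B * Re c)\<close>, so
  \<open>P c r / P c s\<close> has modulus at most 1 for \<open>r \<le> s\<close>, and the factor
  \<open>B\<close> in the kernel is paid for by one integration of \<open>P\<close>. A smoothed step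
  has a large slope, so \<open>g'\<close> can only be measured by its total variation. A thin layer
  still acts like a point mass, because the kernel vanishes on the diagonal and the layer hardly
  acts on itself. The step profile has zero mass, jumps -4 at 1 and 2 at \<open>sqrt 2\<close>, and
  angular velocities 1 and 0 there. In general \<open>u\<close> tends to a nonzero constant at 0, so
  \<open>\<phi>\<close> behaves like \<open>r powr (-3/2)\<close>, which is not admissible. Once
  this constant vanishes, the system itself improves the decay to \<open>u = O(r ^ 3)\<close>,
  enough for \<open>Hdot1\<close> and the boundary condition.\<close>

lemma tail_integral_has_vector_derivative:
  fixes f :: "real \<Rightarrow> 'a::banach"
  assumes cont: "continuous_on {0<..} f" and supp: "\<And>s. R \<le> s \<Longrightarrow> f s = 0" and r: "0 < r"
  shows "((\<lambda>r. integral {r..R} f) has_vector_derivative - f r) (at r)"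
proof -
  define a where "a = r / 2"
  define b where "b = max R r + 1"
  have ab: "0 < a" "a < r" "r < b" "R < b" using r by (auto simp: a_def b_def)
  have c: "continuous_on {a..b} f"
    by (rule continuous_on_subset[OF cont]) (use ab in auto)
  have eq: "integral {x..R} f = integral {a..b} f - integral {a..x} f" if "x \<in> {a<..<b}" for x
  proof -
    have i: "f integrable_on {u..w}" if "a \<le> u" "w \<le> b" for u w
      by (rule integrable_continuous_real, rule continuous_on_subset[OF c]) (use that in auto)
    have z: "integral {u..b} f = 0" if "R \<le> u" for u
      using supp that by (intro integral_unique has_integral_is_0) auto
    have "integral {a..x} f + integral {x..b} f = integral {a..b} f"
      using that by (intro Henstock_Kurzweil_Integration.integral_combine i) auto
    moreover have "integral {x..b} f = integral {x..R} f"
    proof (cases "x \<le> R")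
      case True
      have "integral {x..R} f + integral {R..b} f = integral {x..b} f"
        using that True ab by (intro Henstock_Kurzweil_Integration.integral_combine i) auto
      then show ?thesis using z[of R] by simp
    next
      case False
      then show ?thesis using z[of x] by simp
    qed
    ultimately show ?thesis by (simp add: algebra_simps)
  qed
  have "((\<lambda>x. integral {a..x} f) has_vector_derivative f r) (at r within {a..b})"
    using ab by (intro integral_has_vector_derivative c) auto
  then have "((\<lambda>x. integral {a..x} f) has_vector_derivative f r) (at r)"
    using ab by (subst (asm) at_within_interior) auto
  then have "((\<lambda>x. integral {a..b} f - integral {a..x} f) has_vector_derivative - f r) (at r)"
    by (auto intro!: derivative_eq_intros)
  then show ?thesis
    by (rule has_vector_derivative_transform_within_open[of _ _ _ "{a<..<b}"]) (use ab eq in auto)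
qed

text \<open>The substitution \<open>s = r + t * (R - r)\<close> moves the parameter from the limits
  into an integrand over the fixed interval \<open>{0..1}\<close>. Writing \<open>min r R\<close>
  for \<open>r\<close> makes the same formula give 0 beyond \<open>R\<close>.\<close>

lemma tail_integral_continuous_on:
  fixes f :: "real \<Rightarrow> 'b::metric_space \<Rightarrow> 'a::banach"
  assumes cont: "continuous_on ({0<..} \<times> L) (\<lambda>(s, c). f s c)" and R: "0 < R"
  shows "continuous_on ({0<..} \<times> L) (\<lambda>(r, c). integral {r..R} (\<lambda>s. f s c))"
proof -
  let ?g = "\<lambda>p t. (R - min (fst p) R) *\<^sub>R f (min (fst p) R + t * (R - min (fst p) R)) (snd p)"
  have pos: "0 < min r R + t * (R - min r R)" if "0 < r" "0 \<le> t" for r t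
    using that R by (intro add_pos_nonneg mult_nonneg_nonneg) auto
  have eq: "integral {r..R} (\<lambda>s. f s c) = integral {0..1} (?g (r, c))" if r: "0 < r" and c: "c \<in> L" for r c
  proof (cases "r < R")
    case False
    then have "integral {r..R} (\<lambda>s. f s c) = 0" by (cases "r = R") auto
    then show ?thesis using False by (simp add: min_def)
  next
    case True
    have cf: "continuous_on {r..R} (\<lambda>s. f s c)"
      by (rule continuous_on_compose2[OF cont, of _ "\<lambda>s. (s, c)", simplified])
         (use r c in \<open>auto intro!: continuous_intros\<close>)
    have d: "((\<lambda>u. integral {r..u} (\<lambda>s. f s c)) has_vector_derivative f x c) (at x within {r..R})"
      if "x \<in> {r..R}" for x
      using that by (intro integral_has_vector_derivative cf)
    have "(?g (r, c) has_integral (integral {r..r + 1 * (R - r)} (\<lambda>s. f s c)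
            - integral {r..r + 0 * (R - r)} (\<lambda>s. f s c))) {0..1}"
    proof (rule fundamental_theorem_of_calculus)
      fix t :: real assume t: "t \<in> {0..1}"
      have im: "(\<lambda>t. r + t * (R - r)) ` {0..1} \<subseteq> {r..R}"
      proof safe
        fix x :: real assume "x \<in> {0..1}"
        then have "x * (R - r) \<le> 1 * (R - r)" "0 \<le> x * (R - r)" using True
          by (auto intro!: mult_right_mono)
        then show "r + x * (R - r) \<in> {r..R}" by auto
      qed
      have "((\<lambda>t. r + t * (R - r)) has_vector_derivative (R - r)) (at t within {0..1})"
        by (auto intro!: derivative_eq_intros)
      moreover have "((\<lambda>u. integral {r..u} (\<lambda>s. f s c)) has_vector_derivative f (r + t * (R - r)) c)
         (at (r + t * (R - r)) within (\<lambda>t. r + t * (R - r)) ` {0..1})"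
        by (rule has_vector_derivative_within_subset[OF d im]) (use im t in blast)
      ultimately have "((\<lambda>u. integral {r..u} (\<lambda>s. f s c)) \<circ> (\<lambda>t. r + t * (R - r)) has_vector_derivative
          (R - r) *\<^sub>R f (r + t * (R - r)) c) (at t within {0..1})"
        by (rule vector_diff_chain_within)
      then show "((\<lambda>t. integral {r..r + t * (R - r)} (\<lambda>s. f s c)) has_vector_derivative
          ?g (r, c) t) (at t within {0..1})"
        using True by (simp add: o_def min_def)
    qed simp
    then show ?thesis by (auto dest: integral_unique)
  qed
  have "continuous_on (({0<..} \<times> L) \<times> cbox 0 1) (\<lambda>(p, t). ?g p t)"
  proof -
    have "continuous_on (({0<..} \<times> L) \<times> cbox 0 1)
        (\<lambda>q. (\<lambda>(s, c). f s c) (min (fst (fst q)) R + snd q * (R - min (fst (fst q)) R), snd (fst q)))"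
      by (rule continuous_on_compose2[OF cont]) (use pos in \<open>auto intro!: continuous_intros\<close>)
    then show ?thesis
      by (auto simp: case_prod_unfold intro!: continuous_intros)
  qed
  then have "continuous_on ({0<..} \<times> L) (\<lambda>p. integral (cbox 0 1) (?g p))"
    by (rule integral_continuous_on_param)
  then show ?thesis
    by (rule continuous_on_eq) (use eq in auto)
qed

section \<open>The linear system for a radial mode\<close>

lemma continuous_on_has_vector_derivative:
  "(\<And>x. x \<in> S \<Longrightarrow> (f has_vector_derivative f' x) (at x)) \<Longrightarrow> continuous_on S f"
  by (meson continuous_at_imp_continuous_on has_vector_derivative_continuous)

text \<open>\<open>A\<close> is an antiderivative of \<open>v r / r\<close>, which makes the
  integrating factor explicit. \<open>\<Lambda>\<close> is the lower bound for \<open>Re c\<close>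
  on which the uniform estimates rest.\<close>

locale shooting =
  fixes gd v A :: "real \<Rightarrow> real" and R B \<Lambda> :: real
  assumes R_pos: "0 < R" and B_pos: "0 < B" and \<Lambda>_pos: "0 < \<Lambda>"
    and gd_cont: "continuous_on UNIV gd"
    and gd_supp: "R \<le> r \<Longrightarrow> gd r = 0"
    and v_cont: "continuous_on {0<..} v"
    and A_deriv: "0 < r \<Longrightarrow> (A has_real_derivative v r / r) (at r)"
begin

text \<open>The integrating factor of the homogeneous equation
  \<open>h' = (B / r) (2 i v + c) h\<close>.\<close>

definition P :: "complex \<Rightarrow> real \<Rightarrow> complex" where
  "P c r = exp (of_real B * (2 * \<i> * of_real (A r) + c * of_real (ln r)))"

text \<open>Variation of constants: \<open>X\<close> is \<open>h / P\<close>, and the limit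
  \<open>R\<close> selects the solution that vanishes outside the support.\<close>

definition X :: "complex \<Rightarrow> (real \<Rightarrow> complex) \<Rightarrow> real \<Rightarrow> complex" where
  "X c u r = integral {r..R} (\<lambda>s. 2 * \<i> * of_real B * of_real (gd s / s ^ 3) * u s / P c s)"

definition h :: "complex \<Rightarrow> (real \<Rightarrow> complex) \<Rightarrow> real \<Rightarrow> complex" where
  "h c u r = P c r * X c u r"

definition y :: "complex \<Rightarrow> (real \<Rightarrow> complex) \<Rightarrow> real \<Rightarrow> complex" where
  "y c u r = - integral {r..R} (\<lambda>s. of_real (1 / s\<^sup>2) * h c u s)"

text \<open>One Picard step: \<open>u\<close> is frozen where it enters the equation for
  \<open>h\<close>, and the system is then integrated inwards from the data 1, 0, 0. Fixed points
  are the wanted modes.\<close>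

definition T :: "complex \<Rightarrow> (real \<Rightarrow> complex) \<Rightarrow> real \<Rightarrow> complex" where
  "T c u r = 1 - integral {r..R} (\<lambda>s. of_real (s ^ 3) * y c u s)"

text \<open>\<open>s\<^sup>2 * n r s\<close> is the integral of \<open>t ^ 3\<close> over
  \<open>{r..s}\<close>. It is the weight of \<open>h\<close> that remains when \<open>y\<close> is
  eliminated from \<open>u' = r ^ 3 * y\<close>, \<open>y' = h / r\<^sup>2\<close>.\<close>

definition n :: "real \<Rightarrow> real \<Rightarrow> real" where
  "n r s = (s\<^sup>2 - r ^ 4 / s\<^sup>2) / 4"

definition q :: "complex \<Rightarrow> real \<Rightarrow> real \<Rightarrow> complex" where
  "q c r t = integral {r..t} (\<lambda>s. of_real (n r s) * P c s)"

definition H :: "complex \<Rightarrow> real \<Rightarrow> real \<Rightarrow> complex" where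
  "H c r t = 2 * \<i> * of_real B * q c r t / (of_real (t ^ 3) * P c t)"

lemma P_nonzero [simp]: "P c r \<noteq> 0"
  by (simp add: P_def)

lemma A_cont: "continuous_on {0<..} A"
  by (rule continuous_on_has_vector_derivative)
     (auto intro: A_deriv simp flip: has_real_derivative_iff_has_vector_derivative)

lemma P_cont2: "continuous_on ({0<..} \<times> UNIV) (\<lambda>(r, c). P c r)"
proof -
  have "continuous_on ({0<..} \<times> (UNIV :: complex set)) (\<lambda>p. A (fst p))"
    by (rule continuous_on_compose2[OF A_cont]) (auto intro!: continuous_intros)
  then show ?thesis
    unfolding P_def case_prod_unfold
    by (intro continuous_intros) auto
qed

lemma P_cont: "continuous_on {0<..} (P c)"
proof -
  have "continuous_on {0<..} (\<lambda>r. (\<lambda>(r, c). P c r) (r, c))"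
    by (rule continuous_on_compose2[OF P_cont2]) (auto intro!: continuous_intros)
  then show ?thesis by simp
qed

lemma P_deriv:
  assumes "0 < r"
  shows "(P c has_vector_derivative
    of_real (B / r) * (2 * \<i> * of_real (v r) + c) * P c r) (at r)"
proof -
  have "((\<lambda>r. complex_of_real (A r)) has_vector_derivative of_real (v r / r)) (at r)"
    by (rule has_vector_derivative_of_real[OF A_deriv[OF assms]])
  moreover have "((\<lambda>r. complex_of_real (ln r)) has_vector_derivative of_real (1 / r)) (at r)"
    using assms by (intro has_vector_derivative_of_real) (auto intro!: derivative_eq_intros)
  ultimately have "((\<lambda>r. of_real B * (2 * \<i> * of_real (A r) + c * of_real (ln r))) has_vector_derivative
      of_real B * (2 * \<i> * of_real (v r / r) + c * of_real (1 / r))) (at r)"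
    by (intro has_vector_derivative_mult_right has_vector_derivative_add)
  then have "((exp \<circ> (\<lambda>r. of_real B * (2 * \<i> * of_real (A r) + c * of_real (ln r)))) has_vector_derivative
      (of_real B * (2 * \<i> * of_real (v r / r) + c * of_real (1 / r))) * P c r) (at r)"
    unfolding P_def by (rule field_vector_diff_chain_at) (rule DERIV_exp)
  moreover have "of_real B * (2 * \<i> * of_real (v r / r) + c * of_real (1 / r)) =
      of_real (B / r) * (2 * \<i> * of_real (v r) + c)"
    using assms by (simp add: field_simps)
  ultimately show ?thesis by (simp add: o_def P_def[abs_def])
qed

lemma norm_P: "0 < r \<Longrightarrow> norm (P c r) = exp (B * Re c * ln r)"
  by (simp add: P_def norm_exp_eq_Re algebra_simps)

lemma norm_P_mono:
  assumes "0 < r" "r \<le> s" "0 \<le> Re c"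
  shows "norm (P c r) \<le> norm (P c s)"
  using assms B_pos by (simp add: norm_P mult_left_mono)

lemma X_integrand_cont:
  assumes "continuous_on {0<..} u"
  shows "continuous_on {0<..} (\<lambda>s. 2 * \<i> * of_real B * of_real (gd s / s ^ 3) * u s / P c s)"
  using assms P_cont continuous_on_subset[OF gd_cont subset_UNIV]
  by (intro continuous_intros) auto

lemma X_deriv:
  assumes "continuous_on {0<..} u" "0 < r"
  shows "(X c u has_vector_derivative - (2 * \<i> * of_real B * of_real (gd r / r ^ 3) * u r / P c r)) (at r)"
  unfolding X_def
  by (rule tail_integral_has_vector_derivative[OF X_integrand_cont]) (use assms gd_supp in auto)

lemma h_deriv:
  assumes "continuous_on {0<..} u" "0 < r"
  shows "(h c u has_vector_derivative of_real (B / r) *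
    ((2 * \<i> * of_real (v r) + c) * h c u r - 2 * \<i> * of_real (gd r / r\<^sup>2) * u r)) (at r)"
proof -
  have "(h c u has_vector_derivative
     P c r * (- (2 * \<i> * of_real B * of_real (gd r / r ^ 3) * u r / P c r)) +
     of_real (B / r) * (2 * \<i> * of_real (v r) + c) * P c r * X c u r) (at r)"
    unfolding h_def by (rule has_vector_derivative_mult[OF P_deriv X_deriv]) (use assms in auto)
  moreover have "P c r * (- (2 * \<i> * of_real B * of_real (gd r / r ^ 3) * u r / P c r)) +
     of_real (B / r) * (2 * \<i> * of_real (v r) + c) * P c r * X c u r =
     of_real (B / r) *
    ((2 * \<i> * of_real (v r) + c) * h c u r - 2 * \<i> * of_real (gd r / r\<^sup>2) * u r)"
    using assms(2) by (simp add: h_def field_simps power2_eq_square power3_eq_cube)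
  ultimately show ?thesis by simp
qed

lemma h_cont: "continuous_on {0<..} u \<Longrightarrow> continuous_on {0<..} (h c u)"
  by (rule continuous_on_has_vector_derivative, rule h_deriv) auto

lemma h_supp: "R \<le> r \<Longrightarrow> h c u r = 0"
  by (cases "r = R") (auto simp: h_def X_def)

lemma y_deriv:
  assumes "continuous_on {0<..} u" "0 < r"
  shows "(y c u has_vector_derivative of_real (1 / r\<^sup>2) * h c u r) (at r)"
proof -
  have "continuous_on {0<..} (\<lambda>s. of_real (1 / s\<^sup>2) * h c u s)"
    by (intro continuous_intros h_cont assms) auto
  then have "((\<lambda>r. integral {r..R} (\<lambda>s. of_real (1 / s\<^sup>2) * h c u s)) has_vector_derivative
     - (of_real (1 / r\<^sup>2) * h c u r)) (at r)"
    by (rule tail_integral_has_vector_derivative) (use assms h_supp in auto)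
  from has_vector_derivative_minus[OF this] show ?thesis by (simp add: y_def[abs_def])
qed

lemma y_cont: "continuous_on {0<..} u \<Longrightarrow> continuous_on {0<..} (y c u)"
  by (rule continuous_on_has_vector_derivative, rule y_deriv) auto

lemma y_supp: "R \<le> r \<Longrightarrow> y c u r = 0"
  by (cases "r = R") (auto simp: y_def)

lemma T_deriv:
  assumes "continuous_on {0<..} u" "0 < r"
  shows "(T c u has_vector_derivative of_real (r ^ 3) * y c u r) (at r)"
proof -
  have "continuous_on {0<..} (\<lambda>s. of_real (s ^ 3) * y c u s)"
    by (intro continuous_intros y_cont assms)
  then have "((\<lambda>r. integral {r..R} (\<lambda>s. of_real (s ^ 3) * y c u s)) has_vector_derivative
     - (of_real (r ^ 3) * y c u r)) (at r)"
    by (rule tail_integral_has_vector_derivative) (use assms y_supp in auto)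
  from has_vector_derivative_diff[OF has_vector_derivative_const this, of 1]
  show ?thesis by (simp add: T_def[abs_def])
qed

lemma T_supp: "R \<le> r \<Longrightarrow> T c u r = 1"
  by (cases "r = R") (auto simp: T_def)

text \<open>Joint continuity in radius and eigenvalue is what later makes \<open>u(0)\<close>
  continuous in \<open>c\<close>. The map \<open>l\<close> leaves room for a truncation of the
  eigenvalue to a half plane.\<close>

lemma T_cont2:
  fixes L :: "'l::metric_space set"
  assumes "continuous_on ({0<..} \<times> L) (\<lambda>(s, c). u s c)" and "continuous_on L l"
  shows "continuous_on ({0<..} \<times> L) (\<lambda>(r, c). T (l c) (\<lambda>s. u s c) r)"
proof -
  have P: "continuous_on ({0<..} \<times> L) (\<lambda>p. P (l (snd p)) (fst p))"
  proof -
    have "continuous_on ({0<..} \<times> L) (\<lambda>p. (\<lambda>(r, c). P c r) (fst p, l (snd p)))"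
      by (rule continuous_on_compose2[OF P_cont2])
         (auto intro!: continuous_intros continuous_on_compose2[OF assms(2)])
    then show ?thesis by simp
  qed
  have gd: "continuous_on ({0<..} \<times> L) (\<lambda>p. gd (fst p))"
    by (rule continuous_on_compose2[OF gd_cont]) (auto intro!: continuous_intros)
  have "continuous_on ({0<..} \<times> L) (\<lambda>(r, c). X (l c) (\<lambda>s. u s c) r)"
    unfolding X_def
    by (rule tail_integral_continuous_on[OF _ R_pos])
       (use assms(1) P gd in \<open>auto simp: case_prod_unfold intro!: continuous_intros\<close>)
  then have h: "continuous_on ({0<..} \<times> L) (\<lambda>p. h (l (snd p)) (\<lambda>s. u s (snd p)) (fst p))"
    unfolding h_def case_prod_unfold by (intro continuous_intros P)
  have "continuous_on ({0<..} \<times> L) (\<lambda>(r, c). integral {r..R} (\<lambda>s. of_real (1 / s\<^sup>2) * h (l c) (\<lambda>s. u s c) s))"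
    by (rule tail_integral_continuous_on[OF _ R_pos])
       (use h in \<open>auto simp: case_prod_unfold intro!: continuous_intros\<close>)
  then have y: "continuous_on ({0<..} \<times> L) (\<lambda>p. y (l (snd p)) (\<lambda>s. u s (snd p)) (fst p))"
    unfolding y_def case_prod_unfold by (intro continuous_intros)
  have "continuous_on ({0<..} \<times> L) (\<lambda>(r, c). integral {r..R} (\<lambda>s. of_real (s ^ 3) * y (l c) (\<lambda>s. u s c) s))"
    by (rule tail_integral_continuous_on[OF _ R_pos])
       (use y in \<open>auto simp: case_prod_unfold intro!: continuous_intros\<close>)
  then show ?thesis
    unfolding T_def case_prod_unfold by (intro continuous_intros)
qed

section \<open>The Volterra kernel and its bounds uniform in \<open>B\<close>\<close>

lemma n_deriv:
  assumes "0 < s"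
  shows "(n r has_vector_derivative (s + r ^ 4 / s ^ 3) / 2) (at s)"
  unfolding n_def[abs_def] has_real_derivative_iff_has_vector_derivative[symmetric]
  using assms by (auto intro!: derivative_eq_intros simp: field_simps power2_eq_square power3_eq_cube)

lemma n_cont: "continuous_on {0<..} (n r)"
  unfolding n_def[abs_def] by (intro continuous_intros) auto

lemma q_deriv:
  assumes "0 < r" "r \<le> t" "t \<le> b"
  shows "(q c r has_vector_derivative of_real (n r t) * P c t) (at t within {r..b})"
  unfolding q_def[abs_def]
  by (rule integral_has_vector_derivative)
     (use assms in \<open>auto intro!: continuous_intros continuous_on_subset[OF n_cont] continuous_on_subset[OF P_cont]\<close>)

lemma q_start [simp]: "q c r r = 0"
  by (simp add: q_def)

text \<open>This is the exchange of order in three nested integrals, done by one antiderivative: the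
  combination \<open>?Z\<close> differentiates to minus the integrand, equals 1 at \<open>R\<close>,
  and equals \<open>T c u r\<close> at \<open>r\<close>, where both correction terms vanish.\<close>

lemma T_kernel:
  assumes u: "continuous_on {0<..} u" and r: "0 < r" "r \<le> R"
  shows "((\<lambda>t. H c r t * of_real (gd t) * u t) has_integral T c u r - 1) {r..R}"
proof -
  let ?Z = "\<lambda>t. T c u t - of_real ((t ^ 4 - r ^ 4) / 4) * y c u t + q c r t * X c u t"
  have "((\<lambda>t. - (H c r t * of_real (gd t) * u t)) has_integral ?Z R - ?Z r) {r..R}"
  proof (rule fundamental_theorem_of_calculus)
    fix t assume t: "t \<in> {r..R}"
    then have t0: "0 < t" using r by auto
    have p: "((\<lambda>t. complex_of_real ((t ^ 4 - r ^ 4) / 4)) has_vector_derivative of_real (t ^ 3)) (at t within {r..R})"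
      by (rule has_vector_derivative_of_real) (auto intro!: derivative_eq_intros)
    have "(?Z has_vector_derivative of_real (t ^ 3) * y c u t -
        (of_real ((t ^ 4 - r ^ 4) / 4) * (of_real (1 / t\<^sup>2) * h c u t) + of_real (t ^ 3) * y c u t) +
        (q c r t * - (2 * \<i> * of_real B * of_real (gd t / t ^ 3) * u t / P c t) + of_real (n r t) * P c t * X c u t))
        (at t within {r..R})"
      by (intro has_vector_derivative_add has_vector_derivative_diff has_vector_derivative_mult p
          has_vector_derivative_at_within[OF T_deriv] has_vector_derivative_at_within[OF y_deriv] has_vector_derivative_at_within[OF X_deriv] q_deriv u t0)
         (use t r in auto)
    moreover have "of_real ((t ^ 4 - r ^ 4) / 4) * (of_real (1 / t\<^sup>2) * h c u t) = of_real (n r t) * P c t * X c u t"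
    proof -
      have "(t ^ 4 - r ^ 4) / 4 * (1 / t\<^sup>2) = n r t"
        using t0 by (simp add: n_def field_simps power4_eq_xxxx power2_eq_square)
      then have "complex_of_real ((t ^ 4 - r ^ 4) / 4) * of_real (1 / t\<^sup>2) = of_real (n r t)"
        by (metis of_real_mult)
      then show ?thesis by (simp add: h_def mult.assoc[symmetric] del: of_real_divide of_real_diff)
    qed
    moreover have "q c r t * (2 * \<i> * of_real B * of_real (gd t / t ^ 3) * u t / P c t) = H c r t * of_real (gd t) * u t"
      by (simp add: H_def field_simps)
    ultimately show "(?Z has_vector_derivative - (H c r t * of_real (gd t) * u t)) (at t within {r..R})"
      by (simp add: algebra_simps)
  qed (use r in simp)
  moreover have "?Z R = 1" "?Z r = T c u r"
    by (auto simp: T_supp y_supp X_def)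
  ultimately have "((\<lambda>t. - (H c r t * of_real (gd t) * u t)) has_integral 1 - T c u r) {r..R}"
    by (metis)
  from has_integral_neg[OF this] show ?thesis by simp
qed


lemma n_nonneg:
  assumes "0 < r" "r \<le> s" shows "0 \<le> n r s"
proof -
  have "r ^ 4 \<le> s ^ 4" using assms by (simp add: power_mono)
  then have "r ^ 4 / s\<^sup>2 \<le> s\<^sup>2" using assms by (simp add: divide_simps flip: power_add)
  then show ?thesis by (simp add: n_def)
qed

lemma n_mono:
  assumes "0 < r" "r \<le> s" "s \<le> t" shows "n r s \<le> n r t"
proof -
  have "s\<^sup>2 \<le> t\<^sup>2" using assms by (simp add: power_mono)
  moreover from this have "r ^ 4 / t\<^sup>2 \<le> r ^ 4 / s\<^sup>2" using assms by (intro divide_left_mono) auto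
  ultimately show ?thesis by (simp add: n_def)
qed

text \<open>Since \<open>\<bar>P\<bar>' = B Re c \<bar>P\<bar> / s\<close>, integrating against \<open>P\<close> gains a factor \<open>1 / B\<close>.\<close>

lemma norm_integral_P_le:
  assumes r: "0 < r" "r \<le> t" and c: "\<Lambda> \<le> Re c"
    and f: "continuous_on {r..t} f" "\<And>s. s \<in> {r..t} \<Longrightarrow> norm (f s) \<le> C"
  shows "norm (integral {r..t} (\<lambda>s. f s * P c s)) \<le> C * t / (B * \<Lambda>) * norm (P c t)"
proof -
  have c0: "0 < Re c" using c \<Lambda>_pos by simp
  have C0: "0 \<le> C" using f(2)[of r] r by (meson atLeastAtMost_iff norm_ge_zero order_refl order_trans)
  \<comment> \<open>Enlarging \<open>C\<close> to \<open>C * (t / s)\<close> supplies the factor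
    \<open>1 / s\<close> that makes the majorant an exact derivative.\<close>
  let ?g = "\<lambda>s. C * (t / s) * exp (B * Re c * ln s)"
  have g: "(?g has_integral C * t / (B * Re c) * exp (B * Re c * ln t) - C * t / (B * Re c) * exp (B * Re c * ln r)) {r..t}"
  proof (rule fundamental_theorem_of_calculus)
    fix s assume "s \<in> {r..t}"
    then show "((\<lambda>s. C * t / (B * Re c) * exp (B * Re c * ln s)) has_vector_derivative ?g s) (at s within {r..t})"
      using r c0 B_pos unfolding has_real_derivative_iff_has_vector_derivative[symmetric]
      by (auto intro!: derivative_eq_intros simp: field_simps)
  qed (use r in simp)
  have "norm (integral {r..t} (\<lambda>s. f s * P c s)) \<le> integral {r..t} ?g"
  proof (rule integral_norm_bound_integral)
    show "(\<lambda>s. f s * P c s) integrable_on {r..t}"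
      using r by (intro integrable_continuous_real continuous_intros f continuous_on_subset[OF P_cont]) auto
    show "?g integrable_on {r..t}" using g by blast
    fix s assume s: "s \<in> {r..t}"
    then have s0: "0 < s" using r by auto
    have "norm (f s * P c s) = norm (f s) * exp (B * Re c * ln s)"
      using s0 by (simp add: norm_mult norm_P)
    also have "\<dots> \<le> (C * (t / s)) * exp (B * Re c * ln s)"
    proof (rule mult_right_mono)
      have "norm (f s) \<le> C * 1" using f(2)[OF s] by simp
      also have "\<dots> \<le> C * (t / s)" using C0 s s0 by (intro mult_left_mono) auto
      finally show "norm (f s) \<le> C * (t / s)" .
    qed simp
    finally show "norm (f s * P c s) \<le> ?g s" .
  qed
  also have "\<dots> = C * t / (B * Re c) * (exp (B * Re c * ln t) - exp (B * Re c * ln r))"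
    using integral_unique[OF g] by (simp add: right_diff_distrib)
  also have "\<dots> \<le> C * t / (B * Re c) * exp (B * Re c * ln t)"
    using C0 r c0 B_pos by (intro mult_left_mono) auto
  also have "\<dots> \<le> C * t / (B * \<Lambda>) * exp (B * Re c * ln t)"
    using C0 r c0 B_pos \<Lambda>_pos c by (intro mult_right_mono divide_left_mono mult_left_mono) auto
  finally show ?thesis using r by (simp add: norm_P)
qed

text \<open>The \<open>1 / B\<close> gained by integrating against \<open>P\<close> cancels the
  factor \<open>B\<close> in \<open>H\<close>. The factor \<open>1 - (r / t) ^ 4\<close> is kept
  because its zero on the diagonal is what makes the action of a thin layer on itself
  negligible.\<close>

lemma norm_H_le:
  assumes r: "0 < r" "r \<le> t" and c: "\<Lambda> \<le> Re c"
  shows "norm (H c r t) \<le> (1 - (r / t) ^ 4) / (2 * \<Lambda>)"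
proof -
  have t: "0 < t" using r by simp
  have "norm (q c r t) \<le> n r t * t / (B * \<Lambda>) * norm (P c t)"
    unfolding q_def
  proof (rule norm_integral_P_le[OF r c])
    show "continuous_on {r..t} (\<lambda>s. complex_of_real (n r s))"
      using r by (intro continuous_intros continuous_on_subset[OF n_cont]) auto
  qed (use r n_nonneg n_mono in auto)
  then have "2 * B * norm (q c r t) / (t ^ 3 * norm (P c t)) \<le>
      2 * B * (n r t * t / (B * \<Lambda>) * norm (P c t)) / (t ^ 3 * norm (P c t))"
    using B_pos t by (intro divide_right_mono mult_left_mono) auto
  then have "norm (H c r t) \<le> 2 * B * (n r t * t / (B * \<Lambda>) * norm (P c t)) / (t ^ 3 * norm (P c t))"
    using B_pos t by (simp add: H_def norm_mult norm_divide norm_power)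
  also have "\<dots> = 2 * (n r t / t\<^sup>2) / \<Lambda>"
    using t B_pos \<Lambda>_pos by (simp add: field_simps power2_eq_square power3_eq_cube)
  also have "n r t / t\<^sup>2 = (1 - (r / t) ^ 4) / 4"
    using t by (simp add: n_def field_simps power2_eq_square power4_eq_xxxx)
  finally show ?thesis using \<Lambda>_pos by (simp add: field_simps)
qed

lemma norm_H_le':
  assumes r: "0 < r" "r \<le> t" and c: "\<Lambda> \<le> Re c"
  shows "norm (H c r t) \<le> 1 / (2 * \<Lambda>)"
  by (rule order_trans[OF norm_H_le[OF assms]]) (use r \<Lambda>_pos in \<open>auto intro!: divide_right_mono\<close>)

lemma norm_denominator: "\<Lambda> \<le> Re c \<Longrightarrow> \<Lambda> \<le> norm (2 * \<i> * of_real x + c)"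
  using complex_Re_le_cmod[of "2 * \<i> * of_real x + c"] by simp

text \<open>Integration by parts: \<open>B n P = (s n / (2 i v + c)) P'\<close>.\<close>

lemma H_approx:
  assumes r: "0 < r" "r \<le> t" and c: "\<Lambda> \<le> Re c"
    and dv: "\<And>s. 0 < s \<Longrightarrow> (v has_real_derivative dv s) (at s)" "continuous_on {0<..} dv"
    and G: "\<And>s. 0 < s \<Longrightarrow> \<bar>s * dv s\<bar> \<le> G"
  shows "norm (H c r t - of_real (1 - (r / t) ^ 4) * \<i> / (2 * (2 * \<i> * of_real (v t) + c)))
    \<le> (2 / \<Lambda>\<^sup>2 + G / \<Lambda> ^ 3) / B"
proof -
  have t: "0 < t" using r by simp
  have c0: "0 < Re c" using c \<Lambda>_pos by simp
  let ?d = "\<lambda>s. 2 * \<i> * complex_of_real (v s) + c"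
  have nz: "?d s \<noteq> 0" for s using norm_denominator[OF c, of "v s"] \<Lambda>_pos by auto
  let ?\<Phi> = "\<lambda>s. complex_of_real (s * n r s) * inverse (?d s)"
  \<comment> \<open>\<open>m\<close> is the derivative of \<open>s * n r s\<close>, and
    \<open>\<Phi>'\<close> that of \<open>?\<Phi>\<close>.\<close>
  define m where "m s = n r s + s * ((s + r ^ 4 / s ^ 3) / 2)" for s
  define \<Phi>' where "\<Phi>' s = of_real (m s) * inverse (?d s)
     - of_real (s * n r s) * (inverse (?d s) * (2 * \<i> * of_real (dv s)) * inverse (?d s))" for s
  have D: "(?\<Phi> has_vector_derivative \<Phi>' s) (at s)" if s: "0 < s" for s
  proof -
    have a: "((\<lambda>s. complex_of_real (s * n r s)) has_vector_derivative of_real (m s)) (at s)"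
    proof (rule has_vector_derivative_of_real)
      have "(n r has_real_derivative (s + r ^ 4 / s ^ 3) / 2) (at s)"
        using n_deriv[OF s] by (simp add: has_real_derivative_iff_has_vector_derivative)
      then show "((\<lambda>s. s * n r s) has_real_derivative m s) (at s)"
        by (auto intro!: derivative_eq_intros simp: m_def)
    qed
    have d: "(?d has_vector_derivative 2 * \<i> * of_real (dv s) + 0) (at s)"
      by (intro has_vector_derivative_add has_vector_derivative_const has_vector_derivative_mult_right
          has_vector_derivative_of_real dv s)
    have b: "((\<lambda>s. inverse (?d s)) has_vector_derivative - (inverse (?d s) * (2 * \<i> * of_real (dv s)) * inverse (?d s))) (at s)"
      using Deriv.has_derivative_inverse[OF nz d[unfolded has_vector_derivative_def]]
      by (simp add: has_vector_derivative_def scaleR_conv_of_real algebra_simps)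
    show ?thesis using has_vector_derivative_mult[OF a b] unfolding \<Phi>'_def
      by (simp add: algebra_simps)
  qed
  have v: "continuous_on {r..t} v" by (rule continuous_on_subset[OF v_cont]) (use r in auto)
  have nc: "continuous_on {r..t} (n r)" by (rule continuous_on_subset[OF n_cont]) (use r in auto)
  have \<Phi>'c: "continuous_on {r..t} \<Phi>'"
    unfolding \<Phi>'_def m_def using r
    by (intro continuous_intros v nc continuous_on_subset[OF dv(2)]) (use nz in auto)
  have bound: "norm (\<Phi>' s) \<le> (1 / \<Lambda> + G / (2 * \<Lambda>\<^sup>2)) * t\<^sup>2" if s: "s \<in> {r..t}" for s
  proof -
    have s0: "0 < s" "r \<le> s" using s r by auto
    have inv: "norm (inverse (?d s)) \<le> 1 / \<Lambda>"
      using le_imp_inverse_le[OF norm_denominator[OF c] \<Lambda>_pos] by (simp only: norm_inverse divide_inverse mult_1)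
    have "r ^ 4 \<le> s ^ 4" using s0 r by (simp add: power_mono)
    then have r4: "r ^ 4 / s\<^sup>2 \<le> s\<^sup>2" using s0 by (simp add: divide_simps flip: power_add)
    \<comment> \<open>In terms of \<open>w\<close>, which lies between 0 and
      \<open>s\<^sup>2\<close>, the bound for \<open>m s = (3 * s\<^sup>2 + w) / 4\<close> becomes
      linear.\<close>
    define w where "w = r ^ 4 / s\<^sup>2"
    have "m s = (3 * s\<^sup>2 + w) / 4"
      using s0 by (simp add: w_def m_def n_def field_simps power2_eq_square power3_eq_cube)
    moreover have "0 \<le> w" "0 \<le> s\<^sup>2" by (auto simp: w_def)
    ultimately have m: "\<bar>m s\<bar> \<le> s\<^sup>2" using r4[folded w_def] by (simp add: abs_le_iff)
    have "norm (\<Phi>' s) \<le> \<bar>m s\<bar> * norm (inverse (?d s)) +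
        (\<bar>n r s\<bar> * norm (inverse (?d s)) * (2 * \<bar>s * dv s\<bar>)) * norm (inverse (?d s))"
      unfolding \<Phi>'_def
      by (rule order_trans[OF norm_triangle_ineq4]) (simp add: norm_mult abs_mult)
    also have "\<dots> \<le> s\<^sup>2 * (1 / \<Lambda>) + ((s\<^sup>2 / 4) * (1 / \<Lambda>) * (2 * G)) * (1 / \<Lambda>)"
    proof -
      have "\<bar>n r s\<bar> \<le> s\<^sup>2 / 4" using n_nonneg[OF r(1) s0(2)] by (simp add: n_def)
      moreover have "\<bar>s * dv s\<bar> \<le> G" by (rule G) fact
      moreover from this have "0 \<le> G" by linarith
      ultimately show ?thesis using inv m \<Lambda>_pos
        by (intro add_mono mult_mono) (auto intro!: mult_nonneg_nonneg)
    qed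
    also have "\<dots> = (1 / \<Lambda> + G / (2 * \<Lambda>\<^sup>2)) * s\<^sup>2" by (simp add: field_simps power2_eq_square)
    also have "\<dots> \<le> (1 / \<Lambda> + G / (2 * \<Lambda>\<^sup>2)) * t\<^sup>2"
    proof (rule mult_left_mono)
      have "0 \<le> G" using G[OF s0(1)] by linarith
      then show "0 \<le> 1 / \<Lambda> + G / (2 * \<Lambda>\<^sup>2)" using \<Lambda>_pos by auto
    qed (use s s0 in \<open>auto simp: power_mono\<close>)
    finally show ?thesis .
  qed
  have "((\<lambda>s. \<Phi>' s * P c s + of_real B * (of_real (n r s) * P c s)) has_integral ?\<Phi> t * P c t - ?\<Phi> r * P c r) {r..t}"
  proof (rule fundamental_theorem_of_calculus)
    fix s assume s: "s \<in> {r..t}"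
    then have s0: "0 < s" using r by auto
    have "((\<lambda>s. ?\<Phi> s * P c s) has_vector_derivative
       ?\<Phi> s * (of_real (B / s) * ?d s * P c s) + \<Phi>' s * P c s) (at s)"
      by (intro has_vector_derivative_mult D P_deriv s0)
    moreover have "of_real (s * n r s) * inverse D * (of_real (B / s) * D * p) = of_real B * (of_real (n r s) * p)"
      if "D \<noteq> 0" for D p :: complex
      using s0 that by (simp add: field_simps)
    then have "?\<Phi> s * (of_real (B / s) * ?d s * P c s) = of_real B * (of_real (n r s) * P c s)"
      using nz[of s] by blast
    ultimately show "((\<lambda>s. ?\<Phi> s * P c s) has_vector_derivative
       \<Phi>' s * P c s + of_real B * (of_real (n r s) * P c s)) (at s within {r..t})"
      by (simp add: has_vector_derivative_at_within add.commute)
  qed (use r in simp)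
  moreover have "?\<Phi> r = 0" using r by (simp add: n_def power2_eq_square power4_eq_xxxx)
  moreover have "((\<lambda>s. of_real (n r s) * P c s) has_integral q c r t) {r..t}"
    unfolding q_def using r
    by (intro integrable_integral integrable_continuous_real continuous_intros nc continuous_on_subset[OF P_cont]) auto
  ultimately have "((\<lambda>s. \<Phi>' s * P c s) has_integral ?\<Phi> t * P c t - of_real B * q c r t) {r..t}"
    using has_integral_diff[OF _ has_integral_mult_right, of _ "?\<Phi> t * P c t" "{r..t}" _ "q c r t" "of_real B"]
    by fastforce
  then have i: "integral {r..t} (\<lambda>s. \<Phi>' s * P c s) = ?\<Phi> t * P c t - of_real B * q c r t"
    by (rule integral_unique)
  have "H c r t - of_real (1 - (r / t) ^ 4) * \<i> / (2 * ?d t) =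
     - (2 * \<i> / (of_real (t ^ 3) * P c t) * integral {r..t} (\<lambda>s. \<Phi>' s * P c s))"
  proof -
    have "2 * \<i> / (of_real (t ^ 3) * P c t) * (?\<Phi> t * P c t) = of_real (1 - (r / t) ^ 4) * \<i> / (2 * ?d t)"
    proof -
      have k: "of_real (t * n r t) / of_real (t ^ 3) = complex_of_real ((1 - (r / t) ^ 4) / 4)"
        unfolding of_real_divide[symmetric] of_real_eq_iff
        using t by (simp add: n_def field_simps power2_eq_square power3_eq_cube power4_eq_xxxx)
      have "2 * \<i> / (t3 * p) * (tn * inverse D * p) = of_real x * \<i> / (2 * D)"
        if "p \<noteq> 0" "D \<noteq> 0" "tn / t3 = of_real (x / 4)" for p t3 tn D :: complex and x
      proof -
        have "2 * \<i> / (t3 * p) * (tn * inverse D * p) = tn / t3 * (2 * \<i> * inverse D)"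
          using that(1) by (simp add: field_simps)
        then show ?thesis unfolding that(3) using that(2) by (simp add: field_simps)
      qed
      from this[OF P_nonzero nz k] show ?thesis .
    qed
    then show ?thesis unfolding i H_def right_diff_distrib by (simp add: mult.commute)
  qed
  then have "norm (H c r t - of_real (1 - (r / t) ^ 4) * \<i> / (2 * ?d t)) =
     2 / (t ^ 3 * norm (P c t)) * norm (integral {r..t} (\<lambda>s. \<Phi>' s * P c s))"
    using t by (simp add: norm_mult norm_divide norm_power)
  \<comment> \<open>After the integration by parts no factor \<open>B\<close> stands in front, so
    the gain from integrating \<open>P\<close> survives as a remainder of order
    \<open>1 / B\<close>.\<close>
  also have "\<dots> \<le> 2 / (t ^ 3 * norm (P c t)) *
      (((1 / \<Lambda> + G / (2 * \<Lambda>\<^sup>2)) * t\<^sup>2) * t / (B * \<Lambda>) * norm (P c t))"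
    using t by (intro mult_left_mono norm_integral_P_le[OF r c \<Phi>'c bound]) auto
  also have "\<dots> = (2 / \<Lambda>\<^sup>2 + G / \<Lambda> ^ 3) / B"
    using t B_pos \<Lambda>_pos by (simp add: field_simps power2_eq_square power3_eq_cube)
  finally show ?thesis .
qed


text \<open>An exponential weight for the Volterra equation. Its logarithmic derivative
  \<open>- \<bar>gd r\<bar> / \<Lambda>\<close> has twice the size of the kernel bound times
  \<open>\<bar>gd r\<bar>\<close>, so \<open>T\<close> contracts by 1/2 in the norm
  \<open>sup (norm u / e)\<close> however steep the vortex is, while \<open>e\<close> is controlled
  by its total variation.\<close>

definition e :: "real \<Rightarrow> real" where
  "e r = exp (integral {r..R} (\<lambda>s. \<bar>gd s\<bar>) / \<Lambda>)"

lemma gd_abs_cont: "continuous_on S (\<lambda>s. \<bar>gd s\<bar>)"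
  by (intro continuous_intros continuous_on_subset[OF gd_cont]) auto

lemma e_pos [simp]: "0 < e r" by (simp add: e_def)

lemma e_nonneg [simp]: "0 \<le> e r" and abs_e [simp]: "\<bar>e r\<bar> = e r"
  by (auto simp: e_def)

lemma e_ge_1: "1 \<le> e r"
  unfolding e_def using \<Lambda>_pos
  by (auto intro!: divide_nonneg_pos integral_nonneg integrable_continuous_real gd_abs_cont)

lemma e_deriv:
  assumes "0 < r"
  shows "(e has_vector_derivative - (\<bar>gd r\<bar> / \<Lambda> * e r)) (at r)"
proof -
  have "((\<lambda>r. integral {r..R} (\<lambda>s. \<bar>gd s\<bar>)) has_vector_derivative - \<bar>gd r\<bar>) (at r)"
    by (rule tail_integral_has_vector_derivative[OF gd_abs_cont]) (use assms gd_supp in auto)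
  then show ?thesis
    unfolding e_def[abs_def] has_real_derivative_iff_has_vector_derivative[symmetric]
    using \<Lambda>_pos by (auto intro!: derivative_eq_intros)
qed

lemma e_cont: "continuous_on {0<..} e"
  by (rule continuous_on_has_vector_derivative, rule e_deriv) auto

text \<open>The majorant \<open>\<bar>gd t\<bar> / \<Lambda> * e t * (d / 2)\<close> is minus the
  derivative of \<open>e t * (d / 2)\<close>, so its integral telescopes.\<close>

lemma norm_T_diff_le:
  assumes u: "continuous_on {0<..} u" "continuous_on {0<..} w" and c: "\<Lambda> \<le> Re c" and r: "0 < r"
    and d: "\<And>s. 0 < s \<Longrightarrow> norm (u s - w s) \<le> e s * d"
  shows "norm (T c u r - T c w r) \<le> e r * (d / 2)"
proof (cases "r \<le> R")
  case False
  have "0 \<le> e r * d" using d[OF r] by (rule order_trans[OF norm_ge_zero])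
  then show ?thesis using False by (simp add: T_supp)
next
  case True
  have d0: "0 \<le> d"
    using order_trans[OF norm_ge_zero d[OF r]] e_pos[of r] by (simp add: zero_le_mult_iff)
  have i: "((\<lambda>t. H c r t * of_real (gd t) * u t - H c r t * of_real (gd t) * w t) has_integral
      (T c u r - 1) - (T c w r - 1)) {r..R}"
    by (intro has_integral_diff T_kernel u r True)
  have g: "((\<lambda>t. \<bar>gd t\<bar> / \<Lambda> * e t * (d / 2)) has_integral (- e R * (d / 2)) - (- e r * (d / 2))) {r..R}"
  proof (rule fundamental_theorem_of_calculus)
    fix t assume "t \<in> {r..R}"
    then have "0 < t" using r by auto
    from e_deriv[OF this]
    have "((\<lambda>t. - e t * (d / 2)) has_vector_derivative \<bar>gd t\<bar> / \<Lambda> * e t * (d / 2)) (at t)"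
      unfolding has_real_derivative_iff_has_vector_derivative[symmetric]
      by (auto intro!: derivative_eq_intros simp: mult_ac)
    then show "((\<lambda>t. - e t * (d / 2)) has_vector_derivative \<bar>gd t\<bar> / \<Lambda> * e t * (d / 2)) (at t within {r..R})"
      by (rule has_vector_derivative_at_within)
  qed (rule True)
  have "norm (T c u r - T c w r) = norm (integral {r..R} (\<lambda>t. H c r t * of_real (gd t) * u t - H c r t * of_real (gd t) * w t))"
    using integral_unique[OF i] by simp
  also have "\<dots> \<le> integral {r..R} (\<lambda>t. \<bar>gd t\<bar> / \<Lambda> * e t * (d / 2))"
  proof (rule integral_norm_bound_integral)
    fix t assume t: "t \<in> {r..R}"
    then have t0: "0 < t" "r \<le> t" using r by auto
    have "norm (H c r t * of_real (gd t) * u t - H c r t * of_real (gd t) * w t)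
       = norm (H c r t) * \<bar>gd t\<bar> * norm (u t - w t)"
      by (simp flip: right_diff_distrib add: norm_mult)
    also have "\<dots> \<le> 1 / (2 * \<Lambda>) * \<bar>gd t\<bar> * (e t * d)"
      using norm_H_le'[OF r t0(2) c] d[OF t0(1)] \<Lambda>_pos by (intro mult_mono) auto
    finally show "norm (H c r t * of_real (gd t) * u t - H c r t * of_real (gd t) * w t)
      \<le> \<bar>gd t\<bar> / \<Lambda> * e t * (d / 2)" by (simp add: field_simps)
  qed (use i g in auto)
  also have "\<dots> = e r * (d / 2) - e R * (d / 2)"
    using integral_unique[OF g] by simp
  also have "\<dots> \<le> e r * (d / 2)" using d0 by simp
  finally show ?thesis .
qed

lemma T_zero: "T c (\<lambda>_. 0) r = 1"
  by (simp add: T_def y_def h_def X_def)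

lemma norm_T_le:
  assumes u: "continuous_on {0<..} u" and c: "\<Lambda> \<le> Re c" and r: "0 < r"
    and d: "\<And>s. 0 < s \<Longrightarrow> norm (u s) \<le> e s * d"
  shows "norm (T c u r) \<le> e r * (1 + d / 2)"
proof -
  have "norm (T c u r - T c (\<lambda>_. 0) r) \<le> e r * (d / 2)"
    by (rule norm_T_diff_le) (use assms in auto)
  then have "norm (T c u r) \<le> 1 + e r * (d / 2)"
    using norm_triangle_ineq2[of "T c u r" 1] by (simp add: T_zero)
  then show ?thesis using e_ge_1[of r] by (simp add: algebra_simps)
qed

text \<open>The parameter \<open>c\<close> is part of the domain, so that the fixed point depends continuously on it.\<close>

lemma fixed_point_exists:
  "\<exists>U. continuous_on ({0<..} \<times> UNIV) (\<lambda>(r, c). U r c) \<and>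
     (\<forall>c r. \<Lambda> \<le> Re c \<longrightarrow> 0 < r \<longrightarrow> U r c = T c (\<lambda>s. U s c) r \<and> norm (U r c) \<le> 2 * e r)"
proof -
  \<comment> \<open>Bounded continuous functions form a complete space over a whole type. Clamping
    the real part extends the problem to every \<open>c\<close> and changes nothing on the half
    plane.\<close>
  define l where "l c = Complex (max \<Lambda> (Re c)) (Im c)" for c
  have l_re: "\<Lambda> \<le> Re (l c)" for c by (simp add: l_def)
  have l_id: "l c = c" if "\<Lambda> \<le> Re c" for c using that by (simp add: l_def max_def complex_eq_iff)
  have l_cont: "continuous_on UNIV l"
    unfolding l_def[abs_def] by (intro continuous_intros)
  \<comment> \<open>The coordinate \<open>ln r\<close> identifies the half-line with the whole real
    line, and the factor \<open>e r\<close> turns the sup norm of \<open>f\<close> into the weighted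
    norm of \<open>U\<close>.\<close>
  define U where "U f r c = of_real (e r) * apply_bcontfun f (ln r, c)"
    for f :: "(real \<times> complex) \<Rightarrow>\<^sub>C complex" and r :: real and c :: complex
  have e_fst: "continuous_on S (\<lambda>p. e (g p))" if "continuous_on S g" "g ` S \<subseteq> {0<..}"
    for S and g :: "real \<times> complex \<Rightarrow> real"
    by (rule continuous_on_compose2[OF e_cont that])
  have U2: "continuous_on ({0<..} \<times> UNIV) (\<lambda>(r, c). U f r c)" for f
    unfolding U_def case_prod_unfold
    by (intro continuous_intros e_fst continuous_on_compose2[OF continuous_on_apply_bcontfun[of UNIV]]) auto
  have U1: "continuous_on {0<..} (\<lambda>r. U f r c)" for f c
  proof -
    have "continuous_on {0<..} (\<lambda>r. (\<lambda>(r, c). U f r c) (r, c))"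
      by (rule continuous_on_compose2[OF U2]) (auto intro!: continuous_intros)
    then show ?thesis by simp
  qed
  define \<Psi> where "\<Psi> f p = complex_of_real (1 / e (exp (fst p))) * T (l (snd p)) (\<lambda>s. U f s (snd p)) (exp (fst p))"
    for f :: "(real \<times> complex) \<Rightarrow>\<^sub>C complex" and p :: "real \<times> complex"
  have U_norm: "norm (U f r c) = e r * norm (apply_bcontfun f (ln r, c))" for f r c
    by (simp add: U_def norm_mult)
  have \<Psi>: "\<Psi> f \<in> bcontfun" for f
  proof (rule bcontfun_normI)
    have "continuous_on UNIV (\<lambda>p. (\<lambda>(r, c). T (l c) (\<lambda>s. U f s c) r) (exp (fst p), snd (p :: real \<times> complex)))"
      by (rule continuous_on_compose2[OF T_cont2[OF U2 l_cont]]) (auto intro!: continuous_intros)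
    then show "continuous_on UNIV (\<Psi> f)"
      unfolding \<Psi>_def[abs_def] by (intro continuous_intros e_fst) (auto simp: less_imp_neq[OF e_pos, symmetric])
    fix p
    have "norm (T (l (snd p)) (\<lambda>s. U f s (snd p)) (exp (fst p))) \<le> e (exp (fst p)) * (1 + norm f / 2)"
      using norm_bounded by (intro norm_T_le U1 l_re) (auto simp: U_norm)
    then show "norm (\<Psi> f p) \<le> 1 + norm f / 2"
      using e_pos[of "exp (fst p)"] by (simp add: \<Psi>_def norm_mult norm_divide field_simps)
  qed
  define \<Phi> where "\<Phi> f = Bcontfun (\<Psi> f)" for f
  have \<Phi>: "apply_bcontfun (\<Phi> f) = \<Psi> f" for f
    unfolding \<Phi>_def by (rule Bcontfun_inverse[OF \<Psi>])
  have "\<exists>!f. \<Phi> f = f"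
  proof (rule banach_fix_type[of "1 / 2"])
    show "\<forall>f g. dist (\<Phi> f) (\<Phi> g) \<le> 1 / 2 * dist f g"
    proof (intro allI dist_bound)
      fix f g p
      have "norm (T (l (snd p)) (\<lambda>s. U f s (snd p)) (exp (fst p)) - T (l (snd p)) (\<lambda>s. U g s (snd p)) (exp (fst p)))
         \<le> e (exp (fst p)) * (dist f g / 2)"
      proof (rule norm_T_diff_le[OF U1 U1 l_re])
        fix s :: real assume "0 < s"
        have "norm (U f s (snd p) - U g s (snd p)) = e s * dist (apply_bcontfun f (ln s, snd p)) (apply_bcontfun g (ln s, snd p))"
          by (simp add: U_def norm_mult dist_norm flip: right_diff_distrib)
        also have "\<dots> \<le> e s * dist f g" using dist_bounded less_imp_le[OF e_pos] by (intro mult_left_mono)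
        finally show "norm (U f s (snd p) - U g s (snd p)) \<le> e s * dist f g" .
      qed simp
      then show "dist (apply_bcontfun (\<Phi> f) p) (apply_bcontfun (\<Phi> g) p) \<le> 1 / 2 * dist f g"
        unfolding \<Phi> \<Psi>_def dist_norm right_diff_distrib[symmetric] norm_mult
        using e_pos[of "exp (fst p)"] by (simp add: norm_divide field_simps)
    qed
  qed auto
  then obtain f where f: "\<Phi> f = f" by blast
  have fixU: "U f r c = T (l c) (\<lambda>s. U f s c) r" if "0 < r" for r c
  proof -
    have "U f r c = of_real (e r) * \<Psi> f (ln r, c)" unfolding U_def by (subst f[symmetric]) (simp add: \<Phi>)
    then show ?thesis using that e_pos[of r] by (simp add: \<Psi>_def)
  qed
  \<comment> \<open>The a priori bound for \<open>T\<close> is applied to the fixed point itself;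
    absorbing \<open>norm f / 2\<close> yields the factor 2 in front of \<open>e r\<close>.\<close>
  have "norm f \<le> 1 + norm f / 2"
  proof (rule norm_bound)
    fix p
    have "norm (T (l (snd p)) (\<lambda>s. U f s (snd p)) (exp (fst p))) \<le> e (exp (fst p)) * (1 + norm f / 2)"
      using norm_bounded by (intro norm_T_le U1 l_re) (auto simp: U_norm)
    then have "norm (\<Psi> f p) \<le> 1 + norm f / 2"
      using e_pos[of "exp (fst p)"] by (simp add: \<Psi>_def norm_mult norm_divide field_simps)
    then show "norm (apply_bcontfun f p) \<le> 1 + norm f / 2" by (metis \<Phi> f)
  qed
  then have nf: "norm f \<le> 2" by simp
  have bd: "norm (U f r c) \<le> 2 * e r" for r c
    unfolding U_norm using order_trans[OF norm_bounded nf] by (simp add: mult.commute)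
  have "U f r c = T c (\<lambda>s. U f s c) r \<and> norm (U f r c) \<le> 2 * e r" if "\<Lambda> \<le> Re c" "0 < r" for c r
    using fixU[OF that(2)] l_id[OF that(1)] bd by metis
  then show ?thesis using U2[of f] by blast
qed

end

section \<open>Behaviour at the origin\<close>

context shooting begin

text \<open>Since \<open>norm (P c r) \<le> norm (P c s)\<close> for \<open>r \<le> s\<close>, the
  exponentials drop out. The bound grows with \<open>B\<close>, which is harmless: at the origin
  only rates for a fixed \<open>B\<close> matter.\<close>

lemma norm_h_le:
  assumes u: "continuous_on {0<..} u" and c: "\<Lambda> \<le> Re c" and r: "0 < r"
    and \<psi>: "\<And>s. s \<in> {r..R} \<Longrightarrow> norm (of_real (gd s) * u s) / s ^ 3 \<le> \<psi> s" "(\<psi> has_integral I) {r..R}"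
  shows "norm (h c u r) \<le> 2 * B * I"
proof -
  have c0: "0 \<le> Re c" using c \<Lambda>_pos by simp
  have "h c u r = integral {r..R} (\<lambda>s. P c r * (2 * \<i> * of_real B * of_real (gd s / s ^ 3) * u s / P c s))"
    unfolding h_def X_def by (rule integral_mult_right[symmetric])
  also have "norm \<dots> \<le> integral {r..R} (\<lambda>s. 2 * B * \<psi> s)"
  proof (rule integral_norm_bound_integral)
    show "(\<lambda>s. P c r * (2 * \<i> * of_real B * of_real (gd s / s ^ 3) * u s / P c s)) integrable_on {r..R}"
      using r by (intro integrable_continuous_real continuous_intros continuous_on_subset[OF X_integrand_cont[OF u]]) auto
    show "(\<lambda>s. 2 * B * \<psi> s) integrable_on {r..R}" using has_integral_mult_right[OF \<psi>(2), of "2 * B"] by blast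
    fix s assume s: "s \<in> {r..R}"
    have "norm (P c r * (2 * \<i> * of_real B * of_real (gd s / s ^ 3) * u s / P c s))
      = (2 * B * (norm (of_real (gd s) * u s) / s ^ 3)) * (norm (P c r) / norm (P c s))"
      using s r B_pos by (simp add: norm_mult norm_divide norm_power)
    also have "\<dots> \<le> (2 * B * \<psi> s) * 1"
    proof (rule mult_mono)
      have "0 \<le> norm (of_real (gd s) * u s) / s ^ 3" using s r by simp
      then show "0 \<le> 2 * B * \<psi> s" using \<psi>(1)[OF s] B_pos by simp
      show "norm (P c r) / norm (P c s) \<le> 1"
        using norm_P_mono[OF r _ c0, of s] s by (simp add: divide_le_eq)
      show "2 * B * (norm (of_real (gd s) * u s) / s ^ 3) \<le> 2 * B * \<psi> s"
        using \<psi>(1)[OF s] B_pos by (intro mult_left_mono) auto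
    qed auto
    finally show "norm (P c r * (2 * \<i> * of_real B * of_real (gd s / s ^ 3) * u s / P c s)) \<le> 2 * B * \<psi> s"
      by simp
  qed
  also have "\<dots> = 2 * B * I" using \<psi>(2) by (simp add: integral_unique)
  finally show ?thesis .
qed

lemma norm_y_le:
  assumes u: "continuous_on {0<..} u" and r: "0 < r"
    and \<psi>: "\<And>s. s \<in> {r..R} \<Longrightarrow> norm (h c u s) / s\<^sup>2 \<le> \<psi> s" "(\<psi> has_integral I) {r..R}"
  shows "norm (y c u r) \<le> I"
proof -
  have "norm (integral {r..R} (\<lambda>s. of_real (1 / s\<^sup>2) * h c u s)) \<le> integral {r..R} \<psi>"
  proof (rule integral_norm_bound_integral)
    show "(\<lambda>s. of_real (1 / s\<^sup>2) * h c u s) integrable_on {r..R}"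
      using r by (intro integrable_continuous_real continuous_intros continuous_on_subset[OF h_cont[OF u]]) auto
    show "\<psi> integrable_on {r..R}" using \<psi>(2) by blast
  qed (use \<psi>(1) r in \<open>auto simp: norm_mult norm_divide norm_power\<close>)
  then show ?thesis using \<psi>(2) by (simp add: y_def integral_unique)
qed

lemma has_integral_power_neg:
  fixes r b :: real
  assumes "0 < r" "r \<le> b"
  shows "((\<lambda>s. C / s\<^sup>2) has_integral C / r - C / b) {r..b}"
    and "((\<lambda>s. C / s ^ 3) has_integral C / (2 * r\<^sup>2) - C / (2 * b\<^sup>2)) {r..b}"
proof -
  have "((\<lambda>s. C / s\<^sup>2) has_integral - C / b - (- C / r)) {r..b}"
    using assms by (intro fundamental_theorem_of_calculus)
     (auto intro!: derivative_eq_intros simp: field_simps power2_eq_square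
       simp flip: has_real_derivative_iff_has_vector_derivative)
  then show "((\<lambda>s. C / s\<^sup>2) has_integral C / r - C / b) {r..b}" by simp
  have "((\<lambda>s. C / s ^ 3) has_integral - C / (2 * b\<^sup>2) - (- C / (2 * r\<^sup>2))) {r..b}"
    using assms by (intro fundamental_theorem_of_calculus)
     (auto intro!: derivative_eq_intros simp: field_simps power2_eq_square power3_eq_cube
       simp flip: has_real_derivative_iff_has_vector_derivative)
  then show "((\<lambda>s. C / s ^ 3) has_integral C / (2 * r\<^sup>2) - C / (2 * b\<^sup>2)) {r..b}" by simp
qed

text \<open>With \<open>gd s = O(s)\<close> and bounded \<open>u\<close>, the integrand of
  \<open>X\<close> without its exponential is \<open>O(1 / s\<^sup>2)\<close>, whence
  \<open>h = O(1 / r)\<close> and \<open>y = O(1 / r\<^sup>2)\<close>. Then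
  \<open>u' = r ^ 3 * y\<close> is \<open>O(r)\<close>, and \<open>u\<close> has a limit at
  0.\<close>

lemma norm_y_le_bounded:
  assumes u: "continuous_on {0<..} u" and c: "\<Lambda> \<le> Re c" and r: "0 < r"
    and K: "\<And>s. 0 < s \<Longrightarrow> \<bar>gd s\<bar> \<le> K * s" and M: "\<And>s. 0 < s \<Longrightarrow> norm (u s) \<le> M"
  shows "norm (y c u r) \<le> B * K * M / r\<^sup>2"
proof (cases "r \<le> R")
  case False
  have "0 \<le> K" using K[of 1] by simp
  moreover have "0 \<le> M" using order_trans[OF norm_ge_zero M[OF r]] .
  ultimately show ?thesis using False B_pos by (simp add: y_supp)
next
  case True
  have K0: "0 \<le> K" using K[of 1] by simp
  have M0: "0 \<le> M" using order_trans[OF norm_ge_zero M[OF r]] .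
  have h: "norm (h c u s) \<le> 2 * B * (K * M / s)" if s: "0 < s" "s \<le> R" for s
  proof -
    have "norm (h c u s) \<le> 2 * B * (K * M / s - K * M / R)"
    proof (rule norm_h_le[OF u c s(1) _ has_integral_power_neg(1)[OF s]])
      fix t assume "t \<in> {s..R}"
      then have t: "0 < t" using s by auto
      have "norm (of_real (gd t) * u t) \<le> (K * t) * M"
        unfolding norm_mult using K[OF t] M[OF t] K0 t by (intro mult_mono) auto
      then have "norm (of_real (gd t) * u t) / t ^ 3 \<le> (K * t) * M / t ^ 3"
        using t by (intro divide_right_mono) auto
      also have "\<dots> = K * M / t\<^sup>2" using t by (simp add: power2_eq_square power3_eq_cube)
      finally show "norm (of_real (gd t) * u t) / t ^ 3 \<le> K * M / t\<^sup>2" .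
    qed
    also have "\<dots> \<le> 2 * B * (K * M / s)" using B_pos K0 M0 R_pos by (intro mult_left_mono) auto
    finally show ?thesis .
  qed
  have "norm (y c u r) \<le> (2 * B * (K * M)) / (2 * r\<^sup>2) - (2 * B * (K * M)) / (2 * R\<^sup>2)"
  proof (rule norm_y_le[OF u r _ has_integral_power_neg(2)[OF r True]])
    fix s assume "s \<in> {r..R}"
    then have s: "0 < s" "s \<le> R" using r by auto
    have "norm (h c u s) / s\<^sup>2 \<le> 2 * B * (K * M / s) / s\<^sup>2"
      using h[OF s] by (intro divide_right_mono) auto
    then show "norm (h c u s) / s\<^sup>2 \<le> 2 * B * (K * M) / s ^ 3"
      by (simp add: power2_eq_square power3_eq_cube)
  qed
  also have "\<dots> \<le> B * K * M / r\<^sup>2"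
    using zero_le_divide_iff[of "B * (K * M)" "R\<^sup>2"] B_pos K0 M0 by (simp add: mult.assoc)
  finally show ?thesis .
qed

text \<open>The second round of the bootstrap at the origin: quadratic decay of \<open>u\<close>
  makes \<open>h\<close> bounded and improves \<open>y\<close> by one power of
  \<open>r\<close>.\<close>

lemma norm_y_le_quadratic:
  assumes u: "continuous_on {0<..} u" and c: "\<Lambda> \<le> Re c" and r: "0 < r"
    and K: "\<And>s. 0 < s \<Longrightarrow> \<bar>gd s\<bar> \<le> K * s" and M: "\<And>s. 0 < s \<Longrightarrow> norm (u s) \<le> M * s\<^sup>2"
  shows "norm (y c u r) \<le> 2 * B * K * M * R / r"
proof (cases "r \<le> R")
  case False
  have "0 \<le> K" using K[of 1] by simp
  moreover have "0 \<le> M" using order_trans[OF norm_ge_zero M[of 1]] by simp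
  ultimately show ?thesis using False B_pos r R_pos by (simp add: y_supp)
next
  case True
  have K0: "0 \<le> K" using K[of 1] by simp
  have M0: "0 \<le> M" using order_trans[OF norm_ge_zero M[of 1]] by simp
  have h: "norm (h c u s) \<le> 2 * B * (K * M * R)" if s: "0 < s" "s \<le> R" for s
  proof -
    have i: "((\<lambda>_. K * M) has_integral (R - s) * (K * M)) {s..R}"
      using has_integral_const_real[of "K * M" s R] s by simp
    have "norm (h c u s) \<le> 2 * B * ((R - s) * (K * M))"
    proof (rule norm_h_le[OF u c s(1) _ i])
      fix t assume "t \<in> {s..R}"
      then have t: "0 < t" using s by auto
      have "norm (of_real (gd t) * u t) \<le> (K * t) * (M * t\<^sup>2)"
        unfolding norm_mult using K[OF t] M[OF t] K0 t by (intro mult_mono) auto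
      then have "norm (of_real (gd t) * u t) / t ^ 3 \<le> (K * t) * (M * t\<^sup>2) / t ^ 3"
        using t by (intro divide_right_mono) auto
      also have "\<dots> = K * M" using t by (simp add: power2_eq_square power3_eq_cube)
      finally show "norm (of_real (gd t) * u t) / t ^ 3 \<le> K * M" .
    qed
    also have "\<dots> \<le> 2 * B * (R * (K * M))"
      using B_pos K0 M0 s by (intro mult_left_mono mult_right_mono) auto
    finally show ?thesis by (simp add: mult_ac)
  qed
  have "norm (y c u r) \<le> (2 * B * (K * M * R)) / r - (2 * B * (K * M * R)) / R"
    by (rule norm_y_le[OF u r _ has_integral_power_neg(1)[OF r True]])
       (use h r in \<open>auto intro!: divide_right_mono\<close>)
  also have "\<dots> \<le> 2 * B * K * M * R / r"
    using mult_nonneg_nonneg[of B "K * M"] B_pos K0 M0 R_pos by (simp add: mult.assoc)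
  finally show ?thesis .
qed

lemma T_increment_le:
  assumes u: "continuous_on {0<..} u" and rs: "0 < r" "r \<le> s"
    and C: "\<And>t. 0 < t \<Longrightarrow> t \<le> s \<Longrightarrow> norm (of_real (t ^ 3) * y c u t) \<le> C"
  shows "norm (T c u s - T c u r) \<le> C * s"
proof -
  have C0: "0 \<le> C" using order_trans[OF norm_ge_zero C[of s]] rs by simp
  have "norm (T c u s - T c u r) \<le> C * norm (s - r)"
  proof (rule differentiable_bound[of "{r..s}" _ "\<lambda>t x. x *\<^sub>R (of_real (t ^ 3) * y c u t)"])
    fix t assume t: "t \<in> {r..s}"
    then show "(T c u has_derivative (\<lambda>x. x *\<^sub>R (of_real (t ^ 3) * y c u t))) (at t within {r..s})"
      using has_vector_derivative_at_within[OF T_deriv[OF u, of t c]] rs by (auto simp: has_vector_derivative_def)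
    show "onorm (\<lambda>x. x *\<^sub>R (of_real (t ^ 3) * y c u t)) \<le> C"
    proof (rule onorm_le)
      fix x :: real
      have "\<bar>x\<bar> * norm (of_real (t ^ 3) * y c u t) \<le> \<bar>x\<bar> * C"
        using t rs by (intro mult_left_mono C) auto
      then show "norm (x *\<^sub>R (of_real (t ^ 3) * y c u t)) \<le> C * norm x" by (simp add: mult_ac)
    qed
  qed (use rs in auto)
  also have "\<dots> \<le> C * s" using C0 rs by (intro mult_left_mono) auto
  finally show ?thesis .
qed

text \<open>The increments of \<open>U\<close> near 0 are bounded by \<open>C * s\<^sup>2\<close>
  with \<open>C\<close> independent of \<open>c\<close>. The values at the radii
  \<open>1 / (n + 1)\<close> are therefore uniformly Cauchy, and their limit inherits continuity in
  \<open>c\<close>.\<close>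

lemma limit_at_0:
  assumes U: "continuous_on ({0<..} \<times> UNIV) (\<lambda>(r, c). U r c)"
    and fixU: "\<And>c r. \<Lambda> \<le> Re c \<Longrightarrow> 0 < r \<Longrightarrow> U r c = T c (\<lambda>s. U s c) r"
    and M: "\<And>c r. \<Lambda> \<le> Re c \<Longrightarrow> 0 < r \<Longrightarrow> norm (U r c) \<le> M"
    and K: "\<And>s. 0 < s \<Longrightarrow> \<bar>gd s\<bar> \<le> K * s"
  obtains D where "continuous_on {c. \<Lambda> \<le> Re c} D"
    "\<And>c r. \<Lambda> \<le> Re c \<Longrightarrow> 0 < r \<Longrightarrow> norm (U r c - D c) \<le> B * K * M * r\<^sup>2"
proof -
  let ?L = "{c. \<Lambda> \<le> Re c}"
  define C where "C = B * K * M"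
  have "\<Lambda> \<le> Re (of_real \<Lambda>)" by simp
  then have M0: "0 \<le> M" using order_trans[OF norm_ge_zero M[of "of_real \<Lambda>" 1]] by simp
  then have C0: "0 \<le> C" using K[of 1] B_pos by (simp add: C_def)
  have U1: "continuous_on {0<..} (\<lambda>r. U r c)" for c
  proof -
    have "continuous_on {0<..} (\<lambda>r. (\<lambda>(r, c). U r c) (r, c))"
      by (rule continuous_on_compose2[OF U]) (auto intro!: continuous_intros)
    then show ?thesis by simp
  qed
  have U2: "continuous_on S (\<lambda>c. U r c)" if "0 < r" for r S
  proof -
    have "continuous_on S (\<lambda>c. (\<lambda>(r, c). U r c) (r, c))"
      by (rule continuous_on_compose2[OF U]) (use that in \<open>auto intro!: continuous_intros\<close>)
    then show ?thesis by simp
  qed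
  have inc: "norm (U s c - U r c) \<le> C * s\<^sup>2" if "\<Lambda> \<le> Re c" "0 < r" "r \<le> s" for r s c
  proof -
    have "norm (T c (\<lambda>s. U s c) s - T c (\<lambda>s. U s c) r) \<le> (C * s) * s"
    proof (rule T_increment_le[OF U1 that(2,3)])
      fix t :: real assume t: "0 < t" "t \<le> s"
      have "norm (of_real (t ^ 3) * y c (\<lambda>s. U s c) t) = t ^ 3 * norm (y c (\<lambda>s. U s c) t)"
        using t by (simp add: norm_mult norm_power)
      also have "\<dots> \<le> t ^ 3 * (C / t\<^sup>2)"
        using norm_y_le_bounded[OF U1 that(1) t(1) K M[OF that(1)]] t
        by (intro mult_left_mono) (auto simp: C_def)
      also have "\<dots> = C * t" using t by (simp add: power2_eq_square power3_eq_cube)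
      also have "\<dots> \<le> C * s" using C0 t by (intro mult_left_mono) auto
      finally show "norm (of_real (t ^ 3) * y c (\<lambda>s. U s c) t) \<le> C * s" .
    qed
    then show ?thesis using that by (simp add: fixU[symmetric] power2_eq_square)
  qed
  define f where "f n c = U (1 / real (Suc n)) c" for n c
  have f: "norm (f m c - f k c) \<le> C * (1 / real (Suc m))\<^sup>2" if "m \<le> k" "c \<in> ?L" for m k c
    unfolding f_def using that by (intro inc) (auto simp: frac_le)
  have lim0: "(\<lambda>m. C * (1 / real (Suc m))\<^sup>2) \<longlonglongrightarrow> 0"
    by (rule tendsto_mult_right_zero, rule tendsto_null_power[OF LIMSEQ_Suc[OF lim_1_over_n]]) simp
  have "uniformly_Cauchy_on ?L f"
    unfolding uniformly_Cauchy_on_def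
  proof (intro allI impI)
    fix \<epsilon> :: real assume "0 < \<epsilon>"
    then have "\<forall>\<^sub>F m in sequentially. C * (1 / real (Suc m))\<^sup>2 < \<epsilon>"
      using lim0 by (auto dest: order_tendstoD(2))
    then obtain N where N: "\<And>m. N \<le> m \<Longrightarrow> C * (1 / real (Suc m))\<^sup>2 < \<epsilon>"
      by (auto simp: eventually_sequentially)
    have "dist (f m c) (f k c) < \<epsilon>" if "c \<in> ?L" "N \<le> m" "N \<le> k" for c m k
    proof (cases "m \<le> k")
      case True
      then show ?thesis using f[OF True that(1)] N[OF that(2)] by (simp add: dist_norm)
    next
      case False
      then have "k \<le> m" by simp
      then show ?thesis using f[OF _ that(1), of k m] N[OF that(3)] by (simp add: dist_norm norm_minus_commute)
    qed
    then show "\<exists>N. \<forall>x\<in>?L. \<forall>m\<ge>N. \<forall>n\<ge>N. dist (f m x) (f n x) < \<epsilon>" by blast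
  qed
  then obtain D where D: "uniform_limit ?L f D sequentially"
    unfolding uniformly_convergent_eq_Cauchy[symmetric] uniformly_convergent_on_def by blast
  show thesis
  proof
    show "continuous_on ?L D"
      by (rule uniform_limit_theorem[OF _ D]) (auto simp: f_def intro!: always_eventually U2)
    fix c r assume c: "\<Lambda> \<le> Re c" and r: "0 < (r :: real)"
    have "(\<lambda>n. f n c) \<longlonglongrightarrow> D c" using tendsto_uniform_limitI[OF D] c by simp
    then have "(\<lambda>n. norm (U r c - f n c)) \<longlonglongrightarrow> norm (U r c - D c)" by (intro tendsto_intros)
    moreover have "\<forall>\<^sub>F n in sequentially. norm (U r c - f n c) \<le> C * r\<^sup>2"
    proof -
      have "\<forall>\<^sub>F n in sequentially. 1 / real (Suc n) < r"
        using LIMSEQ_Suc[OF lim_1_over_n] r by (rule order_tendstoD(2))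
      then show ?thesis
        by eventually_elim (unfold f_def, rule inc, use c in auto)
    qed
    ultimately show "norm (U r c - D c) \<le> B * K * M * r\<^sup>2"
      unfolding C_def[symmetric] by (rule tendsto_upperbound) simp
  qed
qed

end

section \<open>Comparison with the piecewise constant vortex\<close>

context shooting begin

text \<open>The value at 0 for the step profile and the limit kernel: \<open>u (sqrt 2) = 1\<close>,
  then \<open>u 1 = 1 + 2 H(1, sqrt 2) = 1 + 3 i / (4 c)\<close>, and finally
  \<open>u 0 = 1 - 4 H(0, 1) u 1 + 2 H(0, sqrt 2)\<close>. The denominators \<open>2 i + c\<close>
  and \<open>c\<close> come from the angular velocities 1 and 0 at the jumps.\<close>

definition D0 :: "complex \<Rightarrow> complex" where
  "D0 c = 1 + \<i> / c - 2 * \<i> / (2 * \<i> + c) * (1 + 3 * \<i> / (4 * c))"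

text \<open>Serves two purposes: stretches where the variation \<open>V\<close> is small, and the
  action of a layer on itself, where the kernel bound \<open>C\<close> is small.\<close>

lemma layer_negligible:
  assumes "f integrable_on {a..b}" "\<And>s. s \<in> {a..b} \<Longrightarrow> norm (f s) \<le> C * \<bar>gd s\<bar>"
    and "integral {a..b} (\<lambda>s. \<bar>gd s\<bar>) \<le> V" "0 \<le> C"
  shows "norm (integral {a..b} f :: complex) \<le> C * V"
proof -
  have i: "(\<lambda>s. \<bar>gd s\<bar>) integrable_on {a..b}"
    by (intro integrable_continuous_real continuous_intros continuous_on_subset[OF gd_cont]) auto
  have "norm (integral {a..b} f) \<le> integral {a..b} (\<lambda>s. C * \<bar>gd s\<bar>)"
    by (rule integral_norm_bound_integral[OF assms(1)]) (use assms(2) has_integral_mult_right[OF integrable_integral[OF i], of C] in auto)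
  also have "\<dots> = C * integral {a..b} (\<lambda>s. \<bar>gd s\<bar>)" by (rule integral_mult_right)
  also have "\<dots> \<le> C * V" using assms by (intro mult_left_mono) auto
  finally show ?thesis .
qed

text \<open>Makes precise that \<open>gd\<close> on a thin layer acts as a point mass
  \<open>J\<close>: the kernel and the mode are nearly constant there and are replaced by
  \<open>F\<close>.\<close>

lemma layer_concentrated:
  assumes f: "f integrable_on {a..b}" "\<And>s. s \<in> {a..b} \<Longrightarrow> norm (f s - F * of_real (gd s)) \<le> C * \<bar>gd s\<bar>"
    and V: "integral {a..b} (\<lambda>s. \<bar>gd s\<bar>) \<le> V" "0 \<le> C"
    and J: "\<bar>integral {a..b} gd - J\<bar> \<le> t"
  shows "norm (integral {a..b} f - F * of_real J :: complex) \<le> C * V + norm F * t"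
proof -
  have g: "(gd has_integral integral {a..b} gd) {a..b}"
    by (intro integrable_integral integrable_continuous_real continuous_on_subset[OF gd_cont]) auto
  have gi: "((\<lambda>s. F * of_real (gd s)) has_integral F * of_real (integral {a..b} gd)) {a..b}"
    by (intro has_integral_mult_right has_integral_of_real g)
  have "(\<lambda>s. f s - F * of_real (gd s)) integrable_on {a..b}"
    using has_integral_diff[OF integrable_integral[OF f(1)] gi] by blast
  then have "norm (integral {a..b} (\<lambda>s. f s - F * of_real (gd s))) \<le> C * V"
    by (rule layer_negligible) (use f(2) V in auto)
  moreover have "integral {a..b} (\<lambda>s. f s - F * of_real (gd s)) = integral {a..b} f - F * of_real (integral {a..b} gd)"
    using has_integral_diff[OF integrable_integral[OF f(1)] gi] by (rule integral_unique)
  moreover have "norm (F * of_real (integral {a..b} gd) - F * of_real J) \<le> norm F * t"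
    using J by (auto simp: norm_mult intro!: mult_left_mono simp flip: right_diff_distrib of_real_diff)
  ultimately show ?thesis
    using norm_triangle_ineq[of "integral {a..b} f - F * of_real (integral {a..b} gd)" "F * of_real (integral {a..b} gd) - F * of_real J"]
    by (simp add: algebra_simps)
qed

lemma power4_diff_le:
  fixes x y :: real
  assumes "0 \<le> x" "x \<le> 1" "0 \<le> y" "y \<le> 1"
  shows "\<bar>x ^ 4 - y ^ 4\<bar> \<le> 4 * \<bar>x - y\<bar>"
proof -
  have "x ^ 4 - y ^ 4 = (x - y) * (x ^ 3 + x\<^sup>2 * y + x * y\<^sup>2 + y ^ 3)"
    by (simp add: algebra_simps power2_eq_square power3_eq_cube power4_eq_xxxx)
  moreover have "\<bar>x ^ 3 + x\<^sup>2 * y + x * y\<^sup>2 + y ^ 3\<bar> \<le> 4"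
  proof -
    have "x ^ 3 \<le> 1" "x\<^sup>2 * y \<le> 1" "x * y\<^sup>2 \<le> 1" "y ^ 3 \<le> 1"
      using assms by (auto intro!: mult_le_one power_le_one)
    moreover have "0 \<le> x ^ 3" "0 \<le> x\<^sup>2 * y" "0 \<le> x * y\<^sup>2" "0 \<le> y ^ 3" using assms by auto
    ultimately show ?thesis by linarith
  qed
  ultimately show ?thesis
    by (simp add: abs_mult mult.commute[of 4] mult_left_mono)
qed

text \<open>Besides the error \<open>\<delta>\<close> of the asymptotic kernel, freezing the power
  costs \<open>x / (2 * \<Lambda>)\<close>, and freezing the angular velocity costs
  \<open>t / \<Lambda>\<^sup>2\<close>, because both denominators have modulus at least
  \<open>\<Lambda>\<close>.\<close>

lemma H_near:
  assumes c: "\<Lambda> \<le> Re c"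
    and \<delta>: "norm (H c r s - of_real (1 - (r / s) ^ 4) * \<i> / (2 * (2 * \<i> * of_real (v s) + c))) \<le> \<delta>"
    and v: "\<bar>v s - v0\<bar> \<le> t" and p: "\<bar>1 - (r / s) ^ 4 - p0\<bar> \<le> x" "\<bar>p0\<bar> \<le> 1"
  shows "norm (H c r s - of_real p0 * \<i> / (2 * (2 * \<i> * of_real v0 + c))) \<le> \<delta> + x / (2 * \<Lambda>) + t / \<Lambda>\<^sup>2"
proof -
  define a where "a = 2 * \<i> * of_real (v s) + c"
  define b where "b = 2 * \<i> * of_real v0 + c"
  have ab: "\<Lambda> \<le> norm a" "\<Lambda> \<le> norm b" unfolding a_def b_def by (auto intro: norm_denominator c)
  then have nz: "a \<noteq> 0" "b \<noteq> 0" using \<Lambda>_pos by auto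
  define p where "p = 1 - (r / s) ^ 4"
  have "of_real p * \<i> / (2 * a) - of_real p0 * \<i> / (2 * b) =
     of_real (p - p0) * \<i> / (2 * a) + of_real p0 * (\<i> * (b - a) / (2 * a * b))"
    using nz by (simp add: field_simps)
  also have "norm \<dots> \<le> norm (of_real (p - p0) * \<i> / (2 * a)) + norm (of_real p0 * (\<i> * (b - a) / (2 * a * b)))"
    by (rule norm_triangle_ineq)
  also have "norm (of_real (p - p0) * \<i> / (2 * a)) \<le> x / (2 * \<Lambda>)"
  proof -
    have "norm (of_real (p - p0) * \<i> / (2 * a)) = \<bar>p - p0\<bar> / (2 * norm a)"
      by (simp only: norm_divide norm_mult norm_of_real norm_numeral norm_ii mult_1_right)
    also have "\<dots> \<le> x / (2 * \<Lambda>)" using p ab \<Lambda>_pos by (intro frac_le) (auto simp: p_def)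
    finally show ?thesis .
  qed
  also have "norm (of_real p0 * (\<i> * (b - a) / (2 * a * b))) \<le> t / \<Lambda>\<^sup>2"
  proof -
    have "b - a = 2 * \<i> * of_real (v0 - v s)" by (simp add: a_def b_def algebra_simps)
    then have "norm (b - a) \<le> 2 * t" using v by (simp add: norm_mult abs_minus_commute del: of_real_diff)
    moreover have "2 * \<Lambda>\<^sup>2 \<le> 2 * norm a * norm b" using ab \<Lambda>_pos by (simp add: power2_eq_square mult_mono)
    ultimately have "norm (b - a) / (2 * norm a * norm b) \<le> 2 * t / (2 * \<Lambda>\<^sup>2)" 
      using \<Lambda>_pos v by (intro frac_le) auto
    then have q: "norm (\<i> * (b - a) / (2 * a * b)) \<le> t / \<Lambda>\<^sup>2" by (simp add: norm_mult norm_divide)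
    have "norm (of_real p0 * (\<i> * (b - a) / (2 * a * b))) \<le> 1 * (t / \<Lambda>\<^sup>2)"
      unfolding norm_mult[of "of_real p0"] using p(2) q by (intro mult_mono) auto
    then show ?thesis by simp
  qed
  finally have "norm (of_real p * \<i> / (2 * a) - of_real p0 * \<i> / (2 * b)) \<le> x / (2 * \<Lambda>) + t / \<Lambda>\<^sup>2" by simp
  moreover have "norm (H c r s - of_real p * \<i> / (2 * a)) \<le> \<delta>" using \<delta> by (simp add: p_def a_def)
  ultimately show ?thesis
    using norm_triangle_ineq[of "H c r s - of_real p * \<i> / (2 * a)" "of_real p * \<i> / (2 * a) - of_real p0 * \<i> / (2 * b)"]
    by (simp add: b_def)
qed

end

lemma one_minus_power4_le:
  fixes x :: real assumes "0 \<le> x" "x \<le> 1" shows "1 - x ^ 4 \<le> 4 * (1 - x)"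
  using Bernoulli_inequality[of "x - 1" 4] assms by simp

text \<open>The Volterra equation is triangular: the outer layer sees only itself, where
  \<open>u\<close> is nearly 1; the inner layer sees the outer one; the radius
  \<open>r\<^sub>0\<close> sees both. Each stage reproduces a term of \<open>D0\<close>, and all
  errors are linear in \<open>t\<close>, \<open>\<delta>\<close> and \<open>r\<^sub>0\<close>. The
  radius stays positive here, and the limit is taken afterwards.\<close>

lemma (in shooting) u_estimate:
  fixes u :: "real \<Rightarrow> complex"
  assumes \<Lambda>: "\<Lambda> = 1 / 4" and R: "R = sqrt 2" and c: "\<Lambda> \<le> Re c"
    and u: "continuous_on {0<..} u" "\<And>r. 0 < r \<Longrightarrow> u r = T c u r"
    and M: "1 \<le> M" "\<And>r. 0 < r \<Longrightarrow> norm (u r) \<le> M"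
    and w: "0 < w" "w \<le> t" "t \<le> 1 / 10"
    and V: "\<And>r. 0 < r \<Longrightarrow> integral {r..R} (\<lambda>s. \<bar>gd s\<bar>) \<le> 9"
    and flat: "\<And>r. 0 < r \<Longrightarrow> integral {r..1} (\<lambda>s. \<bar>gd s\<bar>) \<le> t"
      "integral {1 + w..R - w} (\<lambda>s. \<bar>gd s\<bar>) \<le> t"
    and jump: "\<bar>integral {1..1 + w} gd - (- 4)\<bar> \<le> t" "\<bar>integral {R - w..R} gd - 2\<bar> \<le> t"
    and v: "\<And>s. s \<in> {1..1 + w} \<Longrightarrow> \<bar>v s - 1\<bar> \<le> t" "\<And>s. s \<in> {R - w..R} \<Longrightarrow> \<bar>v s - 0\<bar> \<le> t"
    and \<delta>: "\<And>r s. 0 < r \<Longrightarrow> r \<le> s \<Longrightarrow>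
      norm (H c r s - of_real (1 - (r / s) ^ 4) * \<i> / (2 * (2 * \<i> * of_real (v s) + c))) \<le> \<delta>"
    and r0: "0 < r\<^sub>0" "r\<^sub>0 \<le> 1"
  shows "norm (u r\<^sub>0 - D0 c) \<le> 40000 * M * (t + \<delta> + r\<^sub>0)"
proof -
  have "14 / 10 < sqrt 2" by (rule real_less_rsqrt) (simp add: power2_eq_square)
  moreover have "sqrt 2 < 15 / 10" by (rule real_less_lsqrt) (simp_all add: power2_eq_square)
  ultimately have R2: "14 / 10 < R" "R < 15 / 10" unfolding R .
  have Rsq: "R ^ 4 = 4" unfolding R by (simp add: power4_eq_xxxx)
  note \<Lambda>_pos
  have \<delta>0: "0 \<le> \<delta>" using order_trans[OF norm_ge_zero \<delta>[of 1 1]] by simp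
  have X: "x \<le> M * x" if "0 \<le> x" for x using mult_right_mono[OF M(1) that] by simp
  \<comment> \<open>As \<open>1 \<le> M\<close>, errors with and without the factor
    \<open>norm (u s)\<close> can be measured by the same quantities.\<close>
  define t1 where "t1 = M * t"
  define d1 where "d1 = M * \<delta>"
  define r1 where "r1 = M * r\<^sub>0"
  have small: "0 \<le> t" "t \<le> t1" "\<delta> \<le> d1" "r\<^sub>0 \<le> r1" using w X \<delta>0 r0 by (auto simp: t1_def d1_def r1_def)
  have nc: "1 / 4 \<le> norm c" "1 / 4 \<le> norm (2 * \<i> + c)"
    using norm_denominator[OF c, of 0] norm_denominator[OF c, of 1] \<Lambda> by auto
  then have cnz: "c \<noteq> 0" "2 * \<i> + c \<noteq> 0" by auto
  define I where "I r a b = integral {a..b} (\<lambda>s. H c r s * of_real (gd s) * u s)" for r a b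
  have int: "(\<lambda>s. H c r s * of_real (gd s) * u s) integrable_on {a..b}" if "0 < r" "r \<le> a" "b \<le> R" for r a b
  proof (cases "a \<le> b")
    case True
    have "(\<lambda>s. H c r s * of_real (gd s) * u s) integrable_on {r..R}"
      using T_kernel[OF u(1), of r c] that True by auto
    then show ?thesis by (rule integrable_on_subinterval) (use that in auto)
  qed (simp add: integrable_on_empty)
  have uI: "u r = 1 + I r r R" if "0 < r" "r \<le> R" for r
    using integral_unique[OF T_kernel[OF u(1) that, of c]] u(2)[OF that(1)] by (simp add: I_def)
  have comb: "I r a b + I r b d = I r a d" if "0 < r" "r \<le> a" "a \<le> b" "b \<le> d" "d \<le> R" for r a b d
    unfolding I_def using that by (intro Henstock_Kurzweil_Integration.integral_combine int) auto
  have gdi: "(\<lambda>s. \<bar>gd s\<bar>) integrable_on {a..b}" for a b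
    by (intro integrable_continuous_real continuous_intros continuous_on_subset[OF gd_cont]) auto
  have V9: "integral {a..b} (\<lambda>s. \<bar>gd s\<bar>) \<le> 9" if "0 < a" "b \<le> R" for a b
    using V[OF that(1)] integral_subset_le[OF _ gdi gdi, of a b a R] that by fastforce
  have H2: "norm (H c r s) \<le> 2" if "0 < r" "r \<le> s" for r s
    using norm_H_le'[OF that c] \<Lambda> by simp
  \<comment> \<open>Two points of one layer are at most \<open>w\<close> apart, so
    \<open>1 - (r / s) ^ 4\<close> is at most \<open>4 * w\<close>; this is where the zero on the
    diagonal is used.\<close>
  have Hdiag: "norm (H c r s) \<le> 8 * w" if "1 \<le> r" "r \<le> s" "s \<le> r + w" for r s
  proof -
    have "1 - (r / s) ^ 4 \<le> 4 * (1 - r / s)" using that by (intro one_minus_power4_le) auto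
    also have "1 - r / s = (s - r) / s" using that by (simp add: field_simps)
    also have "(s - r) / s \<le> w / 1" using that w by (intro frac_le) auto
    finally have "1 - (r / s) ^ 4 \<le> 4 * w" by simp
    then show ?thesis using norm_H_le[of r s c] that c \<Lambda> by simp
  qed
  have diag: "norm (I r r b) \<le> 72 * t1" if "1 \<le> r" "b \<le> r + w" "b \<le> R" for r b
  proof -
    have "norm (I r r b) \<le> (8 * w * M) * 9"
      unfolding I_def
    proof (rule layer_negligible[OF int])
      fix s assume s: "s \<in> {r..b}"
      have "norm (H c r s) * \<bar>gd s\<bar> * norm (u s) \<le> (8 * w) * \<bar>gd s\<bar> * M"
        using s that w M(2)[of s] by (intro mult_mono Hdiag) auto
      then show "norm (H c r s * of_real (gd s) * u s) \<le> 8 * w * M * \<bar>gd s\<bar>"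
        by (simp add: norm_mult mult_ac)
    qed (use that w M V9 in auto)
    also have "\<dots> \<le> 72 * t1" using w M by (simp add: t1_def mult.commute)
    finally show ?thesis .
  qed
  have negl: "norm (I r a b) \<le> 2 * t1" if "integral {a..b} (\<lambda>s. \<bar>gd s\<bar>) \<le> t" "0 < r" "r \<le> a" "b \<le> R" for r a b
  proof -
    have "norm (I r a b) \<le> (2 * M) * t"
      unfolding I_def
    proof (rule layer_negligible[OF int])
      fix s assume s: "s \<in> {a..b}"
      have "norm (H c r s) * \<bar>gd s\<bar> * norm (u s) \<le> 2 * \<bar>gd s\<bar> * M"
        using s that M(2)[of s] by (intro mult_mono H2) auto
      then show "norm (H c r s * of_real (gd s) * u s) \<le> 2 * M * \<bar>gd s\<bar>"
        by (simp add: norm_mult mult_ac)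
    qed (use that M in auto)
    then show ?thesis by (simp add: t1_def)
  qed
  have conc: "norm (I r a b - F * U1 * of_real J) \<le> (x * norm U1 + 2 * z) * 9 + norm (F * U1) * t"
    if "\<bar>integral {a..b} gd - J\<bar> \<le> t" "0 < r" "r \<le> a" "a \<le> b" "b \<le> R"
      "\<And>s. s \<in> {a..b} \<Longrightarrow> norm (H c r s - F) \<le> x" "\<And>s. s \<in> {a..b} \<Longrightarrow> norm (u s - U1) \<le> z" for r a b F U1 J x z
  proof -
    have xz: "0 \<le> x" "0 \<le> z"
      using order_trans[OF norm_ge_zero that(6)[of a]] order_trans[OF norm_ge_zero that(7)[of a]] that by auto
    have "norm (I r a b - (F * U1) * of_real J) \<le> (x * norm U1 + 2 * z) * 9 + norm (F * U1) * t"
      unfolding I_def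
    proof (rule layer_concentrated[OF int])
      fix s assume s: "s \<in> {a..b}"
      have "H c r s * of_real (gd s) * u s - F * U1 * of_real (gd s) =
         ((H c r s - F) * U1 + H c r s * (u s - U1)) * of_real (gd s)" by (simp add: algebra_simps)
      also have "norm \<dots> \<le> (x * norm U1 + 2 * z) * \<bar>gd s\<bar>"
        unfolding norm_mult[of _ "of_real (gd s)"] norm_of_real
      proof (rule mult_right_mono)
        have "norm ((H c r s - F) * U1 + H c r s * (u s - U1)) \<le> norm (H c r s - F) * norm U1 + norm (H c r s) * norm (u s - U1)"
          by (rule order_trans[OF norm_triangle_ineq]) (simp add: norm_mult)
        also have "\<dots> \<le> x * norm U1 + 2 * z"
          using that(6,7)[OF s] H2[of r s] s that xz by (intro add_mono mult_mono) auto
        finally show "norm ((H c r s - F) * U1 + H c r s * (u s - U1)) \<le> x * norm U1 + 2 * z" .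
      qed simp
      finally show "norm (H c r s * of_real (gd s) * u s - F * U1 * of_real (gd s)) \<le> (x * norm U1 + 2 * z) * \<bar>gd s\<bar>" .
    qed (use that xz V9 in auto)
    then show ?thesis .
  qed
  have L2: "norm (u r - 1) \<le> 72 * t1" if "r \<in> {R - w..R}" for r
    using diag[of r R] uI[of r] that R2 w by auto
  have cn: "norm (\<i> / (2 * c)) \<le> 2" "norm (\<i> / (2 * (2 * \<i> + c))) \<le> 2" "norm (\<i> / c) \<le> 4"
  proof -
    have "norm (\<i> / (2 * d)) \<le> 2" if "1 / 4 \<le> norm d" for d :: complex
    proof -
      have "1 / (2 * norm d) \<le> 1 / (2 * (1 / 4))" using that by (intro divide_left_mono) auto
      then show ?thesis by (simp add: norm_divide norm_mult)
    qed
    from this[OF nc(1)] this[OF nc(2)] show "norm (\<i> / (2 * c)) \<le> 2" "norm (\<i> / (2 * (2 * \<i> + c))) \<le> 2" .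
    have "\<i> / c = 2 * (\<i> / (2 * c))" by simp
    then show "norm (\<i> / c) \<le> 4" using \<open>norm (\<i> / (2 * c)) \<le> 2\<close> by (simp only: norm_mult norm_numeral)
  qed
  \<comment> \<open>\<open>F1\<close> is the limit kernel from \<open>sqrt 2\<close> to 1: the power
    factor is \<open>1 - 1 / 4 = 3 / 4\<close> and the angular velocity is 0.
    \<open>U1 = 1 + 2 * F1\<close> is the limit of \<open>u\<close> at the inner jump.\<close>
  define F1 where "F1 = 3 * \<i> / (8 * c)"
  define U1 where "U1 = 1 + 3 * \<i> / (4 * c)"
  have F1n: "norm F1 \<le> 2" and U1n: "norm U1 \<le> 4"
  proof -
    have "norm F1 = 3 / 8 * norm (\<i> / c)" by (simp add: F1_def norm_divide norm_mult)
    then show "norm F1 \<le> 2" using cn by simp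
    have "norm (3 * \<i> / (4 * c)) = 3 / 4 * norm (\<i> / c)" by (simp add: norm_divide norm_mult)
    then show "norm U1 \<le> 4" using cn norm_triangle_ineq[of 1 "3 * \<i> / (4 * c)"] by (simp add: U1_def)
  qed
  have L1: "norm (u r - U1) \<le> 1800 * (t1 + d1)" if r: "r \<in> {1..1 + w}" for r
  proof -
    have "norm (I r (R - w) R - F1 * 1 * of_real 2) \<le> ((\<delta> + 12 * t * 2 + 16 * t) * norm (1 :: complex) + 2 * (72 * t1)) * 9 + norm (F1 * 1) * t"
    proof (rule conc[OF jump(2)])
      fix s assume s: "s \<in> {R - w..R}"
      have s1: "1 \<le> s" "r \<le> s" using s r R2 w by auto
      have "\<bar>(r / s) ^ 4 - (1 / R) ^ 4\<bar> \<le> 4 * \<bar>r / s - 1 / R\<bar>"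
        using s1 r R2 by (intro power4_diff_le) auto
      also have "r / s - 1 / R = ((r - 1) * R + (R - s)) / (s * R)" using s1 R2 by (simp add: field_simps)
      also have "\<bar>\<dots>\<bar> \<le> (2 * w + w) / 1"
      proof -
        have "(r - 1) * R \<le> w * 2" using r R2 w by (intro mult_mono) auto
        moreover have "0 \<le> (r - 1) * R" using r R2 by simp
        moreover have "1 \<le> s * R" using mult_mono[of 1 s 1 R] s1 R2 by simp
        ultimately show ?thesis unfolding abs_divide using s by (intro frac_le) auto
      qed
      finally have "\<bar>(r / s) ^ 4 - 1 / 4\<bar> \<le> 12 * t" using w by (simp add: power_divide Rsq)
      then have "\<bar>1 - (r / s) ^ 4 - 3 / 4\<bar> \<le> 12 * t" by (simp add: abs_le_iff)
      from H_near[OF c \<delta> v(2)[OF s] this] r s1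
      show "norm (H c r s - F1) \<le> \<delta> + 12 * t * 2 + 16 * t"
        by (simp add: F1_def \<Lambda> power2_eq_square)
    qed (use L2 r R2 w in auto)
    moreover have "norm (F1 * 1) * t \<le> 2 * t" using F1n small by (intro mult_right_mono) auto
    moreover have "norm (I r r (1 + w)) \<le> 72 * t1" using diag[of r "1 + w"] r w R2 by auto
    moreover have "norm (I r (1 + w) (R - w)) \<le> 2 * t1" using negl[OF flat(2), of r] r w R2 by auto
    moreover have "u r - U1 = I r r (1 + w) + I r (1 + w) (R - w) + (I r (R - w) R - F1 * 1 * of_real 2)"
      using uI[of r] comb[of r r "1 + w" "R - w"] comb[of r r "R - w" R] r R2 w
      by (simp add: F1_def U1_def)
    then have "norm (u r - U1) \<le> norm (I r r (1 + w)) + norm (I r (1 + w) (R - w)) + norm (I r (R - w) R - F1 * 1 * of_real 2)"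
      by (simp add: norm_triangle_le)
    ultimately show ?thesis using small \<delta>0 by simp
  qed
  have K0: "norm (H c r\<^sub>0 s - of_real 1 * \<i> / (2 * (2 * \<i> * of_real v0 + c))) \<le> \<delta> + r\<^sub>0 * 2 + 16 * t"
    if "1 \<le> s" "\<bar>v s - v0\<bar> \<le> t" for s v0
  proof -
    have "(r\<^sub>0 / s) ^ 4 \<le> r\<^sub>0 ^ 4" using that r0 by (intro power_mono) (auto simp: field_simps)
    also have "\<dots> \<le> r\<^sub>0 ^ 1" using r0 by (intro power_decreasing) auto
    finally have "\<bar>1 - (r\<^sub>0 / s) ^ 4 - 1\<bar> \<le> r\<^sub>0" using that r0 by simp
    from H_near[OF c \<delta> that(2) this] r0 that show ?thesis by (simp add: \<Lambda> power2_eq_square)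
  qed
  \<comment> \<open>\<open>F2\<close> and \<open>F3\<close> are the limit kernels from the outer and
    the inner jump to the origin, where the power factor is 1.\<close>
  define F2 where "F2 = \<i> / (2 * c)"
  define F3 where "F3 = \<i> / (2 * (2 * \<i> + c))"
  have e1: "norm (I r\<^sub>0 1 (1 + w) - F3 * U1 * of_real (- 4)) \<le> ((\<delta> + r\<^sub>0 * 2 + 16 * t) * norm U1 + 2 * (1800 * (t1 + d1))) * 9 + norm (F3 * U1) * t"
    by (rule conc[OF jump(1)]) (use K0[OF _ v(1)] L1 r0 R2 w in \<open>auto simp: F3_def\<close>)
  have e2: "norm (I r\<^sub>0 (R - w) R - F2 * 1 * of_real 2) \<le> ((\<delta> + r\<^sub>0 * 2 + 16 * t) * norm (1 :: complex) + 2 * (72 * t1)) * 9 + norm (F2 * 1) * t"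
    by (rule conc[OF jump(2)]) (use K0[OF _ v(2)] L2 r0 R2 w in \<open>auto simp: F2_def\<close>)
  have e3: "norm (I r\<^sub>0 r\<^sub>0 1) \<le> 2 * t1" by (rule negl[OF flat(1)]) (use r0 R2 in auto)
  have e4: "norm (I r\<^sub>0 (1 + w) (R - w)) \<le> 2 * t1" by (rule negl[OF flat(2)]) (use r0 R2 w in auto)
  have m1: "(\<delta> + r\<^sub>0 * 2 + 16 * t) * norm U1 \<le> (\<delta> + r\<^sub>0 * 2 + 16 * t) * 4"
    using U1n \<delta>0 r0 small by (intro mult_left_mono) auto
  have m2: "norm (F3 * U1) * t \<le> (2 * 4) * t" unfolding norm_mult
    using U1n cn small by (intro mult_right_mono mult_mono) (auto simp: F3_def)
  have m3: "norm (F2 * 1) * t \<le> 2 * t" using cn small by (intro mult_right_mono) (auto simp: F2_def)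
  have "D0 c = 1 + F3 * U1 * of_real (- 4) + F2 * 1 * of_real 2"
  proof -
    have g: "2 * \<i> / d * z = - (\<i> / (2 * d) * z * of_real (- 4))" if "d \<noteq> 0" for d z :: complex
      using that by (simp add: field_simps)
    show ?thesis unfolding D0_def g[OF cnz(2)] F2_def F3_def U1_def by simp
  qed
  moreover have "u r\<^sub>0 = 1 + (I r\<^sub>0 r\<^sub>0 1 + I r\<^sub>0 1 (1 + w) + I r\<^sub>0 (1 + w) (R - w) + I r\<^sub>0 (R - w) R)"
    using uI[of r\<^sub>0] comb[of r\<^sub>0 r\<^sub>0 1 "1 + w"] comb[of r\<^sub>0 r\<^sub>0 "1 + w" "R - w"] comb[of r\<^sub>0 r\<^sub>0 "R - w" R] r0 R2 w
    by simp
  ultimately have "u r\<^sub>0 - D0 c = I r\<^sub>0 r\<^sub>0 1 + (I r\<^sub>0 1 (1 + w) - F3 * U1 * of_real (- 4))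
      + I r\<^sub>0 (1 + w) (R - w) + (I r\<^sub>0 (R - w) R - F2 * 1 * of_real 2)"
    by simp
  then have "norm (u r\<^sub>0 - D0 c) \<le> norm (I r\<^sub>0 r\<^sub>0 1) + norm (I r\<^sub>0 1 (1 + w) - F3 * U1 * of_real (- 4))
      + norm (I r\<^sub>0 (1 + w) (R - w)) + norm (I r\<^sub>0 (R - w) R - F2 * 1 * of_real 2)"
    by (simp only: norm_triangle_le add_mono order_refl norm_triangle_ineq)
  \<comment> \<open>The dominant coefficient is \<open>2 * 1800 * 9 = 32400\<close>, from the error
    of \<open>u\<close> on the inner layer; the other terms fit into the rest.\<close>
  also have "\<dots> \<le> 40000 * (t1 + d1 + r1)"
    using e1 e2 e3 e4 m1 m2 m3 small \<delta>0 r0 by simp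
  finally show ?thesis by (simp add: t1_def d1_def r1_def algebra_simps)
qed

context shooting begin

text \<open>\<open>c (2 i + c) D0 c = (c - c0) (c - c0 + 1)\<close> with \<open>c0 = (1 - i) / 2\<close>, so that
  \<open>c - c (2 i + c) D c\<close> maps a small ball around \<open>c0\<close> into itself.\<close>

lemma zero_near_explicit:
  assumes D: "continuous_on {c. 1 / 4 \<le> Re c} D"
    and near: "\<And>c. 1 / 4 \<le> Re c \<Longrightarrow> norm (D c - D0 c) \<le> 1 / 48"
  obtains c where "3 / 8 \<le> Re c" "D c = 0"
proof -
  define c0 where "c0 = (1 - \<i>) / 2"
  define f where "f c = c - c * (2 * \<i> + c) * D c" for c
  have re: "3 / 8 \<le> Re c" if "c \<in> cball c0 (1 / 8)" for c
  proof -
    have "\<bar>Re (c0 - c)\<bar> \<le> 1 / 8" using that abs_Re_le_cmod[of "c0 - c"] by (simp add: dist_norm)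
    moreover have "Re (c0 - c) = 1 / 2 - Re c" by (simp add: c0_def)
    ultimately show ?thesis unfolding abs_le_iff by linarith
  qed
  have "norm c0 \<le> 3 / 4"
  proof -
    have "norm c0 = sqrt (1 / 2)" by (simp add: c0_def cmod_def power2_eq_square)
    also have "\<dots> \<le> 3 / 4" by (rule real_le_lsqrt) (auto simp: power2_eq_square)
    finally show ?thesis .
  qed
  have im: "f c \<in> cball c0 (1 / 8)" if c: "c \<in> cball c0 (1 / 8)" for c
  proof -
    have nz: "c \<noteq> 0" "2 * \<i> + c \<noteq> 0"
      using re[OF c] by (auto simp: complex_eq_iff)
    have dc: "norm (c - c0) \<le> 1 / 8" using c by (simp add: dist_norm norm_minus_commute)
    have nc: "norm c \<le> 1"
      using norm_triangle_ineq2[of c c0] dc \<open>norm c0 \<le> 3 / 4\<close> by simp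
    then have nc2: "norm (2 * \<i> + c) \<le> 3"
      using norm_triangle_ineq[of "2 * \<i>" c] by (simp add: norm_mult)
    have "c * (2 * \<i> + c) * D0 c = (c - c0) * (c - c0 + 1)"
    proof -
      have "c * (2 * \<i> + c) * D0 c = c * (2 * \<i> + c) + \<i> * (2 * \<i> + c) - 2 * \<i> * (c + 3 * \<i> / 4)"
      proof -
        have "c * d * (1 + \<i> / c - 2 * \<i> / d * (1 + 3 * \<i> / (4 * c))) = c * d + \<i> * d - 2 * \<i> * (c + 3 * \<i> / 4)"
          if "d \<noteq> 0" for d using that nz(1) by (simp add: field_simps)
        from this[OF nz(2)] show ?thesis by (simp only: D0_def)
      qed
      also have "\<dots> = (c - c0) * (c - c0 + 1)"
        by (simp add: c0_def field_simps power2_eq_square)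
      finally show ?thesis .
    qed
    \<comment> \<open>The quadratic has slope 1 at \<open>c0\<close>, so \<open>f\<close> cancels
      the linear term without any rescaling. What remains is at most
      \<open>1/64 + 3/48 = 5/64\<close>, below the radius \<open>1/8\<close>.\<close>
    then have "f c - c0 = - (c - c0)\<^sup>2 - c * (2 * \<i> + c) * (D c - D0 c)"
      by (simp add: f_def algebra_simps power2_eq_square)
    then have "norm (f c - c0) \<le> norm ((c - c0)\<^sup>2) + norm (c * (2 * \<i> + c) * (D c - D0 c))"
      using norm_triangle_ineq4[of "- (c - c0)\<^sup>2" "c * (2 * \<i> + c) * (D c - D0 c)"] by simp
    also have "norm ((c - c0)\<^sup>2) \<le> (1 / 8)\<^sup>2" unfolding norm_power using dc by (intro power_mono) auto
    also have "norm (c * (2 * \<i> + c) * (D c - D0 c)) \<le> 1 * 3 * (1 / 48)"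
      unfolding norm_mult using nc nc2 near[of c] re[OF c] by (intro mult_mono) auto
    finally show ?thesis by (simp add: dist_norm norm_minus_commute power2_eq_square)
  qed
  have "continuous_on (cball c0 (1 / 8)) f"
    unfolding f_def by (intro continuous_intros continuous_on_subset[OF D]) (use re in force)
  then obtain c where c: "c \<in> cball c0 (1 / 8)" "f c = c"
    using brouwer[of "cball c0 (1 / 8)" f] im by auto
  have "c \<noteq> 0" "2 * \<i> + c \<noteq> 0" using re[OF c(1)] by (auto simp: complex_eq_iff)
  then have "D c = 0" using c(2) by (simp add: f_def)
  then show thesis using re[OF c(1)] that by blast
qed

text \<open>The half plane \<open>Re c \<ge> 1/4\<close> contains the disc around
  \<open>(1 - i) / 2\<close> with a margin. The constants follow from
  \<open>\<Lambda> = 1/4\<close>: \<open>exp 36\<close> is \<open>exp (9 / \<Lambda>)\<close>, the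
  weight for variation 9; \<open>32\<close> and \<open>64\<close> are
  \<open>2 / \<Lambda>\<^sup>2\<close> and \<open>1 / \<Lambda> ^ 3\<close> from the kernel
  asymptotics; \<open>80000\<close> is \<open>40000\<close> times the factor 2 in the bound of the
  fixed point.\<close>

lemma decaying_solution_exists:
  assumes \<Lambda>: "\<Lambda> = 1 / 4" and R: "R = sqrt 2"
    and w: "0 < w" "w \<le> t" "t \<le> 1 / 10"
    and V: "\<And>r. 0 < r \<Longrightarrow> integral {r..R} (\<lambda>s. \<bar>gd s\<bar>) \<le> 9"
    and flat: "\<And>r. 0 < r \<Longrightarrow> integral {r..1} (\<lambda>s. \<bar>gd s\<bar>) \<le> t"
      "integral {1 + w..R - w} (\<lambda>s. \<bar>gd s\<bar>) \<le> t"
    and jump: "\<bar>integral {1..1 + w} gd - (- 4)\<bar> \<le> t" "\<bar>integral {R - w..R} gd - 2\<bar> \<le> t"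
    and v: "\<And>s. s \<in> {1..1 + w} \<Longrightarrow> \<bar>v s - 1\<bar> \<le> t" "\<And>s. s \<in> {R - w..R} \<Longrightarrow> \<bar>v s - 0\<bar> \<le> t"
    and dv: "\<And>s. 0 < s \<Longrightarrow> (v has_real_derivative dv s) (at s)" "continuous_on {0<..} dv"
    and G: "\<And>s. 0 < s \<Longrightarrow> \<bar>s * dv s\<bar> \<le> G"
    and K: "\<And>s. 0 < s \<Longrightarrow> \<bar>gd s\<bar> \<le> K * s"
    and small: "80000 * exp 36 * (t + (32 + 64 * G) / B) \<le> 1 / 50"
  obtains c u C where "3 / 8 \<le> Re c" "continuous_on {0<..} u" "\<And>r. 0 < r \<Longrightarrow> u r = T c u r"
    "\<And>r. 0 < r \<Longrightarrow> norm (u r) \<le> C * r ^ 3" "\<And>r. 0 < r \<Longrightarrow> norm (y c u r) \<le> C / r"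
proof -
  obtain U where U: "continuous_on ({0<..} \<times> UNIV) (\<lambda>(r, c). U r c)"
    and U2: "\<And>c r. \<Lambda> \<le> Re c \<Longrightarrow> 0 < r \<Longrightarrow> U r c = T c (\<lambda>s. U s c) r \<and> norm (U r c) \<le> 2 * e r"
    using fixed_point_exists by blast
  define M :: real where "M = 2 * exp 36"
  have M1: "1 \<le> M" using exp_ge_add_one_self[of 36] by (simp add: M_def)
  have fixU: "U r c = T c (\<lambda>s. U s c) r" if "\<Lambda> \<le> Re c" "0 < r" for r c using U2[OF that] by simp
  have UM: "norm (U r c) \<le> M" if "\<Lambda> \<le> Re c" "0 < r" for r c
  proof -
    have "e r \<le> exp 36" unfolding e_def using V[OF that(2)] by (simp add: \<Lambda>)
    moreover have "norm (U r c) \<le> 2 * e r" using U2[OF that] by blast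
    ultimately show ?thesis by (simp add: M_def)
  qed
  have U1: "continuous_on {0<..} (\<lambda>r. U r c)" for c
  proof -
    have "continuous_on {0<..} (\<lambda>r. (\<lambda>(r, c). U r c) (r, c))"
      by (rule continuous_on_compose2[OF U]) (auto intro!: continuous_intros)
    then show ?thesis by simp
  qed
  obtain D where D: "continuous_on {c. \<Lambda> \<le> Re c} D"
    and DU: "\<And>c r. \<Lambda> \<le> Re c \<Longrightarrow> 0 < r \<Longrightarrow> norm (U r c - D c) \<le> B * K * M * r\<^sup>2"
    using limit_at_0[OF U fixU UM K] by blast
  have U_lim: "((\<lambda>r. U r c) \<longlongrightarrow> D c) (at_right 0)" if "\<Lambda> \<le> Re c" for c
  proof (rule Lim_null_comparison[THEN LIM_zero_cancel])
    show "\<forall>\<^sub>F r in at_right 0. norm (U r c - D c) \<le> B * K * M * r\<^sup>2"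
      using DU[OF that] by (auto simp: eventually_at_filter)
    have "((\<lambda>r. B * K * M * r\<^sup>2) \<longlongrightarrow> B * K * M * 0\<^sup>2) (at_right 0)" by (intro tendsto_intros)
    then show "((\<lambda>r. B * K * M * r\<^sup>2) \<longlongrightarrow> 0) (at_right 0)" by simp
  qed
  define \<delta> where "\<delta> = (32 + 64 * G) / B"
  have D_near: "norm (D c - D0 c) \<le> 1 / 48" if "1 / 4 \<le> Re c" for c
  proof -
    have c: "\<Lambda> \<le> Re c" using that \<Lambda> by simp
    have H: "norm (H c r s - of_real (1 - (r / s) ^ 4) * \<i> / (2 * (2 * \<i> * of_real (v s) + c))) \<le> \<delta>"
      if "0 < r" "r \<le> s" for r s
      using H_approx[OF that c dv G] by (simp add: \<delta>_def \<Lambda> power2_eq_square power3_eq_cube mult.commute[of 64])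
    have est: "norm (U r c - D0 c) \<le> 40000 * M * (t + \<delta> + r)" if "0 < r" "r \<le> 1" for r
      by (rule u_estimate[OF \<Lambda> R c U1 fixU[OF c] M1 UM[OF c] w V flat jump v H that])
    have "((\<lambda>r. norm (U r c - D0 c)) \<longlongrightarrow> norm (D c - D0 c)) (at_right 0)"
      by (intro tendsto_intros U_lim c)
    moreover have lim: "((\<lambda>r. 40000 * M * (t + \<delta> + r)) \<longlongrightarrow> 40000 * M * (t + \<delta> + 0)) (at_right 0)"
      by (intro tendsto_intros)
    moreover have "\<forall>\<^sub>F r in at_right 0. norm (U r c - D0 c) \<le> 40000 * M * (t + \<delta> + r)"
      unfolding eventually_at_right_field using est by (intro exI[of _ 1]) auto
    ultimately have "norm (D c - D0 c) \<le> 40000 * M * (t + \<delta> + 0)"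
      by (intro tendsto_le[OF _ lim, of "\<lambda>r. norm (U r c - D0 c)"]) simp_all
    also have "\<dots> \<le> 1 / 48" using small by (simp add: M_def \<delta>_def)
    finally show ?thesis .
  qed
  obtain c where c: "3 / 8 \<le> Re c" "D c = 0"
    using zero_near_explicit[of D] D D_near \<Lambda> by auto
  have c': "\<Lambda> \<le> Re c" using c \<Lambda> by simp
  define u where "u r = U r c" for r
  have uc: "continuous_on {0<..} u" unfolding u_def by (rule U1)
  have uT: "u r = T c u r" if "0 < r" for r unfolding u_def[abs_def] by (rule fixU[OF c' that])
  \<comment> \<open>Because \<open>D c = 0\<close>, the rate of convergence at the origin is now a
    rate of decay; fed back through \<open>y\<close> it improves from \<open>r\<^sup>2\<close> to
    \<open>r ^ 3\<close>.\<close>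
  have u2: "norm (u r) \<le> (B * K * M) * r\<^sup>2" if "0 < r" for r
    using DU[OF c' that] c(2) by (simp add: u_def)
  define C where "C = 2 * B * K * (B * K * M) * R"
  have yC: "norm (y c u r) \<le> C / r" if "0 < r" for r
    unfolding C_def by (rule norm_y_le_quadratic[OF uc c' that K u2])
  have C0: "0 \<le> C" using order_trans[OF norm_ge_zero yC[of 1]] by simp
  have u3: "norm (u s) \<le> C * s ^ 3" if s: "0 < s" for s
  proof -
    have inc: "norm (u s - u r) \<le> C * s ^ 3" if r: "0 < r" "r \<le> s" for r
    proof -
      have "norm (T c u s - T c u r) \<le> (C * s\<^sup>2) * s"
      proof (rule T_increment_le[OF uc r])
        fix x :: real assume x: "0 < x" "x \<le> s"
        have "norm (of_real (x ^ 3) * y c u x) = x ^ 3 * norm (y c u x)"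
          using x by (simp add: norm_mult norm_power)
        also have "\<dots> \<le> x ^ 3 * (C / x)" using x yC by (intro mult_left_mono) auto
        also have "\<dots> = C * x\<^sup>2" using x by (simp add: power2_eq_square power3_eq_cube)
        also have "\<dots> \<le> C * s\<^sup>2" using x C0 by (intro mult_left_mono power_mono) auto
        finally show "norm (of_real (x ^ 3) * y c u x) \<le> C * s\<^sup>2" .
      qed
      then show ?thesis using uT r s by (simp add: power2_eq_square power3_eq_cube mult.assoc)
    qed
    have "(u \<longlongrightarrow> 0) (at_right 0)" using U_lim[OF c'] c(2) by (simp add: u_def[abs_def])
    then have "((\<lambda>r. norm (u s - u r)) \<longlongrightarrow> norm (u s - 0)) (at_right 0)" by (intro tendsto_intros)
    moreover have "\<forall>\<^sub>F r in at_right 0. norm (u s - u r) \<le> C * s ^ 3"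
      unfolding eventually_at_right_field using inc s by (intro exI[of _ s]) auto
    ultimately have "norm (u s - 0) \<le> C * s ^ 3" by (rule tendsto_upperbound) simp
    then show ?thesis by simp
  qed
  show thesis by (rule that[OF c(1) uc uT u3 yC])
qed

end

section \<open>The distributional formulation\<close>

text \<open>Integrals run over \<open>{a / 2..b + 1}\<close>, a neighbourhood of the support \<open>{a..b}\<close>, so that no
  boundary terms occur.\<close>

definition supp_in :: "real \<Rightarrow> real \<Rightarrow> (real \<Rightarrow> complex) \<Rightarrow> bool" where
  "supp_in a b \<eta> \<longleftrightarrow> 0 < a \<and> a \<le> b \<and> (\<forall>x. x \<notin> {a..b} \<longrightarrow> \<eta> x = 0)"

lemma supp_in_deriv:
  assumes "supp_in a b \<eta>" "\<And>x. (\<eta> has_vector_derivative \<eta>' x) (at x)"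
  shows "supp_in a b \<eta>'"
proof -
  have "\<eta>' x = 0" if x: "x \<notin> {a..b}" for x
  proof -
    have "((\<lambda>_. 0) has_vector_derivative \<eta>' x) (at x)"
      by (rule has_vector_derivative_transform_within_open[OF assms(2), of "- {a..b}"])
         (use x assms(1) in \<open>auto simp: supp_in_def\<close>)
    then show ?thesis using has_vector_derivative_const vector_derivative_unique_at by blast
  qed
  then show ?thesis using assms(1) by (simp add: supp_in_def)
qed

text \<open>Passes from the Lebesgue pairing on the half-line to a gauge integral over a compact
  interval, where the fundamental theorem of calculus applies.\<close>

lemma regular_eq_integral:
  assumes f: "continuous_on {0<..} f" and \<eta>: "continuous_on {0<..} \<eta>" and s: "supp_in a b \<eta>"
  shows "regular f \<eta> = integral {a / 2..b + 1} (\<lambda>r. f r * \<eta> r)"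
proof -
  let ?F = "\<lambda>r. f r * \<eta> r"
  have ab: "0 < a" "a \<le> b" and z: "\<And>x. x \<notin> {a / 2..b + 1} \<Longrightarrow> ?F x = 0" using s by (auto simp: supp_in_def)
  have c: "continuous_on {a / 2..b + 1} ?F"
    by (intro continuous_intros continuous_on_subset[OF f] continuous_on_subset[OF \<eta>]) (use ab in auto)
  then have "?F absolutely_integrable_on {a / 2..b + 1}" by (rule absolutely_integrable_continuous_real)
  then have "integrable lebesgue ?F"
    unfolding set_integrable_def
    by (rule Bochner_Integration.integrable_cong[THEN iffD1, rotated -1]) (use z in \<open>auto simp: indicator_def\<close>)
  moreover have "(\<lambda>r. if r \<in> {0<..} then ?F r else 0) = ?F"
    using s by (auto simp: supp_in_def)
  ultimately have i: "integrable (lebesgue_on {0<..}) ?F"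
    using Lebesgue_Measure.integrable_restrict_UNIV[of "{0<..}" ?F] by simp
  have "(?F has_integral integral {a / 2..b + 1} ?F) {a / 2..b + 1}"
    by (intro integrable_integral integrable_continuous_real c)
  then have "(?F has_integral integral {a / 2..b + 1} ?F) {0<..}"
    by (rule has_integral_on_superset) (use z ab in auto)
  then show ?thesis
    unfolding regular_def using lebesgue_integral_eq_integral[OF i] by (simp add: integral_unique)
qed

lemma integral_by_parts_supp:
  fixes f \<eta> :: "real \<Rightarrow> complex"
  assumes s: "supp_in a b \<eta>"
    and f: "\<And>r. 0 < r \<Longrightarrow> (f has_vector_derivative f' r) (at r)" "continuous_on {0<..} f'"
    and \<eta>: "\<And>r. 0 < r \<Longrightarrow> (\<eta> has_vector_derivative \<eta>' r) (at r)" "continuous_on {0<..} \<eta>'"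
  shows "integral {a / 2..b + 1} (\<lambda>r. f r * \<eta>' r) = - integral {a / 2..b + 1} (\<lambda>r. f' r * \<eta> r)"
proof -
  have ab: "0 < a" "a \<le> b" and z: "\<eta> (a / 2) = 0" "\<eta> (b + 1) = 0" using s by (auto simp: supp_in_def)
  have sub: "{a / 2..b + 1} \<subseteq> {0<..}" using ab by auto
  have fc: "continuous_on {0<..} f" and \<eta>c: "continuous_on {0<..} \<eta>"
    by (auto intro!: continuous_on_has_vector_derivative f \<eta>)
  have "((\<lambda>r. f r * \<eta>' r + f' r * \<eta> r) has_integral f (b + 1) * \<eta> (b + 1) - f (a / 2) * \<eta> (a / 2)) {a / 2..b + 1}"
    by (rule fundamental_theorem_of_calculus)
       (use ab sub in \<open>auto intro!: has_vector_derivative_mult has_vector_derivative_at_within[OF f(1)] has_vector_derivative_at_within[OF \<eta>(1)]\<close>)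
  then have "integral {a / 2..b + 1} (\<lambda>r. f r * \<eta>' r + f' r * \<eta> r) = 0" using z by (simp add: integral_unique)
  moreover have "integral {a / 2..b + 1} (\<lambda>r. f r * \<eta>' r + f' r * \<eta> r) =
      integral {a / 2..b + 1} (\<lambda>r. f r * \<eta>' r) + integral {a / 2..b + 1} (\<lambda>r. f' r * \<eta> r)"
    by (intro Henstock_Kurzweil_Integration.integral_add integrable_continuous_real continuous_intros
        continuous_on_subset[OF fc sub] continuous_on_subset[OF f(2) sub]
        continuous_on_subset[OF \<eta>c sub] continuous_on_subset[OF \<eta>(2) sub])
  ultimately show ?thesis by (simp add: eq_neg_iff_add_eq_0)
qed

lemma smooth_on_UNIV_iff:
  "smooth_on UNIV f \<longleftrightarrow> (\<exists>f'. (\<forall>x. (f has_vector_derivative f' x) (at x)) \<and> smooth_on UNIV f')"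
proof
  assume "smooth_on UNIV f"
  then obtain F where F: "\<And>x. F 0 x = f x" "\<And>n x. (F n has_vector_derivative F (Suc n) x) (at x)"
    by (auto simp: smooth_on_def)
  have "f = F 0" using F(1) by auto
  moreover have "smooth_on UNIV (F 1)"
    unfolding smooth_on_def by (rule exI[of _ "\<lambda>n. F (Suc n)"]) (use F(2) in auto)
  ultimately show "\<exists>f'. (\<forall>x. (f has_vector_derivative f' x) (at x)) \<and> smooth_on UNIV f'"
    using F(2)[of 0] by auto
next
  assume "\<exists>f'. (\<forall>x. (f has_vector_derivative f' x) (at x)) \<and> smooth_on UNIV f'"
  then obtain f' F where f': "\<And>x. (f has_vector_derivative f' x) (at x)"
    and F: "\<And>x. F 0 x = f' x" "\<And>n x. (F n has_vector_derivative F (Suc n) x) (at x)"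
    by (auto simp: smooth_on_def)
  have "(case_nat f F n has_vector_derivative case_nat f F (Suc n) x) (at x)" for n x
    using f' F by (cases n) simp_all
  then show "smooth_on UNIV f"
    unfolding smooth_on_def by (intro exI[of _ "case_nat f F"]) simp
qed

text \<open>Three derivatives are what the weak equation takes: two from \<open>L_op\<close> and one
  from the drift term.\<close>

lemma smooth_on_UNIV_derivatives:
  assumes "smooth_on UNIV \<eta>"
  shows "\<exists>\<eta>1 \<eta>2 \<eta>3. (\<forall>x. (\<eta> has_vector_derivative \<eta>1 x) (at x)) \<and>
    (\<forall>x. (\<eta>1 has_vector_derivative \<eta>2 x) (at x)) \<and> (\<forall>x. (\<eta>2 has_vector_derivative \<eta>3 x) (at x)) \<and>
    continuous_on UNIV \<eta>3"
proof -
  obtain F where F: "\<And>x. F 0 x = \<eta> x" "\<And>n x. (F n has_vector_derivative F (Suc n) x) (at x)"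
    using assms by (auto simp: smooth_on_def)
  have "F 0 = \<eta>" using F(1) by auto
  then have d: "\<forall>x. (\<eta> has_vector_derivative F (Suc 0) x) (at x)" using F(2)[of 0] by simp
  have c: "continuous_on UNIV (F (Suc (Suc (Suc 0))))"
    by (rule continuous_on_has_vector_derivative, rule F(2))
  show ?thesis using d F(2)[of "Suc 0"] F(2)[of "Suc (Suc 0)"] c by blast
qed

lemma test_fun_supp_in:
  assumes "test_fun \<eta>"
  obtains a b where "supp_in a b \<eta>"
proof -
  obtain a b where ab: "0 < a" "\<forall>r. r \<notin> {a..b} \<longrightarrow> \<eta> r = 0" using assms unfolding test_fun_def by blast
  have "\<eta> r = 0" if "r \<notin> {a..max a b}" for r using ab(2) that by (simp add: max_def split: if_splits)
  then have "supp_in a (max a b) \<eta>" using ab(1) by (simp add: supp_in_def)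
  then show thesis by (rule that)
qed

lemma L_op_regular:
  fixes \<phi> :: "real \<Rightarrow> complex"
  assumes \<phi>: "\<And>r. 0 < r \<Longrightarrow> (\<phi> has_vector_derivative \<phi>1 r) (at r)"
      "\<And>r. 0 < r \<Longrightarrow> (\<phi>1 has_vector_derivative \<phi>2 r) (at r)" "continuous_on {0<..} \<phi>2"
    and \<eta>: "\<And>r. (\<eta> has_vector_derivative \<eta>1 r) (at r)" "\<And>r. (\<eta>1 has_vector_derivative \<eta>2 r) (at r)"
      "continuous_on {0<..} \<eta>2" and s: "supp_in a b \<eta>"
  shows "L_op k (regular \<phi>) \<eta> = integral {a / 2..b + 1}
    (\<lambda>r. (\<phi>2 r - of_real (1 / r\<^sup>2 * ((of_int k)\<^sup>2 - 1/4)) * \<phi> r) * \<eta> r)"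
proof -
  let ?k = "\<lambda>r. complex_of_real (1 / r\<^sup>2 * ((of_int k)\<^sup>2 - 1/4))"
  have ab: "0 < a" "a \<le> b" using s by (auto simp: supp_in_def)
  have sub: "{a / 2..b + 1} \<subseteq> {0<..}" using ab by auto
  have s1: "supp_in a b \<eta>1" by (rule supp_in_deriv[OF s \<eta>(1)])
  have s2: "supp_in a b \<eta>2" by (rule supp_in_deriv[OF s1 \<eta>(2)])
  have sk: "supp_in a b (\<lambda>r. ?k r * \<eta> r)" using s by (auto simp: supp_in_def)
  have c: "continuous_on {0<..} \<phi>" "continuous_on {0<..} \<phi>1" "continuous_on {0<..} \<eta>" "continuous_on {0<..} \<eta>1"
    by (auto intro!: continuous_on_has_vector_derivative \<phi> \<eta>)
  have kc: "continuous_on {0<..} ?k" by (intro continuous_intros) auto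
  have "L_op k (regular \<phi>) \<eta> = regular \<phi> \<eta>2 - regular \<phi> (\<lambda>r. ?k r * \<eta> r)"
  proof -
    have "vector_derivative \<eta> (at r) = \<eta>1 r" "vector_derivative \<eta>1 (at r) = \<eta>2 r" for r
      by (rule vector_derivative_at, rule \<eta>)+
    then show ?thesis by (simp add: L_op_def ddiff_def dmult_def)
  qed
  also have "regular \<phi> \<eta>2 = integral {a / 2..b + 1} (\<lambda>r. \<phi> r * \<eta>2 r)"
    by (rule regular_eq_integral[OF c(1) \<eta>(3) s2])
  also have "\<dots> = - integral {a / 2..b + 1} (\<lambda>r. \<phi>1 r * \<eta>1 r)"
    by (rule integral_by_parts_supp[OF s1 \<phi>(1) c(2) \<eta>(2) \<eta>(3)])
  also have "integral {a / 2..b + 1} (\<lambda>r. \<phi>1 r * \<eta>1 r) = - integral {a / 2..b + 1} (\<lambda>r. \<phi>2 r * \<eta> r)"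
    by (rule integral_by_parts_supp[OF s \<phi>(2) \<phi>(3) \<eta>(1) c(4)])
  also have "regular \<phi> (\<lambda>r. ?k r * \<eta> r) = integral {a / 2..b + 1} (\<lambda>r. \<phi> r * (?k r * \<eta> r))"
    by (rule regular_eq_integral[OF c(1) _ sk]) (intro continuous_intros kc c)
  also have "- (- integral {a / 2..b + 1} (\<lambda>r. \<phi>2 r * \<eta> r)) - \<dots> =
      integral {a / 2..b + 1} (\<lambda>r. \<phi>2 r * \<eta> r - \<phi> r * (?k r * \<eta> r))"
    unfolding minus_minus
    by (intro Henstock_Kurzweil_Integration.integral_diff[symmetric] integrable_continuous_real continuous_intros
        continuous_on_subset[OF \<phi>(3) sub] continuous_on_subset[OF c(1) sub]
        continuous_on_subset[OF c(3) sub] continuous_on_subset[OF kc sub])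
  finally show ?thesis by (simp add: algebra_simps)
qed

text \<open>The coefficient is only known to be differentiable for positive \<open>r\<close>, but
  near every other point the product vanishes identically. This makes the product a legitimate
  argument of \<open>L_op_regular\<close>, which needs derivatives on the whole line.\<close>

lemma has_vector_derivative_mult_supp:
  fixes m \<eta> :: "real \<Rightarrow> complex"
  assumes s: "supp_in a b \<eta>" and m: "\<And>r. 0 < r \<Longrightarrow> (m has_vector_derivative m' r) (at r)"
    and \<eta>: "\<And>r. (\<eta> has_vector_derivative \<eta>' r) (at r)"
  shows "((\<lambda>r. m r * \<eta> r) has_vector_derivative m r * \<eta>' r + m' r * \<eta> r) (at r)"
proof (cases "0 < r")
  case True
  then show ?thesis by (intro has_vector_derivative_mult m \<eta>)
next
  case False
  have a: "0 < a" using s by (simp add: supp_in_def)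
  have "((\<lambda>r. m r * \<eta> r) has_vector_derivative 0) (at r)"
    by (rule has_vector_derivative_transform_within_open[OF has_vector_derivative_const, of "{..<a}"])
       (use s False a in \<open>auto simp: supp_in_def\<close>)
  moreover have "\<eta> r = 0" "\<eta>' r = 0"
    using s supp_in_deriv[OF s \<eta>] False a by (auto simp: supp_in_def)
  ultimately show ?thesis by simp
qed

text \<open>With \<open>w\<close> the pointwise \<open>L_k \<phi>\<close>, moving all derivatives
  off the test function turns the weak equation into the integral of the pointwise equation against
  \<open>\<eta>\<close>.\<close>

lemma solves_rayleighI:
  fixes \<phi> \<phi>1 \<phi>2 w1 :: "real \<Rightarrow> complex" and k :: int
  defines "w \<equiv> \<lambda>r. \<phi>2 r - of_real (1 / r\<^sup>2 * ((of_int k)\<^sup>2 - 1/4)) * \<phi> r"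
  assumes lim: "(\<phi> \<longlongrightarrow> 0) (at_right 0)" "(\<phi> \<longlongrightarrow> 0) at_top"
    and \<phi>: "\<And>r. 0 < r \<Longrightarrow> (\<phi> has_vector_derivative \<phi>1 r) (at r)"
      "\<And>r. 0 < r \<Longrightarrow> (\<phi>1 has_vector_derivative \<phi>2 r) (at r)"
    and w: "\<And>r. 0 < r \<Longrightarrow> (w has_vector_derivative w1 r) (at r)" "continuous_on {0<..} w1"
    and v: "\<And>r. 0 < r \<Longrightarrow> (angular_velocity g has_real_derivative v1 r) (at r)"
      "\<And>r. 0 < r \<Longrightarrow> (v1 has_real_derivative v2 r) (at r)" "continuous_on {0<..} v2"
    and g: "continuous_on {0<..} (rderiv g)"
    and eq: "\<And>r. 0 < r \<Longrightarrow> (\<i> * of_int k * of_real (angular_velocity g r) + \<mu>) * w r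
      - of_real (1 / (\<alpha> * \<beta>)) * (of_real r * w1 r + 1/2 * w r)
      - \<i> * of_int k * of_real (rderiv g r / r) * \<phi> r = 0"
  shows "solves_rayleigh \<alpha> \<beta> g k \<phi> \<mu>"
proof -
  have wc: "continuous_on {0<..} w" by (rule continuous_on_has_vector_derivative, rule w) auto
  have c: "continuous_on {0<..} \<phi>" by (rule continuous_on_has_vector_derivative, rule \<phi>) auto
  have "\<phi>2 = (\<lambda>r. w r + of_real (1 / r\<^sup>2 * ((of_int k)\<^sup>2 - 1/4)) * \<phi> r)" by (auto simp: w_def)
  moreover have "continuous_on {0<..} (\<lambda>r. w r + of_real (1 / r\<^sup>2 * ((of_int k)\<^sup>2 - 1/4)) * \<phi> r)"
    by (intro continuous_intros wc c) auto
  ultimately have \<phi>2c: "continuous_on {0<..} \<phi>2" by simp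
  define m where "m r = \<i> * of_int k * complex_of_real (angular_velocity g r)" for r
  define m1 where "m1 r = \<i> * of_int k * complex_of_real (v1 r)" for r
  define m2 where "m2 r = \<i> * of_int k * complex_of_real (v2 r)" for r
  define n where "n r = \<i> * of_int k * complex_of_real (rderiv g r / r)" for r
  have m: "(m has_vector_derivative m1 r) (at r)" "(m1 has_vector_derivative m2 r) (at r)" if "0 < r" for r
    unfolding m_def[abs_def] m1_def[abs_def] m2_def
    by (intro has_vector_derivative_mult_right has_vector_derivative_of_real v that)+
  have mc: "continuous_on {0<..} m" "continuous_on {0<..} m1"
    by (rule continuous_on_has_vector_derivative, rule m, simp)+
  have m2c: "continuous_on {0<..} m2" unfolding m2_def[abs_def] by (intro continuous_intros v)
  have nc: "continuous_on {0<..} n" unfolding n_def[abs_def] by (intro continuous_intros g) auto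
  have main: "dmult m (L_op k (regular \<phi>)) \<eta>
       - of_real (1 / (\<alpha> * \<beta>)) * (dmult of_real (ddiff (L_op k (regular \<phi>))) \<eta> + 1/2 * L_op k (regular \<phi>) \<eta>)
       + \<mu> * L_op k (regular \<phi>) \<eta> - dmult n (regular \<phi>) \<eta> = 0"
    if test: "test_fun \<eta>" for \<eta>
  proof -
    obtain a b where s: "supp_in a b \<eta>" using test by (rule test_fun_supp_in)
    have "smooth_on UNIV \<eta>" using test by (simp add: test_fun_def)
    then obtain \<eta>1 \<eta>2 \<eta>3 where d: "\<And>x. (\<eta> has_vector_derivative \<eta>1 x) (at x)"
      "\<And>x. (\<eta>1 has_vector_derivative \<eta>2 x) (at x)" "\<And>x. (\<eta>2 has_vector_derivative \<eta>3 x) (at x)"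
      "continuous_on UNIV \<eta>3"
      using smooth_on_UNIV_derivatives by blast
    have \<eta>c: "continuous_on {0<..} \<eta>" "continuous_on {0<..} \<eta>1" "continuous_on {0<..} \<eta>2" "continuous_on {0<..} \<eta>3"
      using d(4) by (auto intro!: continuous_on_has_vector_derivative d continuous_on_subset[OF d(4)])
    have s1: "supp_in a b \<eta>1" by (rule supp_in_deriv[OF s d(1)])
    have ab: "0 < a" "a \<le> b" using s by (auto simp: supp_in_def)
    let ?J = "{a / 2..b + 1}"
    have sub: "?J \<subseteq> {0<..}" using ab by auto
    have id: "((\<lambda>r. complex_of_real r) has_vector_derivative 1) (at r)" for r
      using has_vector_derivative_of_real[OF DERIV_ident] by simp
    have t0: "L_op k (regular \<phi>) \<eta> = integral ?J (\<lambda>r. w r * \<eta> r)"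
      unfolding w_def by (rule L_op_regular[OF \<phi> \<phi>2c d(1,2) \<eta>c(3) s])
    have t1: "dmult m (L_op k (regular \<phi>)) \<eta> = integral ?J (\<lambda>r. w r * (m r * \<eta> r))"
      unfolding dmult_def w_def
    proof (rule L_op_regular[OF \<phi> \<phi>2c])
      show "((\<lambda>r. m r * \<eta> r) has_vector_derivative m r * \<eta>1 r + m1 r * \<eta> r) (at r)" for r
        by (rule has_vector_derivative_mult_supp[OF s m(1) d(1)])
      show "((\<lambda>r. m r * \<eta>1 r + m1 r * \<eta> r) has_vector_derivative
          (m r * \<eta>2 r + m1 r * \<eta>1 r) + (m1 r * \<eta>1 r + m2 r * \<eta> r)) (at r)" for r
        by (intro has_vector_derivative_add has_vector_derivative_mult_supp[OF s1 m(1) d(2)]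
            has_vector_derivative_mult_supp[OF s m(2) d(1)])
      show "continuous_on {0<..} (\<lambda>r. (m r * \<eta>2 r + m1 r * \<eta>1 r) + (m1 r * \<eta>1 r + m2 r * \<eta> r))"
        by (intro continuous_intros mc m2c \<eta>c)
      show "supp_in a b (\<lambda>r. m r * \<eta> r)" using s by (auto simp: supp_in_def)
    qed
    have r\<eta>: "((\<lambda>r. of_real r * \<eta> r) has_vector_derivative of_real r * \<eta>1 r + \<eta> r) (at r)" for r
      using has_vector_derivative_mult[OF id d(1), of r] by simp
    have sr: "supp_in a b (\<lambda>r. of_real r * \<eta> r)" using s by (auto simp: supp_in_def)
    \<comment> \<open>By duality the drift term pairs \<open>L_k \<phi>\<close> with minus the
      derivative of \<open>r * \<eta> r\<close>; one more integration by parts undoes the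
      sign.\<close>
    have "dmult of_real (ddiff (L_op k (regular \<phi>))) \<eta> = - L_op k (regular \<phi>) (\<lambda>r. of_real r * \<eta>1 r + \<eta> r)"
      unfolding dmult_def ddiff_def vector_derivative_at[OF r\<eta>] ..
    also have "L_op k (regular \<phi>) (\<lambda>r. of_real r * \<eta>1 r + \<eta> r) = integral ?J (\<lambda>r. w r * (of_real r * \<eta>1 r + \<eta> r))"
      unfolding w_def
    proof (rule L_op_regular[OF \<phi> \<phi>2c])
      show "((\<lambda>r. of_real r * \<eta>1 r + \<eta> r) has_vector_derivative (of_real r * \<eta>2 r + 1 * \<eta>1 r) + \<eta>1 r) (at r)" for r
        by (intro has_vector_derivative_add has_vector_derivative_mult id d)
      show "((\<lambda>r. (of_real r * \<eta>2 r + 1 * \<eta>1 r) + \<eta>1 r) has_vector_derivative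
          (of_real r * \<eta>3 r + 1 * \<eta>2 r + 1 * \<eta>2 r) + \<eta>2 r) (at r)" for r
        by (intro has_vector_derivative_add has_vector_derivative_mult has_vector_derivative_mult_right id d)
      show "continuous_on {0<..} (\<lambda>r. (of_real r * \<eta>3 r + 1 * \<eta>2 r + 1 * \<eta>2 r) + \<eta>2 r)"
        by (intro continuous_intros \<eta>c)
      show "supp_in a b (\<lambda>r. of_real r * \<eta>1 r + \<eta> r)" by (rule supp_in_deriv[OF sr r\<eta>])
    qed
    also have "\<dots> = - integral ?J (\<lambda>r. w1 r * (of_real r * \<eta> r))"
      by (rule integral_by_parts_supp[OF sr w r\<eta>]) (auto intro!: continuous_intros \<eta>c)
    finally have t2: "dmult of_real (ddiff (L_op k (regular \<phi>))) \<eta> = integral ?J (\<lambda>r. w1 r * (of_real r * \<eta> r))" by simp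
    have t3: "dmult n (regular \<phi>) \<eta> = integral ?J (\<lambda>r. \<phi> r * (n r * \<eta> r))"
      unfolding dmult_def
      by (rule regular_eq_integral[OF c]) (use s in \<open>auto intro!: continuous_intros nc \<eta>c simp: supp_in_def\<close>)
    have I: "(f has_integral integral ?J f) ?J" if "continuous_on {0<..} f" for f :: "real \<Rightarrow> complex"
      by (intro integrable_integral integrable_continuous_real continuous_on_subset[OF that sub])
    let ?\<gamma> = "complex_of_real (1 / (\<alpha> * \<beta>))"
    have "((\<lambda>r. w r * (m r * \<eta> r) - ?\<gamma> * (w1 r * (of_real r * \<eta> r) + 1/2 * (w r * \<eta> r))
        + \<mu> * (w r * \<eta> r) - \<phi> r * (n r * \<eta> r)) has_integral
       integral ?J (\<lambda>r. w r * (m r * \<eta> r)) - ?\<gamma> * (integral ?J (\<lambda>r. w1 r * (of_real r * \<eta> r)) + 1/2 * integral ?J (\<lambda>r. w r * \<eta> r))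
        + \<mu> * integral ?J (\<lambda>r. w r * \<eta> r) - integral ?J (\<lambda>r. \<phi> r * (n r * \<eta> r))) ?J"
      by (intro has_integral_diff has_integral_add has_integral_mult_right I continuous_intros wc mc nc c w \<eta>c)
    moreover have "((\<lambda>r. w r * (m r * \<eta> r) - ?\<gamma> * (w1 r * (of_real r * \<eta> r) + 1/2 * (w r * \<eta> r))
        + \<mu> * (w r * \<eta> r) - \<phi> r * (n r * \<eta> r)) has_integral 0) ?J"
    proof (rule has_integral_is_0)
      fix r assume "r \<in> ?J"
      then have "0 < r" using sub by auto
      have "w r * (m r * \<eta> r) - ?\<gamma> * (w1 r * (of_real r * \<eta> r) + 1/2 * (w r * \<eta> r))
        + \<mu> * (w r * \<eta> r) - \<phi> r * (n r * \<eta> r) =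
        ((m r + \<mu>) * w r - ?\<gamma> * (of_real r * w1 r + 1/2 * w r) - n r * \<phi> r) * \<eta> r"
        by (simp add: algebra_simps)
      also have "(m r + \<mu>) * w r - ?\<gamma> * (of_real r * w1 r + 1/2 * w r) - n r * \<phi> r = 0"
        unfolding m_def n_def using eq[OF \<open>0 < r\<close>] .
      finally show "w r * (m r * \<eta> r) - ?\<gamma> * (w1 r * (of_real r * \<eta> r) + 1/2 * (w r * \<eta> r))
        + \<mu> * (w r * \<eta> r) - \<phi> r * (n r * \<eta> r) = 0" by simp
    qed
    ultimately show ?thesis unfolding t0 t1 t2 t3 by (rule has_integral_unique)
  qed
  show ?thesis
    unfolding solves_rayleigh_def Let_def
    using lim main unfolding m_def[abs_def] n_def[abs_def] by blast
qed

lemma square_integrableI: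
  assumes f: "continuous_on {0<..} f" and R: "0 < R"
    and b: "\<And>r. 0 < r \<Longrightarrow> r \<le> R \<Longrightarrow> norm (f r) \<le> C" "\<And>r. R \<le> r \<Longrightarrow> norm (f r) \<le> C / r"
  shows "square_integrable f"
proof -
  have m: "f \<in> borel_measurable (lebesgue_on {0<..})"
    by (rule continuous_imp_measurable_on_sets_lebesgue[OF f]) auto
  define h where "h r = (if r \<le> R then C\<^sup>2 else C\<^sup>2 * r powr (-2))" for r
  have "h integrable_on {0..R} \<union> {R..}"
  proof (rule integrable_Un)
    have "{0..R} \<inter> {R..} = {R}" using R by auto
    then show "negligible ({0..R} \<inter> {R..})" by simp
    have "(\<lambda>_. C\<^sup>2) integrable_on {0..R}" by (rule integrable_const_ivl)
    then show "h integrable_on {0..R}" by (rule integrable_eq) (auto simp: h_def)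
    have "(\<lambda>r. C\<^sup>2 * r powr (-2)) integrable_on {R..}"
      using has_integral_mult_right[OF has_integral_powr_to_inf[of "-2" R], of "C\<^sup>2"] R by auto
    then show "h integrable_on {R..}"
      by (rule integrable_spike[of _ _ "{R}"]) (auto simp: h_def)
  qed
  then have "h integrable_on {0<..}"
  proof (rule integrable_spike_set)
    show "negligible {x \<in> {0..R} \<union> {R..} - {0<..}. h x \<noteq> 0}"
      by (rule negligible_subset[of "{0}"]) (use R in auto)
    have "{x \<in> {0<..} - ({0..R} \<union> {R..}). h x \<noteq> 0} = {}" by auto
    then show "negligible {x \<in> {0<..} - ({0..R} \<union> {R..}). h x \<noteq> 0}" by (simp only: negligible_empty)
  qed
  moreover have "norm ((norm (f r))\<^sup>2) \<le> h r" if "r \<in> {0<..}" for r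
  proof (cases "r \<le> R")
    case True
    then show ?thesis using b(1)[of r] that by (simp add: h_def power_mono)
  next
    case False
    have "(norm (f r))\<^sup>2 \<le> (C / r)\<^sup>2" using b(2)[of r] False by (intro power_mono) auto
    then show ?thesis using False that by (simp add: h_def powr_minus powr_numeral field_simps)
  qed
  moreover have "(\<lambda>r. (norm (f r))\<^sup>2) \<in> borel_measurable (lebesgue_on {0<..})" using m by simp
  ultimately have "(\<lambda>r. (norm (f r))\<^sup>2) absolutely_integrable_on {0<..}"
    by (intro measurable_bounded_by_integrable_imp_absolutely_integrable[where g = h]) auto
  then have "integrable (lebesgue_on {0<..}) (\<lambda>r. (norm (f r))\<^sup>2)"
    by (simp add: set_integrable_def integrable_restrict_space)
  then show ?thesis using m by (simp add: square_integrable_def)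
qed

lemma Hdot1I:
  assumes \<phi>: "\<And>r. 0 < r \<Longrightarrow> (\<phi> has_vector_derivative \<phi>1 r) (at r)" "continuous_on {0<..} \<phi>1" and R: "0 < R"
    and b: "\<And>r. 0 < r \<Longrightarrow> r \<le> R \<Longrightarrow> norm (\<phi> r) \<le> C * r" "\<And>r. R \<le> r \<Longrightarrow> norm (\<phi> r) \<le> C"
    and b1: "\<And>r. 0 < r \<Longrightarrow> r \<le> R \<Longrightarrow> norm (\<phi>1 r) \<le> C" "\<And>r. R \<le> r \<Longrightarrow> norm (\<phi>1 r) \<le> C / r"
  shows "\<phi> \<in> Hdot1"
proof -
  have c: "continuous_on {0<..} \<phi>" by (rule continuous_on_has_vector_derivative, rule \<phi>) auto
  have "square_integrable (\<lambda>r. of_real (1 / r) * \<phi> r)"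
  proof (rule square_integrableI[OF _ R])
    show "continuous_on {0<..} (\<lambda>r. of_real (1 / r) * \<phi> r)" by (intro continuous_intros c) auto
    show "norm (of_real (1 / r) * \<phi> r) \<le> C" if "0 < r" "r \<le> R" for r
      using b(1)[OF that] that by (simp add: norm_mult norm_divide field_simps)
    show "norm (of_real (1 / r) * \<phi> r) \<le> C / r" if "R \<le> r" for r
      using b(2)[OF that] that R by (simp add: norm_mult norm_divide divide_right_mono)
  qed
  moreover have "square_integrable \<phi>1" by (rule square_integrableI[OF \<phi>(2) R b1])
  moreover have "ddiff (regular \<phi>) \<eta> = regular \<phi>1 \<eta>" if test: "test_fun \<eta>" for \<eta>
  proof -
    obtain a b where s: "supp_in a b \<eta>" using test by (rule test_fun_supp_in)
    have "smooth_on UNIV \<eta>" using test by (simp add: test_fun_def)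
    then obtain \<eta>1 \<eta>2 \<eta>3 where d: "\<And>x. (\<eta> has_vector_derivative \<eta>1 x) (at x)" "\<And>x. (\<eta>1 has_vector_derivative \<eta>2 x) (at x)"
      "\<And>x. (\<eta>2 has_vector_derivative \<eta>3 x) (at x)" "continuous_on UNIV \<eta>3"
      using smooth_on_UNIV_derivatives by blast
    have \<eta>c: "continuous_on {0<..} \<eta>" "continuous_on {0<..} \<eta>1"
      by (auto intro!: continuous_on_has_vector_derivative d)
    have "ddiff (regular \<phi>) \<eta> = - regular \<phi> \<eta>1"
      unfolding ddiff_def vector_derivative_at[OF d(1)] ..
    also have "\<dots> = integral {a / 2..b + 1} (\<lambda>r. \<phi>1 r * \<eta> r)"
      using integral_by_parts_supp[OF s \<phi> d(1) \<eta>c(2)]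
      unfolding regular_eq_integral[OF c \<eta>c(2) supp_in_deriv[OF s d(1)]] by simp
    also have "\<dots> = regular \<phi>1 \<eta>" by (rule regular_eq_integral[OF \<phi>(2) \<eta>c(1) s, symmetric])
    finally show ?thesis .
  qed
  ultimately show ?thesis unfolding Hdot1_def by blast
qed

section \<open>Smooth step functions\<close>

text \<open>Choosing a derivative inside \<open>C\<close> and iterating the choice gives the whole
  sequence of derivatives, so no closed formula for higher derivatives is ever needed.\<close>

lemma smooth_on_UNIV_coinduct:
  assumes f: "f \<in> C" and C: "\<And>f. f \<in> C \<Longrightarrow> \<exists>f'\<in>C. \<forall>x. (f has_vector_derivative f' x) (at x)"
  shows "smooth_on UNIV f"
proof -
  obtain d where d: "\<And>f. f \<in> C \<Longrightarrow> d f \<in> C" "\<And>f x. f \<in> C \<Longrightarrow> (f has_vector_derivative d f x) (at x)"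
    using C by metis
  have "(d ^^ n) f \<in> C" for n by (induction n) (use f d(1) in auto)
  then show ?thesis
    unfolding smooth_on_def by (intro exI[of _ "\<lambda>n. (d ^^ n) f"]) (auto intro: d(2))
qed

lemma smooth_on_subset_UNIV: "smooth_on UNIV f \<Longrightarrow> smooth_on S f"
  unfolding smooth_on_def by (meson UNIV_I has_vector_derivative_at_within)

lemma smooth_on_const: "smooth_on UNIV (\<lambda>_. k :: real)"
proof (rule smooth_on_UNIV_coinduct[of _ "range (\<lambda>k _. k)"])
  fix f :: "real \<Rightarrow> real" assume "f \<in> range (\<lambda>k _. k)"
  then obtain k where "f = (\<lambda>_. k)" by blast
  then show "\<exists>f'\<in>range (\<lambda>k _. k). \<forall>x. (f has_vector_derivative f' x) (at x)"
    by (intro bexI[of _ "\<lambda>_. 0"]) simp_all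
qed simp

lemma smooth_on_affine: "smooth_on UNIV (\<lambda>x. a * x + b :: real)"
  unfolding smooth_on_UNIV_iff[of "\<lambda>x. a * x + b"]
  by (intro exI[of _ "\<lambda>_. a"] conjI smooth_on_const)
     (auto intro!: derivative_eq_intros simp flip: has_real_derivative_iff_has_vector_derivative)

text \<open>Products alone are not closed under differentiation; by the Leibniz rule their finite
  sums are, which is what the coinduction needs.\<close>

inductive_set sums_of_products :: "(real \<Rightarrow> real) set" where
  prod: "smooth_on UNIV f \<Longrightarrow> smooth_on UNIV g \<Longrightarrow> (\<lambda>x. f x * g x) \<in> sums_of_products"
| add: "f \<in> sums_of_products \<Longrightarrow> g \<in> sums_of_products \<Longrightarrow> (\<lambda>x. f x + g x) \<in> sums_of_products"

lemma smooth_on_sums_of_products: "f \<in> sums_of_products \<Longrightarrow> smooth_on UNIV f"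
proof (erule smooth_on_UNIV_coinduct)
  fix f assume "f \<in> sums_of_products"
  then show "\<exists>f'\<in>sums_of_products. \<forall>x. (f has_vector_derivative f' x) (at x)"
  proof induction
    case (prod f g)
    then obtain f' g' where d: "\<And>x. (f has_vector_derivative f' x) (at x)" "smooth_on UNIV f'"
        "\<And>x. (g has_vector_derivative g' x) (at x)" "smooth_on UNIV g'"
      using smooth_on_UNIV_iff by metis
    have "(\<lambda>x. f x * g' x + f' x * g x) \<in> sums_of_products"
      using prod d by (auto intro: sums_of_products.intros)
    then show ?case
      by (rule bexI[rotated]) (auto intro: has_vector_derivative_mult d)
  next
    case (add f g)
    then obtain f' g' where d: "f' \<in> sums_of_products" "g' \<in> sums_of_products"
        "\<And>x. (f has_vector_derivative f' x) (at x)" "\<And>x. (g has_vector_derivative g' x) (at x)" by blast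
    have "(\<lambda>x. f' x + g' x) \<in> sums_of_products" using d by (intro sums_of_products.add)
    then show ?case
      by (rule bexI[rotated]) (auto intro: has_vector_derivative_add d)
  qed
qed

lemma smooth_on_mult:
  "smooth_on UNIV f \<Longrightarrow> smooth_on UNIV g \<Longrightarrow> smooth_on UNIV (\<lambda>x. f x * g x :: real)"
  by (rule smooth_on_sums_of_products, rule sums_of_products.prod)

lemma smooth_on_add:
  assumes "smooth_on UNIV f" "smooth_on UNIV g"
  shows "smooth_on UNIV (\<lambda>x. f x + g x :: real)"
proof -
  have "(\<lambda>x. f x * 1 + g x * 1) \<in> sums_of_products"
    by (intro sums_of_products.intros smooth_on_const assms)
  from smooth_on_sums_of_products[OF this] show ?thesis by simp
qed

lemma smooth_on_diff:
  assumes "smooth_on UNIV f" "smooth_on UNIV g"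
  shows "smooth_on UNIV (\<lambda>x. f x - g x :: real)"
  using smooth_on_add[OF assms(1) smooth_on_mult[OF smooth_on_const[of "-1"] assms(2)]] by simp

lemma smooth_on_compose_affine:
  fixes f :: "real \<Rightarrow> real"
  assumes "smooth_on UNIV f"
  shows "smooth_on UNIV (\<lambda>x. f (a * x + b))"
\<comment> \<open>The scalar \<open>k\<close> collects the powers of \<open>a\<close> produced by
  the chain rule.\<close>
proof (rule smooth_on_UNIV_coinduct[of _ "{\<lambda>x. k * f (a * x + b) | k f. smooth_on UNIV f}"])
  show "(\<lambda>x. f (a * x + b)) \<in> {\<lambda>x. k * f (a * x + b) | k f. smooth_on UNIV f}"
    using assms by (auto intro!: exI[of _ 1] exI[of _ f])
  fix h :: "real \<Rightarrow> real" assume "h \<in> {\<lambda>x. k * f (a * x + b) | k f. smooth_on UNIV f}"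
  then obtain k f where h: "h = (\<lambda>x. k * f (a * x + b) :: real)" and "smooth_on UNIV f" by auto
  then obtain f' where f': "\<And>x. (f has_vector_derivative f' x) (at x)" "smooth_on UNIV f'"
    using smooth_on_UNIV_iff by metis
  have "(h has_vector_derivative (k * a) * f' (a * x + b)) (at x)" for x
  proof -
    have "((\<lambda>x. a * x + b) has_real_derivative a) (at x)" by (auto intro!: derivative_eq_intros)
    moreover have "(f has_real_derivative f' (a * x + b)) (at (a * x + b))"
      using f'(1) by (simp add: has_real_derivative_iff_has_vector_derivative)
    ultimately have "((\<lambda>x. f (a * x + b)) has_real_derivative f' (a * x + b) * a) (at x)"
      by (rule DERIV_chain2[rotated])
    then have "(h has_real_derivative k * (f' (a * x + b) * a)) (at x)"
      unfolding h by (rule DERIV_cmult)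
    then show ?thesis by (simp add: has_real_derivative_iff_has_vector_derivative mult_ac)
  qed
  then show "\<exists>h'\<in>{\<lambda>x. k * f (a * x + b) | k f. smooth_on UNIV f}. \<forall>x. (h has_vector_derivative h' x) (at x)"
    using f'(2) by (intro bexI[of _ "\<lambda>x. (k * a) * f' (a * x + b)"]) auto
qed

text \<open>For \<open>p = 1\<close> this is the classical flat function
  \<open>exp (- 1 / x)\<close> extended by zero; the polynomial makes the family closed under
  differentiation.\<close>

definition flat :: "real poly \<Rightarrow> real \<Rightarrow> real" where
  "flat p x = (if x \<le> 0 then 0 else poly p (1 / x) * exp (- (1 / x)))"

lemma poly_times_exp_neg_tendsto_0: "((\<lambda>x. poly p x * exp (- x)) \<longlongrightarrow> (0 :: real)) at_top"
proof -
  have "((\<lambda>x. \<Sum>i\<le>degree p. coeff p i * (x ^ i / exp x)) \<longlongrightarrow> (\<Sum>i\<le>degree p. coeff p i * 0)) at_top"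
    by (intro tendsto_intros tendsto_power_div_exp_0)
  then show ?thesis
    by (simp add: poly_altdef sum_distrib_right exp_minus divide_inverse mult.assoc)
qed

text \<open>The chain rule for \<open>1 / x\<close> gives the factor \<open>1 / x\<^sup>2\<close>,
  and the exponential contributes \<open>p\<close> against \<open>- pderiv p\<close>. At 0 the right
  difference quotient is, in the variable \<open>1 / x\<close>, again a polynomial times a decaying
  exponential.\<close>

lemma flat_deriv: "(flat p has_real_derivative flat ([:0, 0, 1:] * (p - pderiv p)) x) (at x)"
proof (cases "x = 0")
  case False
  show ?thesis
  proof (cases "x < 0")
    case True
    have "(flat p has_real_derivative 0) (at x)"
      by (rule has_field_derivative_transform_within_open[of "\<lambda>_. 0" _ _ "{..<0}"])
         (use True in \<open>auto simp: flat_def\<close>)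
    then show ?thesis using True by (simp add: flat_def)
  next
    case False
    then have x: "0 < x" using \<open>x \<noteq> 0\<close> by simp
    have "((\<lambda>x. poly p (1 / x)) has_real_derivative poly (pderiv p) (1 / x) * (- 1 / x\<^sup>2)) (at x)"
      using x by (intro DERIV_chain2[OF poly_DERIV]) (auto intro!: derivative_eq_intros simp: power2_eq_square)
    moreover have "((\<lambda>x. exp (- (1 / x))) has_real_derivative exp (- (1 / x)) * (1 / x\<^sup>2)) (at x)"
      using x by (auto intro!: derivative_eq_intros simp: power2_eq_square)
    ultimately have "((\<lambda>x. poly p (1 / x) * exp (- (1 / x))) has_real_derivative
       poly (pderiv p) (1 / x) * (- 1 / x\<^sup>2) * exp (- (1 / x)) + exp (- (1 / x)) * (1 / x\<^sup>2) * poly p (1 / x)) (at x)"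
      by (rule DERIV_mult)
    then have "(flat p has_real_derivative
       poly (pderiv p) (1 / x) * (- 1 / x\<^sup>2) * exp (- (1 / x)) + exp (- (1 / x)) * (1 / x\<^sup>2) * poly p (1 / x)) (at x)"
      by (rule has_field_derivative_transform_within_open[of _ _ _ "{0<..}"]) (use x in \<open>auto simp: flat_def\<close>)
    then show ?thesis using x by (simp add: flat_def field_simps power2_eq_square)
  qed
next
  case True
  have "((\<lambda>h. flat p h / h) \<longlongrightarrow> 0) (at_left 0)"
    by (rule tendsto_eventually) (auto simp: eventually_at_filter flat_def)
  moreover have "((\<lambda>h. flat p h / h) \<longlongrightarrow> 0) (at_right 0)"
    unfolding filterlim_at_right_to_top
  proof (rule Lim_transform_eventually[OF poly_times_exp_neg_tendsto_0[of "pCons 0 p"]])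
    show "\<forall>\<^sub>F x in at_top. poly (pCons 0 p) x * exp (- x) = flat p (inverse x) / inverse x"
      using eventually_gt_at_top[of 0] by eventually_elim (simp add: flat_def field_simps)
  qed
  ultimately have "((\<lambda>h. flat p h / h) \<longlongrightarrow> 0) (at 0)" by (simp add: filterlim_at_split)
  then show ?thesis using True by (simp add: DERIV_def flat_def)
qed

lemma smooth_on_flat: "smooth_on UNIV (flat p)"
proof (rule smooth_on_UNIV_coinduct[of _ "range flat"])
  fix f assume "f \<in> range flat"
  then obtain p where "f = flat p" by auto
  then show "\<exists>f'\<in>range flat. \<forall>x. (f has_vector_derivative f' x) (at x)"
    using flat_deriv[of p] by (auto simp: has_real_derivative_iff_has_vector_derivative)
qed simp

text \<open>The step is a normalised antiderivative of a bump \<open>b\<close>, a product of two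
  flat functions that is positive on \<open>(0, 1)\<close> and zero elsewhere.\<close>

lemma smooth_step_exists:
  "\<exists>s s' :: real \<Rightarrow> real. smooth_on UNIV s \<and> (\<forall>x. (s has_real_derivative s' x) (at x)) \<and> continuous_on UNIV s' \<and>
    (\<forall>x\<le>0. s x = 0) \<and> (\<forall>x\<ge>1. s x = 1) \<and> (\<forall>x. 0 \<le> s' x)"
proof -
  define b where "b x = flat 1 x * flat 1 (-1 * x + 1)" for x
  have b: "smooth_on UNIV b"
    unfolding b_def[abs_def] by (intro smooth_on_mult smooth_on_flat smooth_on_compose_affine)
  then have bc: "continuous_on UNIV b"
    unfolding smooth_on_UNIV_iff[of b] by (auto intro: continuous_on_has_vector_derivative)
  have b0: "0 \<le> b x" for x by (simp add: b_def flat_def)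
  have bz: "b x = 0" if "x \<le> 0 \<or> 1 \<le> x" for x using that by (auto simp: b_def flat_def)
  have bpos: "0 < b x" if "0 < x" "x < 1" for x using that by (simp add: b_def flat_def)
  have "\<exists>F. \<forall>x. - \<infinity> < ereal x \<longrightarrow> ereal x < \<infinity> \<longrightarrow> (F has_vector_derivative b x) (at x)"
    by (rule einterval_antiderivative) (use bc in \<open>auto simp: continuous_on_eq_continuous_at\<close>)
  then obtain F where F: "\<And>x. (F has_real_derivative b x) (at x)"
    by (auto simp: has_real_derivative_iff_has_vector_derivative)
  have mono: "F x \<le> F y" if "x \<le> y" for x y
    by (rule DERIV_nonneg_imp_nondecreasing[OF that]) (use F b0 in blast)
  have "F (1 / 4) < F (3 / 4)"
    by (rule DERIV_pos_imp_increasing) (use F bpos in \<open>auto intro!: exI[of _ "b _"]\<close>)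
  then have F01: "F 0 < F 1" using mono[of 0 "1 / 4"] mono[of "3 / 4" 1] by simp
  have flatF: "F y \<le> F x" if "x \<le> y" "y \<le> 0 \<or> 1 \<le> x" for x y
    by (rule DERIV_nonpos_imp_nonincreasing[OF that(1)]) (metis F bz that(2) order_refl order_trans)
  have Fl: "F x = F 0" if "x \<le> 0" for x using flatF[of x 0] mono[of x 0] that by simp
  have Fr: "F x = F 1" if "1 \<le> x" for x using flatF[of 1 x] mono[of 1 x] that by simp
  define s where "s x = (1 / (F 1 - F 0)) * (F x - F 0)" for x
  have d: "(s has_real_derivative (1 / (F 1 - F 0)) * b x) (at x)" for x
    unfolding s_def[abs_def] using F01 by (auto intro!: derivative_eq_intros F)
  have "smooth_on UNIV s"
    unfolding smooth_on_UNIV_iff[of s]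
    by (intro exI[of _ "\<lambda>x. (1 / (F 1 - F 0)) * b x"] conjI allI smooth_on_mult[OF smooth_on_const b]
        d[unfolded has_real_derivative_iff_has_vector_derivative])
  moreover have "continuous_on UNIV (\<lambda>x. (1 / (F 1 - F 0)) * b x)" by (intro continuous_intros bc)
  moreover have "s x = 0" if "x \<le> 0" for x using Fl[OF that] by (simp add: s_def)
  moreover have "s x = 1" if "1 \<le> x" for x using Fr[OF that] F01 by (simp add: s_def)
  moreover have "0 \<le> (1 / (F 1 - F 0)) * b x" for x using F01 b0[of x] by simp
  ultimately show ?thesis using d
    by (intro exI[of _ s] exI[of _ "\<lambda>x. (1 / (F 1 - F 0)) * b x"] conjI allI impI)
qed

section \<open>The vortex\<close>

lemma integral_split:
  fixes f :: "real \<Rightarrow> real"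
  assumes "continuous_on UNIV f" "a \<le> b" "b \<le> c"
  shows "integral {a..c} f = integral {a..b} f + integral {b..c} f"
proof -
  have "f integrable_on {a..c}"
    by (rule integrable_continuous_real, rule continuous_on_subset[OF assms(1)]) simp
  from Henstock_Kurzweil_Integration.integral_combine[OF assms(2,3) this] show ?thesis by simp
qed

lemma integral_between:
  fixes f :: "real \<Rightarrow> real"
  assumes "continuous_on UNIV f" "a \<le> b" "\<And>x. x \<in> {a..b} \<Longrightarrow> l \<le> f x" "\<And>x. x \<in> {a..b} \<Longrightarrow> f x \<le> u"
  shows "l * (b - a) \<le> integral {a..b} f \<and> integral {a..b} f \<le> u * (b - a)"
proof -
  have i: "f integrable_on {a..b}"
    by (intro integrable_continuous_real continuous_on_subset[OF assms(1)]) auto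
  have c: "integral {a..b} (\<lambda>_. k) = k * (b - a)" for k :: real using assms(2) by simp
  have "integral {a..b} (\<lambda>_. l) \<le> integral {a..b} f" "integral {a..b} f \<le> integral {a..b} (\<lambda>_. u)"
    by (rule integral_le; use i assms(3,4) in \<open>simp add: integrable_const_ivl\<close>)+
  then show ?thesis unfolding c ..
qed

text \<open>The one small parameter \<open>w\<close> is at once the width of both smoothed jumps,
  the curvature of the core and the curvature of the annulus, so the profile tends to the step
  profile as \<open>w\<close> tends to 0.\<close>

locale vortex_profile =
  fixes s s' :: "real \<Rightarrow> real" and w :: real
  assumes s_smooth: "smooth_on UNIV s" and s_deriv: "(s has_real_derivative s' x) (at x)"
    and s'_cont: "continuous_on UNIV s'"
    and s_left: "x \<le> 0 \<Longrightarrow> s x = 0" and s_right: "1 \<le> x \<Longrightarrow> s x = 1" and s'_nonneg: "0 \<le> s' x"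
    and w_pos: "0 < w" and w_le: "w \<le> 1 / 100"
begin

definition R :: real where "R = sqrt 2"

lemma R_bounds: "14 / 10 < R" "R < 15 / 10"
proof -
  show "14 / 10 < R" unfolding R_def by (rule real_less_rsqrt) (simp add: power2_eq_square)
  show "R < 15 / 10" unfolding R_def by (rule real_less_lsqrt) (simp_all add: power2_eq_square)
qed

lemma R_sq: "R * R = 2"
  by (simp add: R_def)

lemma s_mono: "x \<le> y \<Longrightarrow> s x \<le> s y"
  by (rule DERIV_nonneg_imp_nondecreasing) (use s_deriv s'_nonneg in blast)+

lemma s_ge_0: "0 \<le> s x" and s_le_1: "s x \<le> 1"
proof -
  show "0 \<le> s x" using s_mono[of "min x 0" x] s_left[of "min x 0"] by simp
  show "s x \<le> 1" using s_mono[of x "max x 1"] s_right[of "max x 1"] by simp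
qed

lemma s'_left: "x \<le> 0 \<Longrightarrow> s' x = 0"
  by (rule DERIV_local_min[OF s_deriv zero_less_one]) (use s_left s_ge_0 in auto)

lemma s'_right: "1 \<le> x \<Longrightarrow> s' x = 0"
  by (rule DERIV_local_max[OF s_deriv zero_less_one]) (use s_right s_le_1 in auto)

definition step :: "real \<Rightarrow> real \<Rightarrow> real" where
  "step a r = s ((1 / w) * r + (- a / w))"

definition dstep :: "real \<Rightarrow> real \<Rightarrow> real" where
  "dstep a r = s' ((1 / w) * r + (- a / w)) * (1 / w)"

lemma step_arg: "(1 / w) * r + (- a / w) = (r - a) / w"
  by (simp add: diff_divide_distrib)

lemma step_smooth: "smooth_on UNIV (step a)"
  unfolding step_def[abs_def] by (rule smooth_on_compose_affine[OF s_smooth])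

lemma step_deriv: "(step a has_real_derivative dstep a r) (at r)"
  unfolding step_def[abs_def] dstep_def
  by (rule DERIV_chain2[OF s_deriv]) (use w_pos in \<open>auto intro!: derivative_eq_intros\<close>)

lemma dstep_cont: "continuous_on UNIV (dstep a)"
proof -
  have "continuous_on UNIV (\<lambda>r. s' ((1 / w) * r + (- a / w)))"
    by (rule continuous_on_compose2[OF s'_cont]) (use w_pos in \<open>auto intro!: continuous_intros\<close>)
  then show ?thesis unfolding dstep_def[abs_def] by (rule continuous_on_mult_right)
qed

lemma step_left: "r \<le> a \<Longrightarrow> step a r = 0" and dstep_left: "r \<le> a \<Longrightarrow> dstep a r = 0"
  unfolding step_def dstep_def step_arg using w_pos by (auto simp: s_left s'_left divide_nonpos_pos)

lemma step_right: "a + w \<le> r \<Longrightarrow> step a r = 1" and dstep_right: "a + w \<le> r \<Longrightarrow> dstep a r = 0"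
  unfolding step_def dstep_def step_arg using w_pos by (auto simp: s_right s'_right)

lemma step_bounds: "0 \<le> step a r" "step a r \<le> 1" "0 \<le> dstep a r"
  unfolding step_def dstep_def using w_pos s'_nonneg by (auto simp: s_ge_0 s_le_1)

lemma step_cont: "continuous_on UNIV (step a)"
  by (intro continuous_at_imp_continuous_on ballI DERIV_isCont[OF step_deriv])

abbreviation "S1 \<equiv> step 1"
abbreviation "S2 \<equiv> step (R - w)"

text \<open>Minus the vorticity in the annulus. The critical point \<open>6 / 5\<close> is chosen
  between 1 and \<open>sqrt 2\<close>, away from both layers.\<close>

definition q :: "real \<Rightarrow> real" where "q r = 2 - w / 2 * (r - 6 / 5)\<^sup>2"

text \<open>The integral of \<open>r * g r\<close> is \<open>g0 * K - N\<close>: \<open>K\<close> is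
  the coefficient of the unknown core height, and \<open>N\<close> gathers everything else.\<close>

definition N :: real where
  "N = integral {0..R} (\<lambda>r. S1 r * (1 - S2 r) * q r * r) + w * integral {0..R} (\<lambda>r. (1 - S1 r) * r ^ 3)"

definition K :: real where "K = integral {0..R} (\<lambda>r. (1 - S1 r) * r)"

text \<open>The height of the core is chosen such that the total mass vanishes.\<close>

definition g0 :: real where "g0 = N / K"

definition p :: "real \<Rightarrow> real" where "p r = g0 - w * r\<^sup>2"

definition g :: "real \<Rightarrow> real" where
  "g r = (1 - S1 r) * p r - S1 r * (1 - S2 r) * q r"

definition gd :: "real \<Rightarrow> real" where
  "gd r = - dstep 1 r * p r + (1 - S1 r) * (- (2 * w * r))
    - (dstep 1 r * (1 - S2 r) * q r - S1 r * dstep (R - w) r * q r - S1 r * (1 - S2 r) * (w * (r - 6 / 5)))"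

lemma g_smooth: "smooth_on UNIV g"
proof -
  have id: "smooth_on UNIV (\<lambda>x :: real. x)" using smooth_on_affine[of 1 0] by simp
  have "smooth_on UNIV (\<lambda>r. (1 - S1 r) * (g0 - w * (r * r)) - S1 r * (1 - S2 r) * (2 - w / 2 * ((r - 6 / 5) * (r - 6 / 5))))"
    by (rule smooth_on_diff smooth_on_mult smooth_on_const step_smooth id)+
  then show ?thesis unfolding g_def[abs_def] p_def q_def power2_eq_square .
qed

lemma g_deriv: "(g has_real_derivative gd r) (at r)"
proof -
  have "(p has_real_derivative - (2 * w * r)) (at r)" "(q has_real_derivative - (w * (r - 6 / 5))) (at r)"
    unfolding p_def[abs_def] q_def[abs_def] by (auto intro!: derivative_eq_intros)
  then show ?thesis
    unfolding g_def[abs_def] gd_def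
    by (auto intro!: derivative_eq_intros step_deriv simp: algebra_simps)
qed

lemma q_cont: "continuous_on S q" and p_cont: "continuous_on S p"
  unfolding q_def[abs_def] p_def[abs_def] by (intro continuous_intros)+

lemma gd_cont: "continuous_on UNIV gd"
  unfolding gd_def[abs_def] by (intro continuous_intros step_cont dstep_cont p_cont q_cont)

lemma g_cont: "continuous_on UNIV g"
  unfolding g_def[abs_def] by (intro continuous_intros step_cont p_cont q_cont)

lemma sq_le: assumes "r \<in> {0..R}" shows "(r - 6 / 5)\<^sup>2 \<le> 3 / 2"
proof -
  have "\<bar>r - 6 / 5\<bar> \<le> 12 / 10" using assms R_bounds unfolding abs_le_iff atLeastAtMost_iff by linarith
  then have "\<bar>r - 6 / 5\<bar>\<^sup>2 \<le> (12 / 10)\<^sup>2" by (rule power_mono) simp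
  then show ?thesis by (simp add: power2_eq_square)
qed

lemma q_bounds: assumes "r \<in> {0..R}" shows "2 - w \<le> q r" "q r \<le> 2"
proof -
  have "w / 2 * (r - 6 / 5)\<^sup>2 \<le> w / 2 * (3 / 2)" using sq_le[OF assms] w_pos by (intro mult_left_mono) auto
  then show "2 - w \<le> q r" using w_pos by (simp add: q_def)
  show "q r \<le> 2" using w_pos by (simp add: q_def)
qed

lemma K_bounds: "1 / 2 \<le> K" "K \<le> 1 / 2 + 2 * w"
proof -
  let ?f = "\<lambda>r. (1 - S1 r) * r"
  have c: "continuous_on UNIV ?f" by (intro continuous_intros step_cont)
  have "integral {0..1} ?f = integral {0..1} (\<lambda>r. r)"
    by (rule integral_cong) (simp add: step_left)
  also have "\<dots> = 1 / 2" using ident_has_integral[of 0 1] by (auto dest: integral_unique)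
  finally have 1: "integral {0..1} ?f = 1 / 2" .
  have 2: "0 * (1 + w - 1) \<le> integral {1..1 + w} ?f \<and> integral {1..1 + w} ?f \<le> 2 * (1 + w - 1)"
  proof (rule integral_between[OF c])
    fix x assume x: "x \<in> {1..1 + w}"
    then show "0 \<le> (1 - S1 x) * x" using step_bounds by simp
    have "(1 - S1 x) * x \<le> 1 * 2" using step_bounds x w_le by (intro mult_mono) auto
    then show "(1 - S1 x) * x \<le> 2" by simp
  qed (use w_pos in auto)
  have 3: "integral {1 + w..R} ?f = 0"
    by (rule integral_unique, rule has_integral_is_0) (simp add: step_right)
  have "K = 1 / 2 + integral {1..1 + w} ?f"
    unfolding K_def using integral_split[OF c, of 0 1 R] integral_split[OF c, of 1 "1 + w" R] 1 3 R_bounds w_pos w_le by simp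
  then show "1 / 2 \<le> K" "K \<le> 1 / 2 + 2 * w" using 2 by auto
qed

lemma N_bounds: "1 - 6 * w \<le> N" "N \<le> 1 + 10 * w"
proof -
  let ?f = "\<lambda>r. S1 r * (1 - S2 r) * q r * r"
  let ?h = "\<lambda>r. (1 - S1 r) * r ^ 3"
  have c: "continuous_on UNIV ?f" "continuous_on UNIV ?h" by (intro continuous_intros step_cont q_cont)+
  have b: "0 \<le> ?f x" "?f x \<le> 3" if "x \<in> {0..R}" for x
  proof -
    have q: "0 \<le> q x" "q x \<le> 2" using q_bounds[OF that] w_le by auto
    have "S1 x * (1 - S2 x) * q x * x \<le> 1 * 1 * 2 * (3 / 2)"
      using step_bounds q that R_bounds by (intro mult_mono) auto
    then show "?f x \<le> 3" by simp
    show "0 \<le> ?f x" using step_bounds q that by simp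
  qed
  have 1: "integral {0..1} ?f = 0"
    by (rule integral_unique, rule has_integral_is_0) (simp add: step_left)
  have 2: "0 * (1 + w - 1) \<le> integral {1..1 + w} ?f \<and> integral {1..1 + w} ?f \<le> 3 * (1 + w - 1)"
    by (rule integral_between[OF c(1)]) (use b R_bounds w_pos w_le in auto)
  have 4: "0 * (R - (R - w)) \<le> integral {R - w..R} ?f \<and> integral {R - w..R} ?f \<le> 3 * (R - (R - w))"
    by (rule integral_between[OF c(1)]) (use b R_bounds w_pos w_le in auto)
  have i: "((\<lambda>r. k * r) has_integral k * (((R - w)\<^sup>2 - (1 + w)\<^sup>2) / 2)) {1 + w..R - w}" for k
    using ident_has_integral[of "1 + w" "R - w"] R_bounds w_pos w_le by (intro has_integral_mult_right) auto
  have fi: "?f integrable_on {a..b}" for a b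
    by (intro integrable_continuous_real continuous_on_subset[OF c(1)]) auto
  have mid: "?f x = q x * x" if "x \<in> {1 + w..R - w}" for x
    using that by (simp add: step_left step_right)
  have 3: "(2 - w) * (((R - w)\<^sup>2 - (1 + w)\<^sup>2) / 2) \<le> integral {1 + w..R - w} ?f"
    unfolding integral_unique[OF i, symmetric]
  proof (rule integral_le[OF _ fi])
    show "(\<lambda>r. (2 - w) * r) integrable_on {1 + w..R - w}" using i by blast
    fix x assume x: "x \<in> {1 + w..R - w}"
    then show "(2 - w) * x \<le> ?f x"
      unfolding mid[OF x] using w_pos by (intro mult_right_mono q_bounds(1)) auto
  qed
  have 5: "integral {1 + w..R - w} ?f \<le> 2 * (((R - w)\<^sup>2 - (1 + w)\<^sup>2) / 2)"
    unfolding integral_unique[OF i, symmetric]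
  proof (rule integral_le[OF fi])
    show "(\<lambda>r. 2 * r) integrable_on {1 + w..R - w}" using i by blast
    fix x assume x: "x \<in> {1 + w..R - w}"
    then show "?f x \<le> 2 * x"
      unfolding mid[OF x] using w_pos by (intro mult_right_mono q_bounds(2)) auto
  qed
  have sq: "(R - w)\<^sup>2 - (1 + w)\<^sup>2 = 1 - 2 * w * (R + 1)"
    using R_sq by (simp add: power2_eq_square algebra_simps)
  have "w * (R + 1) \<le> w * (5 / 2)" using R_bounds w_pos by (intro mult_left_mono) auto
  then have lo: "1 - 5 * w \<le> (R - w)\<^sup>2 - (1 + w)\<^sup>2" unfolding sq by simp
  have "0 \<le> w * (R + 1)" using R_bounds w_pos by simp
  then have up: "(R - w)\<^sup>2 - (1 + w)\<^sup>2 \<le> 1" unfolding sq by simp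
  have "(2 - w) * ((1 - 5 * w) / 2) \<le> (2 - w) * (((R - w)\<^sup>2 - (1 + w)\<^sup>2) / 2)"
    using lo w_le by (intro mult_left_mono) auto
  moreover have "1 - 6 * w \<le> (2 - w) * ((1 - 5 * w) / 2)" using w_pos by (simp add: algebra_simps)
  ultimately have m1: "1 - 6 * w \<le> integral {1 + w..R - w} ?f" using 3 by linarith
  have m2: "integral {1 + w..R - w} ?f \<le> 1" using order_trans[OF 5] up by simp
  have f: "integral {0..R} ?f = integral {1..1 + w} ?f + integral {1 + w..R - w} ?f + integral {R - w..R} ?f"
    using integral_split[OF c(1), of 0 1 R] integral_split[OF c(1), of 1 "1 + w" R]
      integral_split[OF c(1), of "1 + w" "R - w" R] 1 R_bounds w_pos w_le by simp
  have h: "0 * (R - 0) \<le> integral {0..R} ?h \<and> integral {0..R} ?h \<le> R ^ 3 * (R - 0)"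
  proof (rule integral_between[OF c(2)])
    fix x assume x: "x \<in> {0..R}"
    then show "0 \<le> (1 - S1 x) * x ^ 3" using step_bounds by simp
    have "(1 - S1 x) * x ^ 3 \<le> 1 * R ^ 3" using step_bounds x by (intro mult_mono power_mono) auto
    then show "(1 - S1 x) * x ^ 3 \<le> R ^ 3" by simp
  qed (use R_bounds in auto)
  have "R ^ 3 * (R - 0) = (R * R) * (R * R)" by (simp add: power3_eq_cube)
  then have "R ^ 3 * (R - 0) = 4" by (simp add: R_sq)
  then have "w * integral {0..R} ?h \<le> w * 4" "0 \<le> w * integral {0..R} ?h"
    using h w_pos by (auto intro: mult_left_mono)
  then show "1 - 6 * w \<le> N" "N \<le> 1 + 10 * w"
    unfolding N_def f using 2 4 m1 m2 by auto
qed

text \<open>The disc of radius 1 and the annulus up to \<open>sqrt 2\<close> have equal area, so in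
  the limit \<open>K\<close> is 1/2, \<open>N\<close> is 1 and the core height is 2.\<close>

lemma g0_bounds: "\<bar>g0 - 2\<bar> \<le> 20 * w"
proof -
  have K: "0 < K" using K_bounds by simp
  have "(2 - 20 * w) * K \<le> (2 - 20 * w) * (1 / 2 + 2 * w)" using K_bounds w_le by (intro mult_left_mono) auto
  also have "\<dots> \<le> 1 - 6 * w" using w_pos by (simp add: algebra_simps)
  also have "\<dots> \<le> N" by (rule N_bounds)
  finally have "2 - 20 * w \<le> g0" using K by (simp add: g0_def pos_le_divide_eq)
  have "(2 + 20 * w) * (1 / 2) \<le> (2 + 20 * w) * K" using K_bounds w_pos by (intro mult_left_mono) auto
  moreover have "N \<le> (2 + 20 * w) * (1 / 2)" using N_bounds by simp
  ultimately have "N \<le> (2 + 20 * w) * K" by (rule order_trans[rotated])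
  then have "g0 \<le> 2 + 20 * w" using K by (simp add: g0_def pos_divide_le_eq)
  with \<open>2 - 20 * w \<le> g0\<close> show ?thesis by (simp add: abs_le_iff)
qed

lemma p_bounds: assumes "r \<in> {0..R}" shows "0 < p r" "p r \<le> 3"
proof -
  have "r\<^sup>2 \<le> R\<^sup>2" using assms by (intro power_mono) auto
  then have "r\<^sup>2 \<le> 2" by (simp add: power2_eq_square R_sq)
  then have "w * r\<^sup>2 \<le> w * 2" using w_pos by (intro mult_left_mono) auto
  then show "0 < p r" using g0_bounds w_le unfolding p_def abs_le_iff by linarith
  have "0 \<le> w * r\<^sup>2" using w_pos by simp
  then show "p r \<le> 3" using g0_bounds w_le unfolding p_def abs_le_iff by linarith
qed

lemma g_core: "r \<le> 1 \<Longrightarrow> g r = p r"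
  by (simp add: g_def step_left)

lemma g_annulus: "1 + w \<le> r \<Longrightarrow> r \<le> R - w \<Longrightarrow> g r = - q r"
  by (simp add: g_def step_left step_right)

lemma g_outside: "R \<le> r \<Longrightarrow> g r = 0"
  using R_bounds w_le by (simp add: g_def step_right)

lemma gd_outside: "R \<le> r \<Longrightarrow> gd r = 0"
  using R_bounds w_le by (simp add: gd_def step_right dstep_right)

lemma gd_core: "r \<le> 1 \<Longrightarrow> gd r = - (2 * w * r)"
  using R_bounds w_le by (simp add: gd_def step_left dstep_left)

lemma g_abs_le: assumes "0 \<le> r" shows "\<bar>g r\<bar> \<le> 3"
proof (cases "r \<le> R")
  case True
  have q: "0 \<le> q r" "q r \<le> 2" using q_bounds[of r] assms True w_le by auto
  have p: "0 \<le> p r" "p r \<le> 3" using p_bounds[of r] assms True by auto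
  have "(1 - S1 r) * p r \<le> 1 * 3"
    using step_bounds p by (intro mult_mono) auto
  moreover have "0 \<le> (1 - S1 r) * p r" using step_bounds p by simp
  moreover have "(S1 r * (1 - S2 r)) * q r \<le> 1 * 2" 
    using step_bounds q by (intro mult_mono mult_le_one) auto
  moreover have "0 \<le> (S1 r * (1 - S2 r)) * q r" using step_bounds q by simp
  ultimately show ?thesis unfolding g_def by (simp add: abs_le_iff)
qed (simp add: g_outside)

text \<open>Since \<open>p\<close> and \<open>q\<close> are positive, passing from \<open>p\<close>
  to \<open>- q\<close> can only decrease \<open>g\<close>, and both quadratic pieces decrease up to
  \<open>6 / 5\<close>.\<close>

lemma gd_nonpos: assumes "0 \<le> r" "r \<le> 6 / 5" shows "gd r \<le> 0"
proof -
  have r: "r \<in> {0..R}" "r \<le> R - w" using assms R_bounds w_le by auto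
  have "gd r = - (dstep 1 r * p r + (1 - S1 r) * (2 * w * r) + dstep 1 r * q r + S1 r * (w * (6 / 5 - r)))"
    using r by (simp add: gd_def step_left dstep_left algebra_simps)
  moreover have "0 \<le> dstep 1 r * p r" "0 \<le> (1 - S1 r) * (2 * w * r)" "0 \<le> dstep 1 r * q r" "0 \<le> S1 r * (w * (6 / 5 - r))"
    using step_bounds p_bounds[OF r(1)] q_bounds[OF r(1)] w_pos w_le assms by (auto intro!: mult_nonneg_nonneg)
  ultimately show ?thesis by linarith
qed

lemma gd_nonneg: assumes "6 / 5 \<le> r" "r \<le> R" shows "0 \<le> gd r"
proof -
  have r: "r \<in> {0..R}" "1 + w \<le> r" using assms R_bounds w_le by auto
  have "gd r = dstep (R - w) r * q r + (1 - S2 r) * (w * (r - 6 / 5))"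
    using r by (simp add: gd_def step_right dstep_right)
  moreover have "0 \<le> dstep (R - w) r * q r" "0 \<le> (1 - S2 r) * (w * (r - 6 / 5))"
    using step_bounds q_bounds[OF r(1)] w_pos w_le assms by (auto intro!: mult_nonneg_nonneg)
  ultimately show ?thesis by linarith
qed

lemma rderiv_g: assumes "0 \<le> r" shows "rderiv g r = gd r"
proof -
  have "(g has_vector_derivative gd r) (at r)"
    using g_deriv[of r] by (simp add: has_real_derivative_iff_has_vector_derivative)
  then have "(g has_vector_derivative gd r) (at r within {0..})"
    by (rule has_vector_derivative_at_within)
  moreover have "at r within {0..} \<noteq> bot"
  proof -
    have "r islimpt {0..r + 1}" using assms by simp
    then have "r islimpt {0..}" by (rule islimpt_subset) auto
    then show ?thesis by (simp add: trivial_limit_within)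
  qed
  ultimately show ?thesis unfolding rderiv_def by (rule vector_derivative_within[rotated])
qed

lemma mass_zero: "integral {0..R} (\<lambda>r. r * g r) = 0"
proof -
  have c: "continuous_on UNIV (\<lambda>r. (1 - S1 r) * r)" "continuous_on UNIV (\<lambda>r. (1 - S1 r) * r ^ 3)"
      "continuous_on UNIV (\<lambda>r. S1 r * (1 - S2 r) * q r * r)"
    by (intro continuous_intros step_cont q_cont)+
  have i: "(f has_integral integral {0..R} f) {0..R}" if "continuous_on UNIV f" for f :: "real \<Rightarrow> real"
    by (intro integrable_integral integrable_continuous_real continuous_on_subset[OF that]) auto
  have "((\<lambda>r. g0 * ((1 - S1 r) * r) - w * ((1 - S1 r) * r ^ 3) - S1 r * (1 - S2 r) * q r * r) has_integral
     g0 * K - w * integral {0..R} (\<lambda>r. (1 - S1 r) * r ^ 3) - integral {0..R} (\<lambda>r. S1 r * (1 - S2 r) * q r * r)) {0..R}"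
    unfolding K_def by (intro has_integral_diff has_integral_mult_right i c)
  moreover have "g0 * ((1 - S1 r) * r) - w * ((1 - S1 r) * r ^ 3) - S1 r * (1 - S2 r) * q r * r = r * g r" for r
    by (simp add: g_def p_def algebra_simps power2_eq_square power3_eq_cube)
  moreover have "g0 * K - w * integral {0..R} (\<lambda>r. (1 - S1 r) * r ^ 3) - integral {0..R} (\<lambda>r. S1 r * (1 - S2 r) * q r * r) = 0"
    using K_bounds by (simp add: g0_def N_def)
  ultimately show ?thesis by (simp add: integral_unique)
qed

lemma g_in_vortex_class: "g \<in> vortex_class"
proof -
  have "closure {r \<in> {0..}. g r \<noteq> 0} \<subseteq> {0..R}"
  proof (rule closure_minimal)
    show "{r \<in> {0..}. g r \<noteq> 0} \<subseteq> {0..R}"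
    proof
      fix r assume "r \<in> {r \<in> {0..}. g r \<noteq> 0}"
      then show "r \<in> {0..R}" using g_outside[of r] by (cases "R \<le> r") auto
    qed
  qed simp
  moreover have "\<forall>r\<in>{0..1 / 2}. g r = g0 - w * r\<^sup>2 \<and> 0 < g r"
    using p_bounds R_bounds by (auto simp: g_core p_def)
  \<comment> \<open>A half-width of \<open>1 / 20\<close> keeps the window between the two layers
    for every \<open>w \<le> 1 / 100\<close>.\<close>
  moreover have "\<forall>r\<in>{6 / 5 - 1 / 20..6 / 5 + 1 / 20}. g r = - 2 + 1 / 2 * w * (r - 6 / 5)\<^sup>2"
  proof
    fix r :: real assume "r \<in> {6 / 5 - 1 / 20..6 / 5 + 1 / 20}"
    then have "1 + w \<le> r" "r \<le> R - w" using R_bounds w_le by auto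
    then show "g r = - 2 + 1 / 2 * w * (r - 6 / 5)\<^sup>2" by (simp add: g_annulus q_def)
  qed
  moreover have "\<forall>r\<in>{0..6 / 5}. rderiv g r \<le> 0" "\<forall>r\<in>{6 / 5<..<R}. 0 \<le> rderiv g r"
    using gd_nonpos gd_nonneg by (auto simp: rderiv_g)
  moreover have "integral {0..} (\<lambda>r. g r * r) = 0"
  proof -
    have "((\<lambda>r. g r * r) has_integral 0) {0..R}"
      using mass_zero integrable_integral[of "\<lambda>r. r * g r" "{0..R}"]
      by (simp add: mult.commute integrable_continuous_real continuous_on_mult continuous_on_subset[OF g_cont])
    then have "((\<lambda>r. if r \<in> {0..R} then g r * r else 0) has_integral 0) {0..}"
      by (subst has_integral_restrict) auto
    then have "((\<lambda>r. g r * r) has_integral 0) {0..}"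
      by (rule has_integral_eq[rotated]) (auto simp: g_outside)
    then show ?thesis by (rule integral_unique)
  qed
  moreover have "0 < g0" using g0_bounds w_le by (simp add: abs_le_iff)
  ultimately show ?thesis
    unfolding vortex_class_def mem_Collect_eq using R_bounds w_pos
    apply (intro conjI smooth_on_subset_UNIV[OF g_smooth])
     apply (rule exI[of _ R], rule exI[of _ "6 / 5"], rule exI[of _ g0], rule exI[of _ 2], rule exI[of _ w],
      rule exI[of _ w], rule exI[of _ "1 / 2"], rule exI[of _ "1 / 20"])
     apply (intro conjI; (assumption | simp))
    apply assumption
    done
qed


section \<open>The angular velocity of the vortex\<close>

definition m :: "real \<Rightarrow> real" where "m r = integral {0..r} (\<lambda>\<rho>. \<rho> * g \<rho>)"

abbreviation "v \<equiv> angular_velocity g"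

lemma v_eq: "v r = 1 / r\<^sup>2 * m r"
  by (simp add: angular_velocity_def m_def)

lemma m_integrand_cont: "continuous_on S (\<lambda>\<rho>. \<rho> * g \<rho>)"
  by (intro continuous_intros continuous_on_subset[OF g_cont]) simp

lemma m_deriv: assumes "0 < r" shows "(m has_real_derivative r * g r) (at r)"
proof -
  have "(m has_vector_derivative r * g r) (at r within {0..r + 1})"
    unfolding m_def[abs_def]
    by (rule integral_has_vector_derivative[OF m_integrand_cont]) (use assms in simp)
  then have "(m has_vector_derivative r * g r) (at r)"
    using assms by (subst (asm) at_within_interior) auto
  then show ?thesis by (simp add: has_real_derivative_iff_has_vector_derivative)
qed

lemma m_bound: assumes "0 \<le> r" shows "\<bar>m r\<bar> \<le> 3 / 2 * r\<^sup>2"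
proof -
  have i: "((\<lambda>\<rho>. 3 * \<rho>) has_integral 3 * ((r\<^sup>2 - 0\<^sup>2) / 2)) {0..r}"
    by (rule has_integral_mult_right[OF ident_has_integral[OF assms]])
  have "norm (integral {0..r} (\<lambda>\<rho>. \<rho> * g \<rho>)) \<le> integral {0..r} (\<lambda>\<rho>. 3 * \<rho>)"
  proof (rule integral_norm_bound_integral)
    show "(\<lambda>\<rho>. \<rho> * g \<rho>) integrable_on {0..r}" by (rule integrable_continuous_real[OF m_integrand_cont])
    show "(\<lambda>\<rho>. 3 * \<rho>) integrable_on {0..r}" using i by blast
    fix \<rho> assume "\<rho> \<in> {0..r}"
    then have "\<bar>\<rho>\<bar> * \<bar>g \<rho>\<bar> \<le> \<rho> * 3" using g_abs_le[of \<rho>] by (intro mult_mono) auto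
    then show "norm (\<rho> * g \<rho>) \<le> 3 * \<rho>" by (simp add: abs_mult)
  qed
  then show ?thesis unfolding integral_unique[OF i] by (simp add: m_def)
qed

lemma m_outside: assumes "R \<le> r" shows "m r = 0"
proof -
  have "m r = integral {0..R} (\<lambda>\<rho>. \<rho> * g \<rho>) + integral {R..r} (\<lambda>\<rho>. \<rho> * g \<rho>)"
    unfolding m_def by (rule integral_split[OF m_integrand_cont]) (use R_bounds assms in auto)
  also have "integral {R..r} (\<lambda>\<rho>. \<rho> * g \<rho>) = 0"
    by (rule integral_unique, rule has_integral_is_0) (simp add: g_outside)
  finally show ?thesis using mass_zero by simp
qed

definition v1 :: "real \<Rightarrow> real" where "v1 r = (g r - 2 * v r) / r"

definition v2 :: "real \<Rightarrow> real" where "v2 r = (gd r - 2 * v1 r) / r - (g r - 2 * v r) / r\<^sup>2"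

lemma v_deriv: assumes "0 < r" shows "(v has_real_derivative v1 r) (at r)"
proof -
  have "((\<lambda>r. 1 / r\<^sup>2 * m r) has_real_derivative v1 r) (at r)"
    using assms by (auto intro!: derivative_eq_intros m_deriv simp: v1_def v_eq field_simps power2_eq_square)
  then show ?thesis unfolding v_eq[symmetric] .
qed

lemma v1_deriv: assumes "0 < r" shows "(v1 has_real_derivative v2 r) (at r)"
proof -
  have "(v1 has_real_derivative ((gd r - 2 * v1 r) * r - (g r - 2 * v r) * 1) / (r * r)) (at r)"
    unfolding v1_def[abs_def]
    by (rule DERIV_divide[OF DERIV_diff[OF g_deriv DERIV_cmult[OF v_deriv[OF assms, unfolded v1_def]]] DERIV_ident])
       (use assms in simp)
  also have "((gd r - 2 * v1 r) * r - (g r - 2 * v r) * 1) / (r * r) = v2 r"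
    using assms by (simp add: v2_def diff_divide_distrib power2_eq_square)
  finally show ?thesis .
qed

lemma v_cont: "continuous_on {0<..} v" and v1_cont: "continuous_on {0<..} v1"
  by (intro continuous_at_imp_continuous_on ballI DERIV_isCont[OF v_deriv] DERIV_isCont[OF v1_deriv], simp)+

lemma v2_cont: "continuous_on {0<..} v2"
proof -
  have "continuous_on {0<..} g" "continuous_on {0<..} gd"
    by (rule continuous_on_subset[OF g_cont] continuous_on_subset[OF gd_cont], simp)+
  then show ?thesis
    unfolding v2_def[abs_def] by (intro continuous_intros v_cont v1_cont) auto
qed

lemma v_bound: assumes "0 < r" shows "\<bar>v r\<bar> \<le> 3 / 2"
proof -
  have "\<bar>m r\<bar> / r\<^sup>2 \<le> (3 / 2 * r\<^sup>2) / r\<^sup>2" using m_bound[of r] assms by (intro divide_right_mono) auto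
  then show ?thesis using assms by (simp add: v_eq abs_mult)
qed

lemma v1_bound: assumes "0 < r" shows "\<bar>r * v1 r\<bar> \<le> 6"
proof -
  have "r * v1 r = g r - 2 * v r" using assms by (simp add: v1_def)
  then show ?thesis using v_bound[OF assms] g_abs_le[of r] assms by simp
qed

lemma v_increment: assumes "1 \<le> a" "a \<le> b" "b \<le> a + w" shows "\<bar>v b - v a\<bar> \<le> 6 * w"
proof (cases "a = b")
  case False
  have "\<exists>z>a. z < b \<and> v b - v a = (b - a) * v1 z"
    by (rule MVT2) (use assms False v_deriv in auto)
  then obtain z where z: "a < z" "v b - v a = (b - a) * v1 z" by blast
  have "1 * \<bar>v1 z\<bar> \<le> z * \<bar>v1 z\<bar>" using z assms by (intro mult_right_mono) auto
  also have "\<dots> \<le> 6" using v1_bound[of z] z assms by (simp add: abs_mult)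
  finally have "\<bar>b - a\<bar> * \<bar>v1 z\<bar> \<le> w * 6" using assms w_pos by (intro mult_mono) auto
  then show ?thesis unfolding z(2) abs_mult by simp
qed (use w_pos in simp)

text \<open>The explicit core gives \<open>v 1 = g0 / 2 - w / 4\<close>, within
  \<open>11 * w\<close> of 1, and \<open>v\<close> changes by at most \<open>6 * w\<close> across
  the layer.\<close>

lemma v_inner: assumes "r \<in> {1..1 + w}" shows "\<bar>v r - 1\<bar> \<le> 22 * w"
proof -
  have "((\<lambda>\<rho>. \<rho> * g \<rho>) has_integral (g0 / 2 * 1\<^sup>2 - w / 4 * 1 ^ 4) - (g0 / 2 * 0\<^sup>2 - w / 4 * 0 ^ 4)) {0..1}"
    by (rule fundamental_theorem_of_calculus)
       (auto intro!: derivative_eq_intros simp: g_core p_def algebra_simps power2_eq_square power3_eq_cube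
         simp flip: has_real_derivative_iff_has_vector_derivative)
  then have "v 1 = g0 / 2 - w / 4" by (simp add: v_eq m_def integral_unique)
  then have "\<bar>v 1 - 1\<bar> \<le> 11 * w" using g0_bounds w_pos by (simp add: abs_le_iff)
  then show ?thesis using v_increment[of 1 r] assms w_pos by (simp add: abs_le_iff)
qed

text \<open>Zero total mass makes \<open>v\<close> vanish at \<open>R\<close>; this is the velocity
  0 at the outer jump in \<open>D0\<close>.\<close>

lemma v_outer: assumes "r \<in> {R - w..R}" shows "\<bar>v r\<bar> \<le> 22 * w"
proof -
  have "v R = 0" by (simp add: v_eq m_outside)
  then show ?thesis using v_increment[of r R] assms w_pos w_le R_bounds by simp
qed

section \<open>Variation and jumps of the vortex over the layers and between them\<close>

lemma gd_integral: assumes "a \<le> b" shows "(gd has_integral g b - g a) {a..b}"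
  by (rule fundamental_theorem_of_calculus[OF assms])
     (rule has_vector_derivative_at_within[OF g_deriv[unfolded has_real_derivative_iff_has_vector_derivative]])

lemma variation_decreasing:
  assumes "0 \<le> a" "a \<le> b" "b \<le> 6 / 5" shows "integral {a..b} (\<lambda>r. \<bar>gd r\<bar>) = g a - g b"
proof -
  have "integral {a..b} (\<lambda>r. \<bar>gd r\<bar>) = integral {a..b} (\<lambda>r. - gd r)"
    by (rule integral_cong) (use gd_nonpos assms in auto)
  then show ?thesis using integral_unique[OF has_integral_neg[OF gd_integral[OF assms(2)]]] by simp
qed

lemma variation_increasing:
  assumes "6 / 5 \<le> a" "a \<le> b" "b \<le> R" shows "integral {a..b} (\<lambda>r. \<bar>gd r\<bar>) = g b - g a"
proof -
  have "integral {a..b} (\<lambda>r. \<bar>gd r\<bar>) = integral {a..b} gd"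
    by (rule integral_cong) (use gd_nonneg assms in auto)
  then show ?thesis using integral_unique[OF gd_integral[OF assms(2)]] by simp
qed

lemma variation_across:
  assumes "0 \<le> a" "a \<le> 6 / 5" "6 / 5 \<le> b" "b \<le> R"
  shows "integral {a..b} (\<lambda>r. \<bar>gd r\<bar>) = g a + g b - 2 * g (6 / 5)"
proof -
  have "continuous_on UNIV (\<lambda>r. \<bar>gd r\<bar>)" by (intro continuous_intros gd_cont)
  from integral_split[OF this assms(2,3)] show ?thesis
    using variation_decreasing[of a "6 / 5"] variation_increasing[of "6 / 5" b] assms by simp
qed

text \<open>The profile falls to -2 at \<open>6 / 5\<close> and then rises to 0, so
  \<open>\<bar>g\<bar> \<le> 3\<close> bounds the variation by 7 when \<open>r \<le> 6 / 5\<close>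
  and by 3 otherwise.\<close>

lemma total_variation: assumes "0 < r" shows "integral {r..R} (\<lambda>s. \<bar>gd s\<bar>) \<le> 9"
proof -
  have "g (6 / 5) = - 2" using R_bounds w_le by (simp add: g_annulus q_def)
  moreover have "g R = 0" by (simp add: g_outside)
  ultimately show ?thesis
    using variation_across[of r R] variation_increasing[of r R] g_abs_le[of r] assms R_bounds
    by (cases "r \<le> 6 / 5"; cases "r \<le> R") (auto simp: abs_le_iff)
qed

lemma variation_core: assumes "0 < r" shows "integral {r..1} (\<lambda>s. \<bar>gd s\<bar>) \<le> 22 * w"
proof (cases "r \<le> 1")
  case True
  have "integral {r..1} (\<lambda>s. \<bar>gd s\<bar>) = w * (1 - r\<^sup>2)"
    using variation_decreasing[of r 1] assms True by (simp add: g_core p_def algebra_simps)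
  also have "\<dots> \<le> w * 1" using w_pos by (intro mult_left_mono) auto
  finally show ?thesis using w_pos by simp
qed (use w_pos in simp)

lemma variation_annulus: "integral {1 + w..R - w} (\<lambda>s. \<bar>gd s\<bar>) \<le> 22 * w"
proof -
  have "integral {1 + w..R - w} (\<lambda>s. \<bar>gd s\<bar>) = w / 2 * (1 + w - 6 / 5)\<^sup>2 + w / 2 * (R - w - 6 / 5)\<^sup>2"
    using variation_across[of "1 + w" "R - w"] R_bounds w_pos w_le by (simp add: g_annulus q_def)
  also have "\<dots> \<le> w / 2 * (3 / 2) + w / 2 * (3 / 2)"
    using R_bounds w_pos w_le by (intro add_mono mult_left_mono sq_le) auto
  finally show ?thesis using w_pos by simp
qed

lemma jump_inner: "\<bar>integral {1..1 + w} gd - (- 4)\<bar> \<le> 22 * w"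
proof -
  have "integral {1..1 + w} gd = - 2 + w / 2 * (1 + w - 6 / 5)\<^sup>2 - (g0 - w)"
    using integral_unique[OF gd_integral[of 1 "1 + w"]] R_bounds w_pos w_le
    by (simp add: g_annulus g_core q_def p_def)
  moreover have "w / 2 * (1 + w - 6 / 5)\<^sup>2 \<le> w / 2 * (3 / 2)"
    using R_bounds w_pos w_le by (intro mult_left_mono sq_le) auto
  moreover have "0 \<le> w / 2 * (1 + w - 6 / 5)\<^sup>2" using w_pos by simp
  ultimately show ?thesis using g0_bounds w_pos unfolding abs_le_iff by linarith
qed

lemma jump_outer: "\<bar>integral {R - w..R} gd - 2\<bar> \<le> 22 * w"
proof -
  have "integral {R - w..R} gd = 2 - w / 2 * (R - w - 6 / 5)\<^sup>2"
  proof -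
    have "g R = 0" by (rule g_outside) (rule order_refl)
    moreover have "g (R - w) = - q (R - w)"
      by (rule g_annulus) (use R_bounds w_le in linarith, rule order_refl)
    ultimately show ?thesis using integral_unique[OF gd_integral[of "R - w" R]] w_pos by (simp add: q_def)
  qed
  moreover have "w / 2 * (R - w - 6 / 5)\<^sup>2 \<le> w / 2 * (3 / 2)"
    using R_bounds w_pos w_le by (intro mult_left_mono sq_le) auto
  moreover have "0 \<le> w / 2 * (R - w - 6 / 5)\<^sup>2" using w_pos by simp
  ultimately show ?thesis using w_pos unfolding abs_le_iff by linarith
qed

text \<open>The core is exactly quadratic, which gives linear vanishing at 0; on the rest of the
  support compactness suffices. The constant may blow up as \<open>w\<close> shrinks, but it enters
  only the rates at the origin and not the smallness condition.\<close>

lemma gd_linear_bound: obtains k where "\<And>r. 0 < r \<Longrightarrow> \<bar>gd r\<bar> \<le> k * r"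
proof -
  have "compact (gd ` {1..R})"
    by (rule compact_continuous_image[OF continuous_on_subset[OF gd_cont subset_UNIV] compact_Icc])
  then have "\<exists>b. \<forall>r\<in>{1..R}. \<bar>gd r\<bar> \<le> b"
    by (auto dest!: compact_imp_bounded simp: bounded_iff)
  then obtain b where b: "\<And>r. r \<in> {1..R} \<Longrightarrow> \<bar>gd r\<bar> \<le> b" by blast
  define k where "k = max (2 * w) (max b 0)"
  have "\<bar>gd r\<bar> \<le> k * r" if r: "0 < r" for r
  proof -
    consider "r \<le> 1" | "1 \<le> r" "r \<le> R" | "R \<le> r" by linarith
    then show ?thesis
    proof cases
      case 1
      have "2 * w * r \<le> k * r" using r by (intro mult_right_mono) (auto simp: k_def)
      then show ?thesis using 1 r w_pos by (simp add: gd_core abs_mult)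
    next
      case 2
      have "b \<le> k" "0 \<le> k" by (auto simp: k_def)
      moreover from this have "k * 1 \<le> k * r" using 2 by (intro mult_left_mono) auto
      ultimately show ?thesis using b[of r] 2 by simp
    next
      case 3
      then show ?thesis using r by (simp add: gd_outside k_def)
    qed
  qed
  then show thesis by (rule that)
qed

end

section \<open>Unstable modes\<close>

context vortex_profile
begin

text \<open>Undoes the substitution: \<open>u\<close>, \<open>y\<close> and \<open>h\<close>
  determine \<open>\<phi>\<close> and its derivatives up to \<open>\<phi>2\<close>. The number
  \<open>416\<close> is \<open>32 + 64 * 6\<close>, with \<open>6\<close> the bound for
  \<open>r * v1 r\<close>, and \<open>22 * w\<close> bounds all deviations from the step
  profile.\<close>

lemma rayleigh_solution_exists:
  fixes \<alpha> \<beta> :: real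
  assumes B: "0 < \<alpha> * \<beta>" and small: "80000 * exp 36 * (22 * w + 416 / (\<alpha> * \<beta>)) \<le> 1 / 50"
  shows "\<exists>\<phi>\<in>Hdot1. \<exists>\<mu>. \<not> (AE r in lebesgue_on {0<..}. \<phi> r = 0) \<and> 3 / 8 \<le> Re \<mu> \<and>
    solves_rayleigh \<alpha> \<beta> g 2 \<phi> \<mu>"
proof -
  define B where "B = \<alpha> * \<beta>"
  \<comment> \<open>Near 0 the quotient \<open>v x / x\<close> is not integrable, as
    \<open>v\<close> tends to \<open>g0 / 2\<close>; hence an antiderivative on the open half-line
    instead of an integral from 0.\<close>
  have "\<exists>A. \<forall>x. 0 < ereal x \<longrightarrow> ereal x < \<infinity> \<longrightarrow> (A has_vector_derivative v x / x) (at x)"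
  proof (rule einterval_antiderivative)
    show "isCont (\<lambda>x. v x / x) x" if "0 < ereal x" for x
      using that DERIV_isCont[OF v_deriv, of x] by (intro continuous_intros) auto
  qed simp
  then obtain A where A: "\<And>x. 0 < x \<Longrightarrow> (A has_real_derivative v x / x) (at x)"
    by (auto simp: has_real_derivative_iff_has_vector_derivative)
  interpret sh: shooting gd v A R B "1 / 4"
    by unfold_locales (use R_bounds B A v_cont gd_cont gd_outside in \<open>auto simp: B_def\<close>)
  obtain k where k: "\<And>r. 0 < r \<Longrightarrow> \<bar>gd r\<bar> \<le> k * r" using gd_linear_bound by blast
  have "80000 * exp 36 * (22 * w) \<le> 80000 * exp 36 * (22 * w + 416 / (\<alpha> * \<beta>))"
    using B by (intro mult_left_mono) auto
  then have "80000 * exp 36 * (22 * w) \<le> 1 / 50" using small by linarith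
  moreover have "1 * (22 * w) \<le> 80000 * exp 36 * (22 * w)"
    using w_pos exp_ge_add_one_self[of 36] by (intro mult_right_mono) auto
  ultimately have w': "22 * w \<le> 1 / 10" by linarith
  have small': "80000 * exp 36 * (22 * w + (32 + 64 * 6) / B) \<le> 1 / 50"
    using small by (simp add: B_def)
  obtain c u C where c: "3 / 8 \<le> Re c" and uc: "continuous_on {0<..} u"
    and uT: "\<And>r. 0 < r \<Longrightarrow> u r = sh.T c u r"
    and u3: "\<And>r. 0 < r \<Longrightarrow> norm (u r) \<le> C * r ^ 3" and yC: "\<And>r. 0 < r \<Longrightarrow> norm (sh.y c u r) \<le> C / r"
    by (rule sh.decaying_solution_exists[of w "22 * w" v1 6 k])
       (use R_def w_pos w' total_variation variation_core variation_annulus jump_inner jump_outer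
         v_inner v_outer v_deriv v1_cont v1_bound k small' in auto)
  \<comment> \<open>With all powers of \<open>r\<close> written through \<open>z\<close>, the
    bookkeeping of half-integer exponents reduces to \<open>z_mult\<close>.\<close>
  define z where "z a r = complex_of_real (r powr a)" for a r
  define \<phi> where "\<phi> r = z (- 3 / 2) r * u r" for r
  define \<phi>1 where "\<phi>1 r = z (3 / 2) r * sh.y c u r - 3 / 2 * (z (- 5 / 2) r * u r)" for r
  define \<phi>2 where "\<phi>2 r = z (- 1 / 2) r * sh.h c u r + 15 / 4 * (z (- 7 / 2) r * u r)" for r
  define h' where "h' r = of_real (B / r) * ((2 * \<i> * of_real (v r) + c) * sh.h c u r - 2 * \<i> * of_real (gd r / r\<^sup>2) * u r)" for r
  define w1 where "w1 r = z (- 1 / 2) r * h' r - 1 / 2 * (z (- 3 / 2) r * sh.h c u r)" for r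
  have z_deriv: "(z a has_vector_derivative of_real a * z (a - 1) r) (at r)" if "0 < r" for a r
  proof -
    have "((\<lambda>r. r powr a) has_real_derivative a * r powr (a - 1)) (at r)"
      using that by (auto intro!: derivative_eq_intros)
    from has_vector_derivative_of_real[OF this] show ?thesis by (simp add: z_def[abs_def])
  qed
  have z_mult: "z a r * z b r = z (a + b) r" for a b r by (simp add: z_def powr_add)
  have z_pow: "of_real (r ^ n) = z (real n) r" if "0 < r" for r n using that by (simp add: z_def powr_realpow)
  have z_inv: "of_real (1 / r ^ n) = z (- real n) r" if "0 < r" for r n
    using that by (simp add: z_def powr_minus powr_realpow divide_inverse)
  have z_cont: "continuous_on {0<..} (z a)" for a
    by (rule continuous_on_has_vector_derivative, rule z_deriv) simp
  have u_deriv: "(u has_vector_derivative of_real (r ^ 3) * sh.y c u r) (at r)" if "0 < r" for r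
    by (rule has_vector_derivative_transform_within_open[OF sh.T_deriv[OF uc that], of "{0<..}"])
       (use that uT in auto)
  have d1: "(\<phi> has_vector_derivative \<phi>1 r) (at r)" if "0 < r" for r
  proof -
    have D: "(\<phi> has_vector_derivative z (- 3 / 2) r * (of_real (r ^ 3) * sh.y c u r) + of_real (- 3 / 2) * z (- 3 / 2 - 1) r * u r) (at r)"
      unfolding \<phi>_def[abs_def] by (intro has_vector_derivative_mult z_deriv u_deriv that)
    have e: "z (- 3 / 2) r * (of_real (r ^ 3) * sh.y c u r) = z (3 / 2) r * sh.y c u r"
      unfolding z_pow[OF that] mult.assoc[symmetric] z_mult by simp
    have E: "z (- 3 / 2) r * (of_real (r ^ 3) * sh.y c u r) + of_real (- 3 / 2) * z (- 3 / 2 - 1) r * u r = \<phi>1 r"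
      unfolding e \<phi>1_def by simp
    show ?thesis using D unfolding E .
  qed
  have d2: "(\<phi>1 has_vector_derivative \<phi>2 r) (at r)" if "0 < r" for r
  proof -
    have D: "(\<phi>1 has_vector_derivative (z (3 / 2) r * (of_real (1 / r\<^sup>2) * sh.h c u r) + of_real (3 / 2) * z (3 / 2 - 1) r * sh.y c u r)
       - 3 / 2 * (z (- 5 / 2) r * (of_real (r ^ 3) * sh.y c u r) + of_real (- 5 / 2) * z (- 5 / 2 - 1) r * u r)) (at r)"
      unfolding \<phi>1_def[abs_def]
      by (intro has_vector_derivative_diff has_vector_derivative_mult_right has_vector_derivative_mult z_deriv u_deriv sh.y_deriv uc that)
    have e1: "z (3 / 2) r * (of_real (1 / r\<^sup>2) * sh.h c u r) = z (- 1 / 2) r * sh.h c u r"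
      unfolding z_inv[OF that] mult.assoc[symmetric] z_mult by simp
    have e2: "z (- 5 / 2) r * (of_real (r ^ 3) * sh.y c u r) = z (1 / 2) r * sh.y c u r"
      unfolding z_pow[OF that] mult.assoc[symmetric] z_mult by simp
    have E: "(z (3 / 2) r * (of_real (1 / r\<^sup>2) * sh.h c u r) + of_real (3 / 2) * z (3 / 2 - 1) r * sh.y c u r)
       - 3 / 2 * (z (- 5 / 2) r * (of_real (r ^ 3) * sh.y c u r) + of_real (- 5 / 2) * z (- 5 / 2 - 1) r * u r) = \<phi>2 r"
      unfolding e1 e2 \<phi>2_def by (simp add: algebra_simps)
    show ?thesis using D unfolding E .
  qed
  \<comment> \<open>The terms with \<open>u\<close> cancel because
    \<open>15 / 4 = 3 / 2 * (5 / 2)\<close>, that is, \<open>r powr (-3/2)\<close> is annihilated by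
    \<open>L_2\<close>; only \<open>h\<close> survives.\<close>
  have w_eq: "\<phi>2 r - of_real (1 / r\<^sup>2 * ((of_int 2)\<^sup>2 - 1/4)) * \<phi> r = z (- 1 / 2) r * sh.h c u r" if "0 < r" for r
  proof -
    have "of_real (1 / r\<^sup>2 * ((of_int 2)\<^sup>2 - 1/4)) * \<phi> r = 15 / 4 * (of_real (1 / r\<^sup>2) * z (- 3 / 2) r * u r)"
      by (simp add: \<phi>_def)
    also have "of_real (1 / r\<^sup>2) * z (- 3 / 2) r = z (- 7 / 2) r"
      unfolding z_inv[OF that] z_mult by simp
    finally show ?thesis by (simp add: \<phi>2_def)
  qed
  have h'_deriv: "(sh.h c u has_vector_derivative h' r) (at r)" if "0 < r" for r
    unfolding h'_def by (rule sh.h_deriv[OF uc that])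
  have d3: "((\<lambda>r. \<phi>2 r - of_real (1 / r\<^sup>2 * ((of_int 2)\<^sup>2 - 1/4)) * \<phi> r) has_vector_derivative w1 r) (at r)" if "0 < r" for r
  proof (rule has_vector_derivative_transform_within_open[of _ _ _ "{0<..}"])
    have "((\<lambda>r. z (- 1 / 2) r * sh.h c u r) has_vector_derivative z (- 1 / 2) r * h' r + of_real (- 1 / 2) * z (- 1 / 2 - 1) r * sh.h c u r) (at r)"
      by (intro has_vector_derivative_mult z_deriv h'_deriv that)
    moreover have "z (- 1 / 2) r * h' r + of_real (- 1 / 2) * z (- 1 / 2 - 1) r * sh.h c u r = w1 r"
      by (simp add: w1_def)
    ultimately show "((\<lambda>r. z (- 1 / 2) r * sh.h c u r) has_vector_derivative w1 r) (at r)" by (simp only:)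
  qed (use that w_eq in auto)
  have w1c: "continuous_on {0<..} w1"
    unfolding w1_def h'_def
    by (intro continuous_intros z_cont sh.h_cont uc v_cont continuous_on_subset[OF gd_cont]) auto
  have \<phi>1c: "continuous_on {0<..} \<phi>1" by (rule continuous_on_has_vector_derivative, rule d2) simp
  have C0: "0 \<le> C" using order_trans[OF norm_ge_zero u3[of 1]] by simp
  have u1: "u r = 1" if "R \<le> r" for r using uT[of r] sh.T_supp[OF that] that R_bounds by simp
  have y0: "sh.y c u r = 0" if "R \<le> r" for r by (rule sh.y_supp[OF that])
  have nz: "norm (z a r) = r powr a" for a r by (simp add: z_def)
  have b_near: "norm (\<phi> r) \<le> C * r powr (3 / 2)" if "0 < r" for r
  proof -
    have "norm (\<phi> r) \<le> r powr (- 3 / 2) * (C * r ^ 3)"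
      unfolding \<phi>_def norm_mult nz by (intro mult_left_mono u3 that) simp
    also have "r ^ 3 = r powr 3" using that by (simp add: powr_numeral)
    also have "r powr (- 3 / 2) * (C * r powr 3) = C * r powr (3 / 2)"
      by (simp add: mult.left_commute flip: powr_add)
    finally show ?thesis .
  qed
  have b1_near: "norm (\<phi>1 r) \<le> 5 / 2 * C * r powr (1 / 2)" if "0 < r" for r
  proof -
    have "norm (\<phi>1 r) \<le> norm (z (3 / 2) r * sh.y c u r) + norm (3 / 2 * (z (- 5 / 2) r * u r))"
      unfolding \<phi>1_def by (rule norm_triangle_ineq4)
    also have "\<dots> \<le> r powr (3 / 2) * (C / r) + 3 / 2 * (r powr (- 5 / 2) * (C * r ^ 3))"
    proof (rule add_mono)
      show "norm (z (3 / 2) r * sh.y c u r) \<le> r powr (3 / 2) * (C / r)"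
        unfolding norm_mult nz by (rule mult_left_mono[OF yC[OF that]]) simp
      have "norm (3 / 2 * (z (- 5 / 2) r * u r)) = 3 / 2 * (r powr (- 5 / 2) * norm (u r))"
        unfolding norm_mult nz by simp
      also have "\<dots> \<le> 3 / 2 * (r powr (- 5 / 2) * (C * r ^ 3))"
        using u3[OF that] by (intro mult_left_mono) auto
      finally show "norm (3 / 2 * (z (- 5 / 2) r * u r)) \<le> 3 / 2 * (r powr (- 5 / 2) * (C * r ^ 3))" .
    qed
    also have "C / r = C * r powr (- 1)" using that by (simp add: powr_minus divide_inverse)
    also have "r ^ 3 = r powr 3" using that by (simp add: powr_numeral)
    also have "r powr (3 / 2) * (C * r powr (- 1)) = C * r powr (3 / 2 + - 1)"
      unfolding powr_add by (rule mult.left_commute)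
    also have "r powr (- 5 / 2) * (C * r powr 3) = C * r powr (- 5 / 2 + 3)"
      unfolding powr_add by (rule mult.left_commute)
    finally show ?thesis by simp
  qed
  have R1: "1 \<le> R" "R \<le> 2" using R_bounds by auto
  have powr_le: "r powr a \<le> 2" if "0 < r" "r \<le> R" "0 \<le> a" "a \<le> 1" for r a
  proof -
    have "r powr a \<le> R powr a" using that by (intro powr_mono2) auto
    also have "\<dots> \<le> R powr 1" using that R1 by (intro powr_mono) auto
    finally show ?thesis using R1 by simp
  qed
  have powr_far: "r powr a \<le> r powr b" if "R \<le> r" "a \<le> b" for r a b
    using that R1 by (intro powr_mono) auto
  define C' where "C' = 5 * C + 3 / 2"
  have "\<phi> \<in> Hdot1"
  proof (rule Hdot1I[OF d1 \<phi>1c, of R C'])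
    show "norm (\<phi> r) \<le> C' * r" if "0 < r" "r \<le> R" for r
    proof -
      have "C * r powr (3 / 2) = C * (r * r powr (1 / 2))" using that powr_add[of r 1 "1 / 2"] by simp
      also have "\<dots> \<le> C * (r * 2)" using that C0 powr_le[of r "1 / 2"] by (intro mult_left_mono) auto
      also have "\<dots> \<le> C' * r" using C0 that by (simp add: C'_def algebra_simps)
      finally show ?thesis using b_near[OF that(1)] by simp
    qed
    show "norm (\<phi> r) \<le> C'" if "R \<le> r" for r
    proof -
      have "norm (\<phi> r) \<le> r powr 0" unfolding \<phi>_def u1[OF that] norm_mult nz using powr_far[OF that, of "- 3 / 2" 0] by simp
      then show ?thesis using C0 that R1 by (simp add: C'_def)
    qed
    show "norm (\<phi>1 r) \<le> C'" if "0 < r" "r \<le> R" for r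
    proof -
      have "5 / 2 * C * r powr (1 / 2) \<le> 5 / 2 * C * 2" using powr_le[of r "1 / 2"] that C0 by (intro mult_left_mono) auto
      then show ?thesis using b1_near[OF that(1)] by (simp add: C'_def)
    qed
    show "norm (\<phi>1 r) \<le> C' / r" if "R \<le> r" for r
    proof -
      have "norm (\<phi>1 r) = 3 / 2 * r powr (- 5 / 2)"
        unfolding \<phi>1_def u1[OF that] y0[OF that] by (simp add: norm_mult nz)
      also have "\<dots> \<le> 3 / 2 * r powr (- 1)" using powr_far[OF that, of "- 5 / 2" "- 1"] by simp
      also have "\<dots> \<le> C' * r powr (- 1)" using C0 by (intro mult_right_mono) (auto simp: C'_def)
      finally show ?thesis using that R1 by (simp add: powr_minus divide_inverse)
    qed
  qed (use R1 in auto)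
  moreover have "\<not> (AE r in lebesgue_on {0<..}. \<phi> r = 0)"
  proof
    assume "AE r in lebesgue_on {0<..}. \<phi> r = 0"
    then have "AE r in lebesgue. r \<in> {0<..} \<longrightarrow> \<phi> r = 0" by (subst (asm) AE_restrict_space_iff) auto
    then have "negligible {r. \<not> (r \<in> {0<..} \<longrightarrow> \<phi> r = 0)}"
      by (simp add: eventually_ae_filter_negligible) (metis negligible_subset)
    \<comment> \<open>Outside the support \<open>u = 1\<close>, so \<open>\<phi>\<close> has no zero
      on this interval of positive length.\<close>
    moreover have "{R<..<R + 1} \<subseteq> {r. \<not> (r \<in> {0<..} \<longrightarrow> \<phi> r = 0)}"
      using R1 u1 by (auto simp: \<phi>_def z_def)
    ultimately have "negligible {R<..<R + 1}" by (rule negligible_subset)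
    then show False using non_negligible_UNIV open_not_negligible[of "{R<..<R + 1}"] by auto
  qed
  moreover have "solves_rayleigh \<alpha> \<beta> g 2 \<phi> c"
  proof (rule solves_rayleighI[OF _ _ d1 d2 d3 w1c v_deriv v1_deriv v2_cont])
    show "(\<phi> \<longlongrightarrow> 0) (at_right 0)"
    proof (rule Lim_null_comparison)
      show "\<forall>\<^sub>F r in at_right 0. norm (\<phi> r) \<le> C * r powr (3 / 2)"
        using b_near by (auto simp: eventually_at_filter)
      have "((\<lambda>r. C * r powr (3 / 2)) \<longlongrightarrow> C * 0 powr (3 / 2)) (at_right 0)"
        by (intro tendsto_intros) (auto simp: eventually_at_filter)
      then show "((\<lambda>r. C * r powr (3 / 2)) \<longlongrightarrow> 0) (at_right 0)" by simp
    qed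
    show "(\<phi> \<longlongrightarrow> 0) at_top"
    proof (rule Lim_null_comparison)
      show "\<forall>\<^sub>F r in at_top. norm (\<phi> r) \<le> r powr (- 3 / 2)"
        using eventually_ge_at_top[of R] by eventually_elim (simp add: \<phi>_def u1 norm_mult nz)
      show "((\<lambda>r :: real. r powr (- 3 / 2)) \<longlongrightarrow> 0) at_top"
        by (rule tendsto_neg_powr) (auto intro: filterlim_ident)
    qed
    have "continuous_on {0<..} gd" by (rule continuous_on_subset[OF gd_cont]) simp
    then show "continuous_on {0<..} (rderiv g)" by (rule continuous_on_eq) (simp add: rderiv_g)
    fix r :: real assume r: "0 < r"
    have "1 / (\<alpha> * \<beta>) = 1 / B" by (simp add: B_def)
    \<comment> \<open>The derivative of the weight \<open>r powr (-1/2)\<close> cancels the summand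
      \<open>1/2\<close>, so only \<open>h'\<close> is left.\<close>
    have "of_real r * w1 r + 1 / 2 * (z (- 1 / 2) r * sh.h c u r) = of_real r * z (- 1 / 2) r * h' r"
    proof -
      have "of_real r * z (- 3 / 2) r = z (- 1 / 2) r"
        using z_pow[OF r, of 1] z_mult[of 1 r "- 3 / 2"] by simp
      then show ?thesis by (simp add: w1_def algebra_simps)
    qed
    also have "\<dots> = of_real B * (z (- 1 / 2) r * ((2 * \<i> * of_real (v r) + c) * sh.h c u r - 2 * \<i> * of_real (gd r / r\<^sup>2) * u r))"
      unfolding h'_def using r by simp
    finally have e1: "of_real (1 / (\<alpha> * \<beta>)) * (of_real r * w1 r + 1 / 2 * (z (- 1 / 2) r * sh.h c u r)) =
       z (- 1 / 2) r * ((2 * \<i> * of_real (v r) + c) * sh.h c u r - 2 * \<i> * of_real (gd r / r\<^sup>2) * u r)"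
      unfolding \<open>1 / (\<alpha> * \<beta>) = 1 / B\<close> using sh.B_pos by simp
    have e3: "of_real (gd r / r) * \<phi> r = of_real (gd r / r\<^sup>2) * z (- 1 / 2) r * u r"
    proof -
      have "z (- 3 / 2) r = of_real (1 / r) * z (- 1 / 2) r"
        using z_inv[OF r, of 1] z_mult[of "- 1" r "- 1 / 2"] by simp
      then show ?thesis by (simp add: \<phi>_def power2_eq_square)
    qed
    have e2: "\<i> * of_int 2 * of_real (rderiv g r / r) * \<phi> r = z (- 1 / 2) r * (2 * \<i> * of_real (gd r / r\<^sup>2) * u r)"
      unfolding rderiv_g[OF less_imp_le[OF r]] mult.assoc[of _ _ "\<phi> r"] e3 by (simp only: of_int_numeral mult_ac)
    show "(\<i> * of_int 2 * of_real (v r) + c) * (\<phi>2 r - of_real (1 / r\<^sup>2 * ((of_int 2)\<^sup>2 - 1/4)) * \<phi> r)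
      - of_real (1 / (\<alpha> * \<beta>)) * (of_real r * w1 r + 1/2 * (\<phi>2 r - of_real (1 / r\<^sup>2 * ((of_int 2)\<^sup>2 - 1/4)) * \<phi> r))
      - \<i> * of_int 2 * of_real (rderiv g r / r) * \<phi> r = 0"
      unfolding w_eq[OF r] e1 e2 by (simp add: algebra_simps)
  qed
  ultimately show ?thesis using c by blast
qed

end

theorem theorem2p3:
  fixes \<alpha> :: real
  assumes "0 < \<alpha>" and "\<alpha> < 2"
  shows "\<exists>g\<in>vortex_class. \<exists>k::int. \<exists>\<epsilon>::real. \<exists>\<beta>\<^sub>0::real.
           2 \<le> \<bar>k\<bar> \<and> 0 < \<epsilon> \<and> \<epsilon> < 1 \<and> 0 < \<beta>\<^sub>0 \<and>
           (\<forall>\<beta>\<ge>\<beta>\<^sub>0. \<exists>\<phi>\<in>Hdot1. \<exists>\<mu>::complex.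
              \<not> (AE r in lebesgue_on {0<..}. \<phi> r = 0) \<and>
              \<epsilon> / 2 < Re \<mu> \<and>
              solves_rayleigh \<alpha> \<beta> g k \<phi> \<mu>)"
proof -
  define E :: real where "E = 80000 * exp 36"
  have E: "1 \<le> E" using exp_ge_add_one_self[of 36] by (simp add: E_def)
  \<comment> \<open>Half of the error budget \<open>1 / 50\<close>: this choice makes
    \<open>E * (22 * w)\<close> equal to \<open>1 / 100\<close>.\<close>
  define w where "w = 1 / (2200 * E)"
  obtain s s' :: "real \<Rightarrow> real" where s: "smooth_on UNIV s" "\<And>x. (s has_real_derivative s' x) (at x)" "continuous_on UNIV s'"
      "\<And>x. x \<le> 0 \<Longrightarrow> s x = 0" "\<And>x. 1 \<le> x \<Longrightarrow> s x = 1" "\<And>x. 0 \<le> s' x"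
    using smooth_step_exists by blast
  have w: "0 < w" "w \<le> 1 / 100" using E by (auto simp: w_def field_simps)
  interpret vortex_profile s s' w by unfold_locales (use s w in auto)
  \<comment> \<open>The other half: for \<open>\<beta> \<ge> \<beta>\<^sub>0\<close> the term
    \<open>E * (416 / (\<alpha> * \<beta>))\<close> is at most \<open>1 / 100\<close>. The vortex
    has been fixed before, independently of \<open>\<beta>\<close>.\<close>
  define \<beta>\<^sub>0 where "\<beta>\<^sub>0 = 41600 * E / \<alpha>"
  have \<beta>0: "0 < \<beta>\<^sub>0" using E assms by (simp add: \<beta>\<^sub>0_def)
  have "\<exists>\<phi>\<in>Hdot1. \<exists>\<mu>. \<not> (AE r in lebesgue_on {0<..}. \<phi> r = 0) \<and> (1 / 2) / 2 < Re \<mu> \<and> solves_rayleigh \<alpha> \<beta> g 2 \<phi> \<mu>"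
    if \<beta>: "\<beta>\<^sub>0 \<le> \<beta>" for \<beta>
  proof -
    have B: "41600 * E \<le> \<alpha> * \<beta>" using \<beta> assms(1) by (simp add: \<beta>\<^sub>0_def field_simps)
    then have B0: "0 < \<alpha> * \<beta>" using E by simp
    have "E * (416 / (\<alpha> * \<beta>)) \<le> 1 / 100" using B B0 by (simp add: field_simps)
    moreover have "E * (22 * w) = 1 / 100" using E by (simp add: w_def)
    ultimately have "E * (22 * w + 416 / (\<alpha> * \<beta>)) \<le> 1 / 50" by (simp add: distrib_left)
    from rayleigh_solution_exists[OF B0 this[unfolded E_def]] show ?thesis by fastforce
  qed
  then show ?thesis
    \<comment> \<open>The witness \<open>1 / 2\<close> for \<open>\<epsilon>\<close> asks for a real
      part above \<open>1 / 4\<close>, while the eigenvalue found has at least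
      \<open>3 / 8\<close>.\<close>
    using \<beta>0 by (intro bexI[OF _ g_in_vortex_class] exI[of _ 2] exI[of _ "1 / 2"] exI[of _ \<beta>\<^sub>0]) auto
qed

end
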